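(* Let $\mathcal{H}$ be a separable complex Hilbert space, let $2\leq p<\infty$ with conjugate exponent $p'=\frac{p}{p-1}$, and let $(T_j)_{j\geq 1}\subset S_p(\mathcal{H})$ satisfy $\sum_{j=1}^{\infty}\|T_j\|_{S_p}^p<\infty$. Let $(\alpha_{ij})_{i,j\geq 1}$ be a symmetric infinite matrix with entries $\alpha_{ij}\in[0,1]$ such that for all $i,j\geq 1$ $$\|T_i T_j^{*}\|_{S_{p/2}}\leq \alpha_{ij}^{2}\,\|T_i\|_{S_p}\|T_j\|_{S_p}\quad\text{and}\quad \|T_i^{*}T_j\|_{S_{p/2}}\leq \alpha_{ij}^{2}\,\|T_i\|_{S_p}\|T_j\|_{S_p}.$$ Assume moreover that the matrix $(\alpha_{ij}^{p'})_{i,j\geq 1}$ (entrywise powers) defines a bounded operator on $\ell_2(\mathbb{N})$, i.e. $\bigl\|(\alpha_{ij}^{p'})_{i,j\geq1}\bigr\|_{\ell_2(\mathbb{N})\to\ell_2(\mathbb{N})}<\infty$. Then the series $\sum_{j=1}^{\infty}T_j$ converges in $S_p(\mathcal{H})$, and $$\Bigl\|\sum_{j=1}^{\infty}T_j\Bigr\|_{S_p}\leq \bigl\|(\alpha_{ij}^{p'})_{i,j\geq1}\bigr\|_{\ell_2(\mathbb{N})\to\ell_2(\mathbb{N})}^{1/p'}\Bigl(\sum_{j=1}^{\infty}\|T_j\|_{S_p}^p\Bigr)^{1/p}.$$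
   Context: For $1\leq q<\infty$, $S_q=S_q(\mathcal{H})$ denotes the Schatten--von Neumann class of compact operators $T$ on $\mathcal{H}$ with $\|T\|_{S_q}=\bigl(\sum_k\lambda_k^q\bigr)^{1/q}<\infty$, where $(\lambda_k)$ are the singular values of $T$, i.e. the eigenvalues (with multiplicity) of $|T|=\sqrt{T^*T}$. Convergence of the series in $S_p(\mathcal{H})$ means convergence of the partial sums $\sum_{j=1}^n T_j$ in the norm $\|\cdot\|_{S_p}$. *)

theory Defs
  imports "HOL-Analysis.Analysis"
begin

section \<open>Complex Hilbert spaces\<close>

text \<open>The inner product is linear in the first and conjugate-linear in the second argument.\<close>

class complex_hilbert = banach +
  fixes scaleC :: "complex \<Rightarrow> 'a \<Rightarrow> 'a"  (infixr "*\<^sub>C" 75)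
    and cinner :: "'a \<Rightarrow> 'a \<Rightarrow> complex"
  assumes scaleC_add_right: "c *\<^sub>C (x + y) = c *\<^sub>C x + c *\<^sub>C y"
    and scaleC_add_left: "(c + d) *\<^sub>C x = c *\<^sub>C x + d *\<^sub>C x"
    and scaleC_scaleC: "c *\<^sub>C (d *\<^sub>C x) = (c * d) *\<^sub>C x"
    and scaleC_of_real: "complex_of_real r *\<^sub>C x = r *\<^sub>R x"
    and cinner_commute: "cinner y x = cnj (cinner x y)"
    and cinner_add_left: "cinner (x + y) z = cinner x z + cinner y z"
    and cinner_scaleC_left: "cinner (c *\<^sub>C x) y = c * cinner x y"
    and cinner_self: "cinner x x = complex_of_real ((norm x)\<^sup>2)"

instantiation complex :: complex_hilbert
begin

definition "scaleC c (x :: complex) = c * x"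
definition "cinner (x :: complex) y = x * cnj y"

instance
proof
  fix x :: complex
  show "cinner x x = complex_of_real ((norm x)\<^sup>2)"
    unfolding cinner_complex_def by (rule complex_norm_square [symmetric])
qed (simp_all add: scaleC_complex_def cinner_complex_def algebra_simps scaleR_conv_of_real)

end

global_interpretation complex_vector:
  vector_space "scaleC :: complex \<Rightarrow> 'a \<Rightarrow> 'a :: complex_hilbert"
proof
  fix x :: 'a
  show "1 *\<^sub>C x = x"
    using scaleC_of_real[of 1 x] by simp
qed (simp_all add: scaleC_add_right scaleC_add_left scaleC_scaleC)

abbreviation clinear :: "('a::complex_hilbert \<Rightarrow> 'b::complex_hilbert) \<Rightarrow> bool"
  where "clinear \<equiv> Vector_Spaces.linear scaleC scaleC"


section \<open>Operators\<close>

definition compact_operator :: "('a::complex_hilbert \<Rightarrow> 'a) \<Rightarrow> bool"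
  where "compact_operator T \<longleftrightarrow> clinear T \<and> compact (closure (T ` cball 0 1))"

definition cadjoint :: "('a::complex_hilbert \<Rightarrow> 'a) \<Rightarrow> 'a \<Rightarrow> 'a"
  where "cadjoint T = (SOME T'. \<forall>x y. cinner (T x) y = cinner x (T' y))"

definition positive_operator :: "('a::complex_hilbert \<Rightarrow> 'a) \<Rightarrow> bool"
  where "positive_operator S \<longleftrightarrow>
    clinear S \<and> bounded_linear S \<and> (\<forall>x. cinner (S x) x \<in> \<real>\<^sub>\<ge>\<^sub>0)"

definition abs_operator :: "('a::complex_hilbert \<Rightarrow> 'a) \<Rightarrow> 'a \<Rightarrow> 'a"
  where "abs_operator T = (THE S. positive_operator S \<and> S \<circ> S = cadjoint T \<circ> T)"

definition eigenspace :: "('a::complex_hilbert \<Rightarrow> 'a) \<Rightarrow> complex \<Rightarrow> 'a set"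
  where "eigenspace T \<mu> = {x. T x = \<mu> *\<^sub>C x}"

text \<open>The value 0 is left out: it contributes nothing to the sums below.\<close>

definition nonzero_singular_values :: "('a::complex_hilbert \<Rightarrow> 'a) \<Rightarrow> real set"
  where "nonzero_singular_values T =
    {\<mu>. \<mu> > 0 \<and> eigenspace (abs_operator T) (complex_of_real \<mu>) \<noteq> {0}}"

definition singular_value_mult :: "('a::complex_hilbert \<Rightarrow> 'a) \<Rightarrow> real \<Rightarrow> nat"
  where "singular_value_mult T \<mu> =
    complex_vector.dim (eigenspace (abs_operator T) (complex_of_real \<mu>))"


section \<open>Schatten--von Neumann classes\<close>

text \<open>
  The sum of the \<open>q\<close>-th powers of the singular values, each distinct value being
  weighted with its multiplicity. For compact \<open>T\<close> these multiplicities are finite,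
  so the convention that \<open>dim\<close> is 0 on infinite-dimensional spaces plays no role.
\<close>

definition schatten_power_sum :: "real \<Rightarrow> ('a::complex_hilbert \<Rightarrow> 'a) \<Rightarrow> ennreal"
  where "schatten_power_sum q T =
    (\<Sum>\<^sub>\<infinity>\<mu>\<in>nonzero_singular_values T. of_nat (singular_value_mult T \<mu>) * ennreal (\<mu> powr q))"

text \<open>
  The norm with value \<open>\<infinity>\<close> outside the Schatten class, so that an upper bound by a
  real number entails membership, and its real-valued version.
\<close>

definition schatten_ennorm :: "real \<Rightarrow> ('a::complex_hilbert \<Rightarrow> 'a) \<Rightarrow> ennreal"
  where "schatten_ennorm q T =
    (if compact_operator T \<and> schatten_power_sum q T < \<infinity>
     then ennreal (enn2real (schatten_power_sum q T) powr (1 / q)) else \<infinity>)"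

definition schatten_norm :: "real \<Rightarrow> ('a::complex_hilbert \<Rightarrow> 'a) \<Rightarrow> real"
  where "schatten_norm q T = enn2real (schatten_ennorm q T)"

definition schatten_class :: "real \<Rightarrow> ('a::complex_hilbert \<Rightarrow> 'a) set"
  where "schatten_class q = {T. compact_operator T \<and> schatten_ennorm q T < \<infinity>}"

definition schatten_sums :: "real \<Rightarrow> (nat \<Rightarrow> 'a::complex_hilbert \<Rightarrow> 'a) \<Rightarrow> ('a \<Rightarrow> 'a) \<Rightarrow> bool"
  where "schatten_sums q T S \<longleftrightarrow> S \<in> schatten_class q \<and>
    (\<lambda>n. schatten_ennorm q (\<lambda>x. (\<Sum>j<n. T j x) - S x)) \<longlonglongrightarrow> 0"


section \<open>Infinite matrices acting on square-summable sequences\<close>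

definition ell2 :: "(nat \<Rightarrow> complex) set"
  where "ell2 = {x. summable (\<lambda>j. (cmod (x j))\<^sup>2)}"

definition ell2_norm :: "(nat \<Rightarrow> complex) \<Rightarrow> real"
  where "ell2_norm x = sqrt (\<Sum>j. (cmod (x j))\<^sup>2)"

definition matrix_apply :: "(nat \<Rightarrow> nat \<Rightarrow> complex) \<Rightarrow> (nat \<Rightarrow> complex) \<Rightarrow> nat \<Rightarrow> complex"
  where "matrix_apply A x = (\<lambda>i. \<Sum>j. A i j * x j)"

definition bounded_on_ell2 :: "(nat \<Rightarrow> nat \<Rightarrow> complex) \<Rightarrow> bool"
  where "bounded_on_ell2 A \<longleftrightarrow>
    (\<forall>x\<in>ell2. (\<forall>i. summable (\<lambda>j. A i j * x j)) \<and> matrix_apply A x \<in> ell2) \<and>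
    (\<exists>C. \<forall>x\<in>ell2. ell2_norm (matrix_apply A x) \<le> C * ell2_norm x)"

definition ell2_opnorm :: "(nat \<Rightarrow> nat \<Rightarrow> complex) \<Rightarrow> real"
  where "ell2_opnorm A = (SUP x\<in>{x \<in> ell2. ell2_norm x \<le> 1}. ell2_norm (matrix_apply A x))"

end

(*
  By the Cauchy-Schwarz inequality applied to singular value decompositions, the norm of sum T_j
  is at most the geometric mean of the norms of sum |T_j| and sum |T_j^*|, so it suffices to treat
  A = sum |T_j|. Its nonzero spectrum is that of the block operator with entries
  X_ij = |T_i|^(1/2) |T_j|^(1/2). The squares of the singular values of X_ij are eigenvalues of
  |T_i| |T_j|, so Weyl's inequality (via Schur triangularisation) turns the hypothesis on
  T_i T_j^* into ||X_ij||_p <= alpha_ij (||T_i||_p ||T_j||_p)^(1/2). Writing the right-hand side as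
  beta_ij^(1/p') (tau_i tau_j)^(1/(2p)) with beta = alpha^p' and tau_j = ||T_j||_p^p, the three
  lines theorem interpolates between the operator norm (entries bounded by beta_ij) and the
  Hilbert-Schmidt norm (squares of the entries bounded by beta_ij (tau_i tau_j)^(1/2)), where the
  bounds are ||beta|| and (||beta|| sum tau_j)^(1/2). At the intermediate exponent p this is the
  claim for finite sums, and applied to the tails of the series it gives convergence.
*)

theory Submission
  imports Defs "HOL-Complex_Analysis.Conformal_Mappings"
begin

section \<open>Inner products\<close>

text \<open>Passing to moduli provides a symmetric factorisation: with R the column of the
  |T_j|^(1/2), R^* R is the sum of the |T_j| and R R^* is the block operator, whose entries are
  accessible one by one. A general T_j offers no such factorisation. The power p' comes from the
  interpolation parameter. On the strip 0 <= Re z <= 1/2 the entries carry the weight beta_ij^(1-z)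
  (tau_i tau_j)^(z/2), and at z = 1/p the first exponent is 1 - 1/p = 1/p'. With this choice the
  quadratic form of beta controls both edges: on the left it is evaluated at the norms of the
  components of a block vector, on the right at the vector (tau_j^(1/2)). For q >= 1 the q-th power
  of the Schatten norm is the supremum of sums of |<T x_a, y_a>|^q over finite orthonormal systems.
  Each such sum is continuous under pointwise convergence of T, so neither duality nor completeness
  of the Schatten classes is invoked. Interpolation is likewise applied to a scalar function, a
  finite sum built from the eigenvectors of A.\<close>

lemma cinner_add_right: "cinner x (y + z) = cinner x y + cinner x (z :: 'a::complex_hilbert)"
  by (metis cinner_add_left cinner_commute complex_cnj_add)

lemma cinner_scaleC_right: "cinner x (c *\<^sub>C y) = cnj c * cinner x (y :: 'a::complex_hilbert)"
  by (metis cinner_commute cinner_scaleC_left complex_cnj_mult)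

lemma cinner_scaleR_left: "cinner (r *\<^sub>R x) y = complex_of_real r * cinner x (y :: 'a::complex_hilbert)"
  by (metis cinner_scaleC_left scaleC_of_real)

lemma cinner_scaleR_right: "cinner x (r *\<^sub>R y) = complex_of_real r * cinner x (y :: 'a::complex_hilbert)"
  by (metis cinner_scaleC_right scaleC_of_real complex_cnj_complex_of_real)

lemma cinner_zero [simp]: "cinner 0 x = 0" "cinner x (0 :: 'a::complex_hilbert) = 0"
  using cinner_scaleR_left[of 0 0 x] cinner_scaleR_right[of x 0 0] by auto

lemma cinner_minus_left: "cinner (- x) y = - cinner x (y :: 'a::complex_hilbert)"
  using cinner_scaleR_left[of "-1" x y] by simp

lemma cinner_minus_right: "cinner x (- y) = - cinner x (y :: 'a::complex_hilbert)"
  using cinner_scaleR_right[of x "-1" y] by simp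

lemma cinner_diff_left: "cinner (x - y) z = cinner x z - cinner y (z :: 'a::complex_hilbert)"
  using cinner_add_left[of x "- y" z] by (simp add: cinner_minus_left)

lemma cmod_cinner_commute: "cmod (cinner x y) = cmod (cinner y (x :: 'a::complex_hilbert))"
  by (metis cinner_commute complex_mod_cnj)

lemma norm_add_sq:
  "(norm (x + y))\<^sup>2 = (norm x)\<^sup>2 + (norm y)\<^sup>2 + 2 * Re (cinner x (y :: 'a::complex_hilbert))"
proof -
  have "complex_of_real ((norm (x + y))\<^sup>2)
      = complex_of_real ((norm x)\<^sup>2) + complex_of_real ((norm y)\<^sup>2) + (cinner x y + cnj (cinner x y))"
    using cinner_commute[of y x]
    by (simp add: cinner_self[symmetric] cinner_add_left cinner_add_right del: of_real_power)
  also have "cinner x y + cnj (cinner x y) = complex_of_real (2 * Re (cinner x y))"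
    by (rule complex_add_cnj)
  finally show ?thesis
    by (metis of_real_add of_real_eq_iff)
qed

lemma norm_diff_sq:
  "(norm (x - y))\<^sup>2 = (norm x)\<^sup>2 + (norm y)\<^sup>2 - 2 * Re (cinner x (y :: 'a::complex_hilbert))"
  using norm_add_sq[of x "- y"] by (simp add: cinner_minus_right)

lemma parallelogram:
  "(norm (x + y))\<^sup>2 + (norm (x - y))\<^sup>2 = 2 * (norm x)\<^sup>2 + 2 * (norm (y :: 'a::complex_hilbert))\<^sup>2"
  by (simp add: norm_add_sq norm_diff_sq)

lemma norm_scaleC: "norm (c *\<^sub>C x) = cmod c * norm (x :: 'a::complex_hilbert)"
proof -
  have "complex_of_real ((norm (c *\<^sub>C x))\<^sup>2) = complex_of_real ((cmod c * norm x)\<^sup>2)"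
    unfolding power_mult_distrib of_real_mult complex_norm_square[of c] cinner_self[symmetric, of x]
      cinner_self[symmetric, of "c *\<^sub>C x"]
    by (simp add: cinner_scaleC_left cinner_scaleC_right mult.assoc)
  then have "(norm (c *\<^sub>C x))\<^sup>2 = (cmod c * norm x)\<^sup>2"
    using of_real_eq_iff by blast
  then show ?thesis
    by (simp add: power2_eq_iff_nonneg)
qed

lemma cinner_Cauchy_Schwarz: "cmod (cinner x y) \<le> norm x * norm (y :: 'a::complex_hilbert)"
proof (cases "y = 0")
  case False
  define c where "c = cinner x y / of_real ((norm y)\<^sup>2)"
  have ny: "norm y > 0" using False by simp
  have "0 \<le> (norm (x - c *\<^sub>C y))\<^sup>2" by simp
  also have "\<dots> = (norm x)\<^sup>2 + (cmod c * norm y)\<^sup>2 - 2 * Re (cnj c * cinner x y)"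
    by (simp add: norm_diff_sq norm_scaleC cinner_scaleC_right)
  also have "cnj c * cinner x y = of_real ((cmod (cinner x y))\<^sup>2 / (norm y)\<^sup>2)"
    unfolding c_def by (simp add: complex_norm_square[simplified of_real_power] mult.commute)
  also have "(cmod c * norm y)\<^sup>2 = (cmod (cinner x y))\<^sup>2 / (norm y)\<^sup>2"
    using ny unfolding c_def
    by (simp add: norm_divide norm_power power_mult_distrib power_divide power4_eq_xxxx power2_eq_square norm_mult)
  finally have "(cmod (cinner x y))\<^sup>2 / (norm y)\<^sup>2 \<le> (norm x)\<^sup>2"
    by (simp only: Re_complex_of_real)
  then have "(cmod (cinner x y))\<^sup>2 \<le> (norm x * norm y)\<^sup>2"
    using ny by (simp add: field_simps power_mult_distrib)
  then show ?thesis
    by (rule power2_le_imp_le) simp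
qed simp

lemma bounded_bilinear_cinner: "bounded_bilinear (cinner :: 'a::complex_hilbert \<Rightarrow> _)"
  by (rule bounded_bilinear.intro)
    (auto simp: cinner_add_left cinner_add_right cinner_scaleR_left cinner_scaleR_right
      scaleR_conv_of_real intro!: exI[of _ 1] cinner_Cauchy_Schwarz)

lemma bounded_bilinear_scaleC: "bounded_bilinear (scaleC :: complex \<Rightarrow> 'a::complex_hilbert \<Rightarrow> _)"
proof (rule bounded_bilinear.intro)
  fix r c and x :: 'a
  show "(r *\<^sub>R c) *\<^sub>C x = r *\<^sub>R c *\<^sub>C x" "c *\<^sub>C r *\<^sub>R x = r *\<^sub>R c *\<^sub>C x"
    by (metis scaleC_of_real scaleC_scaleC scaleR_conv_of_real mult.commute)+
qed (auto simp: scaleC_add_left scaleC_add_right norm_scaleC intro!: exI[of _ 1])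

lemmas tendsto_cinner = bounded_bilinear.tendsto[OF bounded_bilinear_cinner]
lemmas cinner_sum_left = bounded_bilinear.sum_left[OF bounded_bilinear_cinner]
lemmas cinner_sum_right = bounded_bilinear.sum_right[OF bounded_bilinear_cinner]
lemmas bounded_linear_cinner_left = bounded_bilinear.bounded_linear_left[OF bounded_bilinear_cinner]
lemmas tendsto_scaleC = bounded_bilinear.tendsto[OF bounded_bilinear_scaleC]
lemmas scaleC_zero = bounded_bilinear.zero_left[OF bounded_bilinear_scaleC]
  bounded_bilinear.zero_right[OF bounded_bilinear_scaleC]
declare scaleC_zero [simp]

lemma cinner_eq_zero_all: "(\<And>y. cinner x y = 0) \<Longrightarrow> x = (0 :: 'a::complex_hilbert)"
  by (metis cinner_self norm_eq_zero of_real_eq_0_iff zero_eq_power2)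

lemma cinner_ext: "(\<And>y. cinner x y = cinner z y) \<Longrightarrow> x = (z :: 'a::complex_hilbert)"
  using cinner_eq_zero_all[of "x - z"] by (simp add: cinner_diff_left)

section \<open>Algebra of complex-linear maps\<close>

lemma clinear_add: "clinear T \<Longrightarrow> T (x + y) = T x + T y"
  by (simp add: Vector_Spaces.linear_iff)

lemma clinear_scaleC: "clinear T \<Longrightarrow> T (c *\<^sub>C x) = c *\<^sub>C T x"
  by (simp add: Vector_Spaces.linear_iff)

lemma clinear_scaleR: "clinear T \<Longrightarrow> T (r *\<^sub>R x) = r *\<^sub>R T x"
  by (metis clinear_scaleC scaleC_of_real)

lemma clinearI:
  "(\<And>x y. T (x + y) = T x + T y) \<Longrightarrow> (\<And>c x. T (c *\<^sub>C x) = c *\<^sub>C T x) \<Longrightarrow> clinear T"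
  by (simp add: Vector_Spaces.linear_iff complex_vector.vector_space_axioms)

lemma clinear_real_linear: "clinear T \<Longrightarrow> linear T"
  by (simp add: linear_iff clinear_add clinear_scaleR)

lemmas clinear_diff = linear_diff[OF clinear_real_linear]
lemmas clinear_zero = linear_0[OF clinear_real_linear]
lemmas clinear_sum = linear_sum[OF clinear_real_linear]

section \<open>Orthogonal systems\<close>

text \<open>Zero vectors are allowed, so that every system can be indexed by all naturals.\<close>

definition ortho :: "(nat \<Rightarrow> 'a::complex_hilbert) \<Rightarrow> bool"
  where "ortho e \<longleftrightarrow> (\<forall>k l. k \<noteq> l \<longrightarrow> cinner (e k) (e l) = 0) \<and> (\<forall>k. norm (e k) = 0 \<or> norm (e k) = 1)"

text \<open>Weaker than orthonormality and stable under contractions. Partial isometries, which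
  destroy orthonormality, can therefore be applied to test systems in the diagonal
  estimates.\<close>

definition bessel_on :: "'i set \<Rightarrow> ('i \<Rightarrow> 'a::complex_hilbert) \<Rightarrow> bool"
  where "bessel_on F x \<longleftrightarrow> (\<forall>z. (\<Sum>a\<in>F. (cmod (cinner z (x a)))\<^sup>2) \<le> (norm z)\<^sup>2)"

lemma ortho_cinner: "ortho e \<Longrightarrow> cinner (e k) (e l) = (if k = l \<and> e k \<noteq> 0 then 1 else 0)"
  unfolding ortho_def by (cases "k = l") (fastforce simp: cinner_self)+

lemma ortho_norm_le: "ortho e \<Longrightarrow> norm (e k) \<le> 1"
  unfolding ortho_def by (metis order_refl zero_le_one)

lemma norm_sum_orthogonal:
  assumes "finite F" "\<And>k l. k \<in> F \<Longrightarrow> l \<in> F \<Longrightarrow> k \<noteq> l \<Longrightarrow> cinner (v k) (v l :: 'a::complex_hilbert) = 0"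
  shows "(norm (\<Sum>k\<in>F. v k))\<^sup>2 = (\<Sum>k\<in>F. (norm (v k))\<^sup>2)"
  using assms
proof (induction F rule: finite_induct)
  case (insert a F)
  have "cinner (v a) (\<Sum>k\<in>F. v k) = 0"
    unfolding cinner_sum_right using insert by (intro sum.neutral) auto
  with insert show ?case by (simp add: norm_add_sq)
qed simp

lemma norm_sum_ortho:
  assumes "ortho e" "finite F"
  shows "(norm (\<Sum>k\<in>F. c k *\<^sub>C e k))\<^sup>2 = (\<Sum>k\<in>F. (cmod (c k) * norm (e k))\<^sup>2)"
  using assms
  by (subst norm_sum_orthogonal)
    (auto simp: norm_scaleC cinner_scaleC_left cinner_scaleC_right ortho_cinner)

lemma norm_sum_ortho_le:
  assumes "ortho e" "finite F"
  shows "(norm (\<Sum>k\<in>F. c k *\<^sub>C e k))\<^sup>2 \<le> (\<Sum>k\<in>F. (cmod (c k))\<^sup>2)"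
  unfolding norm_sum_ortho[OF assms]
  by (intro sum_mono power_mono mult_left_le) (auto simp: ortho_norm_le[OF assms(1)])

lemma bessel_orthonormal_on:
  assumes "finite F" "\<And>k l. k \<in> F \<Longrightarrow> l \<in> F \<Longrightarrow> k \<noteq> l \<Longrightarrow> cinner (e k) (e l :: 'a::complex_hilbert) = 0"
    "\<And>k. k \<in> F \<Longrightarrow> norm (e k) = 0 \<or> norm (e k) = 1"
  shows "bessel_on F e"
  unfolding bessel_on_def
proof
  fix z
  define w where "w = (\<Sum>k\<in>F. cinner z (e k) *\<^sub>C e k)"
  define s where "s = (\<Sum>k\<in>F. (cmod (cinner z (e k)))\<^sup>2)"
  have "(norm w)\<^sup>2 = (\<Sum>k\<in>F. (norm (cinner z (e k) *\<^sub>C e k))\<^sup>2)"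
    unfolding w_def
    by (rule norm_sum_orthogonal) (use assms in \<open>auto simp: cinner_scaleC_left cinner_scaleC_right\<close>)
  also have "\<dots> = s"
    unfolding s_def
  proof (intro sum.cong refl)
    fix k assume "k \<in> F"
    then show "(norm (cinner z (e k) *\<^sub>C e k))\<^sup>2 = (cmod (cinner z (e k)))\<^sup>2"
      using assms(3)[of k] by (auto simp: norm_scaleC)
  qed
  finally have w: "(norm w)\<^sup>2 = s" .
  have "cinner z w = (\<Sum>k\<in>F. cnj (cinner z (e k)) * cinner z (e k))"
    unfolding w_def cinner_sum_right by (simp add: cinner_scaleC_right)
  also have "\<dots> = of_real s"
    unfolding s_def of_real_sum
    by (intro sum.cong refl) (simp add: complex_norm_square[simplified of_real_power] mult.commute)
  finally have zw: "cinner z w = of_real s" .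
  have "0 \<le> (norm (z - w))\<^sup>2" by simp
  also have "\<dots> = (norm z)\<^sup>2 - s"
    unfolding norm_diff_sq w zw by simp
  finally show "(\<Sum>a\<in>F. (cmod (cinner z (e a)))\<^sup>2) \<le> (norm z)\<^sup>2"
    unfolding s_def by simp
qed

lemma bessel_ortho: "ortho e \<Longrightarrow> finite F \<Longrightarrow> bessel_on F e"
  by (rule bessel_orthonormal_on) (auto simp: ortho_def)

lemma bessel_onD: "bessel_on F x \<Longrightarrow> (\<Sum>a\<in>F. (cmod (cinner z (x a)))\<^sup>2) \<le> (norm z)\<^sup>2"
  by (simp add: bessel_on_def)

lemma bessel_onD': "bessel_on F x \<Longrightarrow> (\<Sum>a\<in>F. (cmod (cinner (x a) z))\<^sup>2) \<le> (norm z)\<^sup>2"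
  by (subst cmod_cinner_commute) (simp add: bessel_on_def)

text \<open>Testing the inequality on \<open>z = x a\<close> bounds the fourth power of the norm of
  \<open>x a\<close> by its square.\<close>

lemma bessel_norm_le:
  assumes "bessel_on F x" "finite F" "a \<in> F" shows "norm (x a) \<le> 1"
proof (cases "x a = 0")
  case False
  have "(cmod (cinner (x a) (x a)))\<^sup>2 \<le> (\<Sum>b\<in>F. (cmod (cinner (x a) (x b)))\<^sup>2)"
    using assms by (intro member_le_sum) auto
  also have "\<dots> \<le> (norm (x a))\<^sup>2"
    by (rule bessel_onD[OF assms(1)])
  finally have "((norm (x a))\<^sup>2)\<^sup>2 \<le> (norm (x a))\<^sup>2"
    by (simp add: cinner_self norm_power)
  then have "(norm (x a))\<^sup>2 \<le> 1"
    using False by (simp add: power2_eq_square)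
  then show ?thesis
    by (simp add: power_le_one_iff abs_square_le_1)
qed simp

section \<open>Convergence of orthogonal series\<close>

lemma ortho_summable_sq: "ortho e \<Longrightarrow> summable (\<lambda>k. (cmod (cinner x (e k)))\<^sup>2)"
  by (rule bounded_imp_summable[where B = "(norm x)\<^sup>2"])
    (auto intro!: bessel_onD bessel_ortho)

lemma ortho_summable:
  assumes "ortho e" "summable (\<lambda>k. (cmod (c k))\<^sup>2)"
  shows "summable (\<lambda>k. c k *\<^sub>C (e k :: 'a::complex_hilbert))"
  unfolding summable_Cauchy
proof (intro allI impI)
  fix \<epsilon> :: real assume "\<epsilon> > 0"
  then obtain N where N: "\<And>m n. m \<ge> N \<Longrightarrow> norm (\<Sum>k=m..<n. (cmod (c k))\<^sup>2) < \<epsilon>\<^sup>2"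
    using assms(2) unfolding summable_Cauchy by (meson zero_less_power)
  show "\<exists>N. \<forall>m\<ge>N. \<forall>n. norm (\<Sum>k=m..<n. c k *\<^sub>C e k) < \<epsilon>"
  proof (intro exI allI impI)
    fix m n assume "N \<le> m"
    have "(norm (\<Sum>k=m..<n. c k *\<^sub>C e k))\<^sup>2 \<le> (\<Sum>k=m..<n. (cmod (c k))\<^sup>2)"
      by (rule norm_sum_ortho_le[OF assms(1)]) simp
    also have "\<dots> < \<epsilon>\<^sup>2"
      using N[OF \<open>N \<le> m\<close>, of n] by (simp add: abs_of_nonneg sum_nonneg)
    finally show "norm (\<Sum>k=m..<n. c k *\<^sub>C e k) < \<epsilon>"
      using \<open>\<epsilon> > 0\<close> by (simp add: power2_less_imp_less)
  qed
qed

section \<open>Diagonal operators between orthogonal systems\<close>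

text \<open>One shape serves for an operator, its adjoint (exchange \<open>e\<close> and
  \<open>f\<close>), its modulus and the root of the modulus (\<open>f = e\<close>), and, with all
  coefficients 1, the partial isometry of the polar decomposition.\<close>

definition diag_op :: "(nat \<Rightarrow> real) \<Rightarrow> (nat \<Rightarrow> 'a) \<Rightarrow> (nat \<Rightarrow> 'a) \<Rightarrow> 'a \<Rightarrow> 'a::complex_hilbert"
  where "diag_op c e f x = (\<Sum>k. (of_real (c k) * cinner x (e k)) *\<^sub>C f k)"

lemma diag_op_summable_sq:
  assumes "ortho e" "\<forall>k. \<bar>c k\<bar> \<le> C"
  shows "summable (\<lambda>k. (cmod (of_real (c k) * cinner x (e k)))\<^sup>2)"
proof (rule summable_comparison_test')
  show "summable (\<lambda>k. C\<^sup>2 * (cmod (cinner x (e k)))\<^sup>2)"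
    by (intro summable_mult ortho_summable_sq assms)
  show "norm ((cmod (of_real (c k) * cinner x (e k)))\<^sup>2) \<le> C\<^sup>2 * (cmod (cinner x (e k)))\<^sup>2" for k
    using power_mono[OF assms(2)[rule_format, of k] abs_ge_zero, of 2]
    by (simp add: norm_mult power_mult_distrib mult_right_mono)
qed

lemma diag_op_sums:
  assumes "ortho e" "ortho f" "\<forall>k. \<bar>c k\<bar> \<le> C"
  shows "(\<lambda>k. (of_real (c k) * cinner x (e k)) *\<^sub>C f k) sums diag_op c e f x"
  unfolding diag_op_def
  by (intro summable_sums ortho_summable assms diag_op_summable_sq[OF assms(1,3)])

lemma clinear_diag_op:
  assumes "ortho e" "ortho f" "\<forall>k. \<bar>c k\<bar> \<le> C"
  shows "clinear (diag_op c e f)"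
proof (rule clinearI)
  fix x y a
  note s = diag_op_sums[OF assms]
  have "(\<lambda>k. (of_real (c k) * cinner (x + y) (e k)) *\<^sub>C f k) sums (diag_op c e f x + diag_op c e f y)"
    using sums_add[OF s[of x] s[of y]] by (simp add: cinner_add_left distrib_left scaleC_add_left)
  with s show "diag_op c e f (x + y) = diag_op c e f x + diag_op c e f y"
    by (rule sums_unique2)
  have "(\<lambda>k. a *\<^sub>C (of_real (c k) * cinner x (e k)) *\<^sub>C f k) sums (a *\<^sub>C diag_op c e f x)"
    by (rule bounded_linear.sums[OF bounded_bilinear.bounded_linear_right[OF bounded_bilinear_scaleC] s])
  then have "(\<lambda>k. (of_real (c k) * cinner (a *\<^sub>C x) (e k)) *\<^sub>C f k) sums (a *\<^sub>C diag_op c e f x)"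
    by (simp add: cinner_scaleC_left scaleC_scaleC mult.left_commute)
  with s show "diag_op c e f (a *\<^sub>C x) = a *\<^sub>C diag_op c e f x"
    by (rule sums_unique2)
qed

lemma cinner_diag_op_sums:
  assumes "ortho e" "ortho f" "\<forall>k. \<bar>c k\<bar> \<le> C"
  shows "(\<lambda>k. of_real (c k) * cinner x (e k) * cinner (f k) y) sums cinner (diag_op c e f x) y"
  using bounded_linear.sums[OF bounded_linear_cinner_left diag_op_sums[OF assms, of x], of y]
  by (simp add: cinner_scaleC_left)

lemma cinner_diag_op_coeff:
  assumes "ortho e" "ortho f" "\<forall>k. \<bar>c k\<bar> \<le> C"
  shows "cinner (diag_op c e f x) (f m) = (if f m = 0 then 0 else of_real (c m) * cinner x (e m))"
proof -
  have "(\<lambda>k. if k = m then (if f m = 0 then 0 else of_real (c m) * cinner x (e m)) else 0) sums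
      cinner (diag_op c e f x) (f m)"
    using cinner_diag_op_sums[OF assms, of x "f m"]
    by (rule back_subst[of "\<lambda>g. g sums _"]) (auto simp: ortho_cinner[OF assms(2)])
  from sums_unique2[OF this sums_single] show ?thesis .
qed

lemma cinner_diag_op_adjoint:
  assumes "ortho e" "ortho f" "\<forall>k. \<bar>c k\<bar> \<le> C"
  shows "cinner (diag_op c e f x) y = cinner x (diag_op c f e y)"
proof -
  have "(\<lambda>k. of_real (c k) * cinner y (f k) * cinner (e k) x) sums cinner (diag_op c f e y) x"
    by (rule cinner_diag_op_sums[OF assms(2,1,3)])
  then have "(\<lambda>k. cnj (of_real (c k) * cinner y (f k) * cinner (e k) x)) sums cnj (cinner (diag_op c f e y) x)"
    by (simp only: sums_cnj)
  then have "(\<lambda>k. of_real (c k) * cinner x (e k) * cinner (f k) y) sums cinner x (diag_op c f e y)"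
    by (simp add: cinner_commute[symmetric] mult_ac)
  with cinner_diag_op_sums[OF assms, of x y] show ?thesis
    by (rule sums_unique2)
qed

lemma norm_diag_op_le:
  assumes "ortho e" "ortho f" "\<forall>k. \<bar>c k\<bar> \<le> C"
  shows "norm (diag_op c e f x) \<le> C * norm x"
proof (rule Lim_bounded)
  have C: "0 \<le> C" using assms(3)[rule_format, of 0] by linarith
  show "(\<lambda>n. norm (\<Sum>k<n. (of_real (c k) * cinner x (e k)) *\<^sub>C f k)) \<longlonglongrightarrow> norm (diag_op c e f x)"
    using diag_op_sums[OF assms, of x] unfolding sums_def by (rule tendsto_norm)
  show "\<forall>n\<ge>0. norm (\<Sum>k<n. (of_real (c k) * cinner x (e k)) *\<^sub>C f k) \<le> C * norm x"
  proof (intro allI impI)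
    fix n
    let ?s = "\<Sum>k<n. (of_real (c k) * cinner x (e k)) *\<^sub>C f k"
    have 1: "(norm ?s)\<^sup>2 \<le> (\<Sum>k<n. (cmod (of_real (c k) * cinner x (e k)))\<^sup>2)"
      by (rule norm_sum_ortho_le[OF assms(2)]) simp
    have 2: "(\<Sum>k<n. (cmod (of_real (c k) * cinner x (e k)))\<^sup>2) \<le> (\<Sum>k<n. C\<^sup>2 * (cmod (cinner x (e k)))\<^sup>2)"
      using power_mono[OF assms(3)[rule_format] abs_ge_zero, of _ 2]
      by (intro sum_mono) (simp add: norm_mult power_mult_distrib mult_right_mono)
    have 3: "C\<^sup>2 * (\<Sum>k<n. (cmod (cinner x (e k)))\<^sup>2) \<le> C\<^sup>2 * (norm x)\<^sup>2"
      using bessel_onD[OF bessel_ortho[OF assms(1) finite_lessThan]] by (rule mult_left_mono) simp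
    have "(norm ?s)\<^sup>2 \<le> (C * norm x)\<^sup>2"
      using 1 2 3 unfolding sum_distrib_left power_mult_distrib by (meson order_trans)
    then show "norm ?s \<le> C * norm x"
      by (rule power2_le_imp_le) (simp add: C)
  qed
qed

text \<open>Where \<open>f k = 0\<close> the intermediate vector loses its k-th component; the last
  hypothesis says that there was nothing to lose.\<close>

lemma diag_op_comp:
  assumes "ortho e" "ortho f" "ortho g" "\<forall>k. \<bar>b k\<bar> \<le> C" "\<And>k. f k = 0 \<Longrightarrow> e k = 0 \<or> b k = 0"
  shows "diag_op c f g (diag_op b e f x) = diag_op (\<lambda>k. c k * b k) e g x"
proof -
  have "of_real (c k) * cinner (diag_op b e f x) (f k) = of_real (c k * b k) * cinner x (e k)" for k
    unfolding cinner_diag_op_coeff[OF assms(1,2,4)] using assms(5)[of k] by auto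
  then have "(\<lambda>k. (of_real (c k) * cinner (diag_op b e f x) (f k)) *\<^sub>C g k)
      = (\<lambda>k. (of_real (c k * b k) * cinner x (e k)) *\<^sub>C g k)"
    by presburger
  then show ?thesis
    unfolding diag_op_def[of c] diag_op_def[of "\<lambda>k. c k * b k"] by (rule arg_cong)
qed

lemma diag_op_basis:
  assumes "ortho e" shows "diag_op c e f (e m) = (if e m = 0 then 0 else of_real (c m) *\<^sub>C f m)"
proof -
  have "(\<lambda>k. if k = m then (if e m = 0 then 0 else of_real (c m) *\<^sub>C f m) else 0) sums
      (if e m = 0 then 0 else of_real (c m) *\<^sub>C f m)"
    by (rule sums_single)
  moreover have "(\<lambda>k. (of_real (c k) * cinner (e m) (e k)) *\<^sub>C f k)
      = (\<lambda>k. if k = m then (if e m = 0 then 0 else of_real (c m) *\<^sub>C f m) else 0)"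
    by (auto simp: ortho_cinner[OF assms])
  ultimately show ?thesis
    unfolding diag_op_def by (simp add: sums_iff)
qed

lemma bounded_linear_clinear:
  assumes "clinear T" "\<And>x. norm (T x) \<le> norm x * C"
  shows "bounded_linear T"
  by (rule bounded_linear_intro[where K = C])
    (use assms in \<open>auto simp: clinear_add clinear_scaleR\<close>)

section \<open>Compact operators\<close>

lemma compact_operator_clinear: "compact_operator T \<Longrightarrow> clinear T"
  by (simp add: compact_operator_def)

lemma compact_operatorI:
  assumes "clinear T" "T ` cball 0 1 \<subseteq> K" "compact K"
  shows "compact_operator T"
proof -
  have "closure (T ` cball 0 1) \<subseteq> K"
    using assms(2,3) by (intro closure_minimal compact_imp_closed)
  then have "compact (closure (T ` cball 0 1))"
    using compact_Int_closed[OF assms(3) closed_closure, of "T ` cball 0 1"] by (simp add: inf.absorb2)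
  with assms(1) show ?thesis by (simp add: compact_operator_def)
qed

lemma compact_operator_bounded:
  assumes "compact_operator T"
  obtains C where "C \<ge> 0" "\<And>x. norm (T x) \<le> C * norm x"
proof -
  have "bounded (closure (T ` cball 0 1))"
    using assms compact_imp_bounded unfolding compact_operator_def by blast
  then obtain C where C: "\<And>y. y \<in> closure (T ` cball 0 1) \<Longrightarrow> norm y \<le> C"
    unfolding bounded_iff by blast
  have C1: "norm (T x) \<le> C" if "norm x \<le> 1" for x
    using that by (intro C subsetD[OF closure_subset]) auto
  have "C \<ge> 0" using C1[of 0] order_trans[OF norm_ge_zero] by force
  moreover have "norm (T x) \<le> C * norm x" for x
  proof (cases "x = 0")
    case True
    then show ?thesis
      using clinear_zero[OF compact_operator_clinear[OF assms]] by simp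
  next
    case False
    have "norm (T ((1 / norm x) *\<^sub>R x)) \<le> C"
      by (rule C1) (use False in simp)
    then show ?thesis
      using False by (simp add: clinear_scaleR[OF compact_operator_clinear[OF assms]] field_simps)
  qed
  ultimately show ?thesis by (rule that)
qed

lemma compact_operator_bounded_linear: "compact_operator T \<Longrightarrow> bounded_linear T"
  by (metis compact_operator_bounded compact_operator_clinear bounded_linear_clinear mult.commute)

lemma compact_operator_add:
  assumes "compact_operator S" "compact_operator T"
  shows "compact_operator (\<lambda>x. S x + T x)"
proof (rule compact_operatorI)
  note l = assms[THEN compact_operator_clinear]
  show "clinear (\<lambda>x. S x + T x)"
    by (rule clinearI) (auto simp: clinear_add l clinear_scaleC scaleC_add_right)
  show "compact {x + y |x y. x \<in> closure (S ` cball 0 1) \<and> y \<in> closure (T ` cball 0 1)}"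
    using assms unfolding compact_operator_def by (intro compact_sums) auto
  show "(\<lambda>x. S x + T x) ` cball 0 1
      \<subseteq> {x + y |x y. x \<in> closure (S ` cball 0 1) \<and> y \<in> closure (T ` cball 0 1)}"
    using closure_subset[of "S ` cball 0 1"] closure_subset[of "T ` cball 0 1"] by blast
qed

lemma compact_operator_comp_left:
  assumes "compact_operator T" "clinear S" "bounded_linear S"
  shows "compact_operator (\<lambda>x. S (T x))"
proof (rule compact_operatorI)
  show "clinear (\<lambda>x. S (T x))"
    using assms(2) compact_operator_clinear[OF assms(1)]
    by (intro clinearI) (auto simp: clinear_add clinear_scaleC)
  show "compact (S ` closure (T ` cball 0 1))"
    using assms(1,3) unfolding compact_operator_def
    by (intro compact_continuous_image) (auto intro: linear_continuous_on)
  show "(\<lambda>x. S (T x)) ` cball 0 1 \<subseteq> S ` closure (T ` cball 0 1)"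
    using closure_subset by blast
qed

lemma clinear_uminus: "clinear (\<lambda>x :: 'a::complex_hilbert. - x)"
  by (rule clinearI) (auto simp: bounded_bilinear.minus_right[OF bounded_bilinear_scaleC])

lemma compact_operator_diff:
  assumes "compact_operator S" "compact_operator T"
  shows "compact_operator (\<lambda>x. S x - T x)"
  using compact_operator_add[OF assms(1) compact_operator_comp_left[OF assms(2) clinear_uminus]]
  by (simp add: bounded_linear_minus bounded_linear_ident)

lemma compact_operator_rank_one: "compact_operator (\<lambda>x. (c * cinner x e) *\<^sub>C f)"
proof (rule compact_operatorI)
  show "clinear (\<lambda>x. (c * cinner x e) *\<^sub>C f)"
    by (rule clinearI) (auto simp: cinner_add_left distrib_left scaleC_add_left cinner_scaleC_left
      scaleC_scaleC mult_ac)
  show "compact ((\<lambda>z. z *\<^sub>C f) ` cball 0 (cmod c * norm e))"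
    by (intro compact_continuous_image linear_continuous_on
      bounded_bilinear.bounded_linear_left[OF bounded_bilinear_scaleC]) auto
  show "(\<lambda>x. (c * cinner x e) *\<^sub>C f) ` cball 0 1 \<subseteq> (\<lambda>z. z *\<^sub>C f) ` cball 0 (cmod c * norm e)"
  proof (intro image_subsetI imageI)
    fix x assume "x \<in> cball (0::'a) 1"
    then have "cmod (cinner x e) \<le> 1 * norm e"
      by (intro order_trans[OF cinner_Cauchy_Schwarz] mult_right_mono) auto
    then show "c * cinner x e \<in> cball 0 (cmod c * norm e)"
      by (simp add: norm_mult mult_left_mono)
  qed
qed

lemma compact_operator_zero: "compact_operator (\<lambda>x. 0)"
  using compact_operator_rank_one[of 0 0 0] by simp

lemma compact_operator_sum:
  "finite F \<Longrightarrow> (\<And>i. i \<in> F \<Longrightarrow> compact_operator (T i)) \<Longrightarrow> compact_operator (\<lambda>x. \<Sum>i\<in>F. T i x)"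
  by (induction F rule: finite_induct) (auto intro: compact_operator_zero compact_operator_add)

text \<open>A finite net for the image of the ball under a nearby \<open>T n\<close> is a coarser
  net for its image under \<open>S\<close>; total boundedness and completeness give
  compactness.\<close>

lemma compact_operator_limit:
  fixes S :: "'a::complex_hilbert \<Rightarrow> 'a"
  assumes "\<And>n. compact_operator (T n)" "clinear S"
    and "\<And>\<epsilon>. \<epsilon> > 0 \<Longrightarrow> \<exists>n. \<forall>x. norm x \<le> 1 \<longrightarrow> norm (T n x - S x) \<le> \<epsilon>"
  shows "compact_operator S"
proof -
  have "\<exists>k. finite k \<and> closure (S ` cball 0 1) \<subseteq> (\<Union>x\<in>k. ball x \<epsilon>)" if "\<epsilon> > 0" for \<epsilon>
  proof -
    have "\<epsilon> / 4 > 0" using that by simp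
    from assms(3)[OF this] obtain n where n: "\<forall>x. norm x \<le> 1 \<longrightarrow> norm (T n x - S x) \<le> \<epsilon> / 4" ..
    have "compact (closure (T n ` cball 0 1))"
      using assms(1)[of n] by (simp add: compact_operator_def)
    then have "\<exists>k. finite k \<and> closure (T n ` cball 0 1) \<subseteq> (\<Union>x\<in>k. ball x (\<epsilon> / 4))"
      using \<open>\<epsilon> / 4 > 0\<close> unfolding compact_eq_totally_bounded by simp
    then obtain k where k: "finite k" "closure (T n ` cball 0 1) \<subseteq> (\<Union>x\<in>k. ball x (\<epsilon> / 4))"
      by (elim exE conjE)
    \<comment> \<open>Closed balls, so that the inclusion passes to the closure; the factor 2 leaves
      room for the open balls of radius \<open>\<epsilon>\<close>.\<close>
    have "S ` cball 0 1 \<subseteq> (\<Union>x\<in>k. cball x (\<epsilon> / 2))"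
    proof (intro image_subsetI)
      fix x :: 'a assume x: "x \<in> cball 0 1"
      then have "T n x \<in> closure (T n ` cball 0 1)"
        by (intro subsetD[OF closure_subset] imageI)
      then have "T n x \<in> (\<Union>y\<in>k. ball y (\<epsilon> / 4))"
        by (rule subsetD[OF k(2)])
      then obtain y where y: "y \<in> k" "dist y (T n x) < \<epsilon> / 4"
        by auto
      have "dist (T n x) (S x) \<le> \<epsilon> / 4"
        using n x by (simp add: dist_norm)
      then have "dist y (S x) \<le> \<epsilon> / 2"
        using y(2) dist_triangle[of y "S x" "T n x"] by linarith
      with y(1) show "S x \<in> (\<Union>x\<in>k. cball x (\<epsilon> / 2))"
        by (intro UN_I[of y]) (simp_all add: mem_cball)
    qed
    then have "closure (S ` cball 0 1) \<subseteq> (\<Union>x\<in>k. cball x (\<epsilon> / 2))"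
      using k(1) by (intro closure_minimal) auto
    also have "\<dots> \<subseteq> (\<Union>x\<in>k. ball x \<epsilon>)"
      using that by (intro UN_mono order_refl) (auto simp: subset_iff)
    finally show ?thesis using k(1) by (intro exI[of _ k] conjI)
  qed
  then have "compact (closure (S ` cball 0 1))"
    unfolding compact_eq_totally_bounded by (auto simp: complete_eq_closed)
  with assms(2) show ?thesis unfolding compact_operator_def by blast
qed

text \<open>The truncation error is again diagonal, so its operator norm is controlled by the
  remaining coefficients. This yields compactness when the coefficients tend to 0.\<close>

lemma diag_op_tail:
  assumes "ortho e" "ortho f" "\<forall>k. \<bar>c k\<bar> \<le> C"
  shows "diag_op c e f x - (\<Sum>k<n. (of_real (c k) * cinner x (e k)) *\<^sub>C f k)
    = diag_op (\<lambda>k. if k < n then 0 else c k) e f x"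
proof -
  have "(\<lambda>k. if k \<in> {..<n} then (of_real (c k) * cinner x (e k)) *\<^sub>C f k else 0) sums
      (\<Sum>k\<in>{..<n}. (of_real (c k) * cinner x (e k)) *\<^sub>C f k)"
    by (rule sums_If_finite_set) simp
  from sums_diff[OF diag_op_sums[OF assms] this]
  have "(\<lambda>k. (of_real (if k < n then 0 else c k) * cinner x (e k)) *\<^sub>C f k) sums
      (diag_op c e f x - (\<Sum>k<n. (of_real (c k) * cinner x (e k)) *\<^sub>C f k))"
    by (rule back_subst[of "\<lambda>g. g sums _"]) auto
  then show ?thesis
    unfolding diag_op_def[of "\<lambda>k. if k < n then 0 else c k"] by (simp add: sums_iff)
qed

lemma compact_operator_diag_op:
  assumes "ortho e" "ortho f" "c \<longlonglongrightarrow> 0"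
  shows "compact_operator (diag_op c e f)"
proof -
  have "Bseq c" using assms(3) convergentI convergent_imp_Bseq by blast
  then obtain C where C: "\<forall>k. \<bar>c k\<bar> \<le> C" unfolding Bseq_def by auto
  show ?thesis
  proof (rule compact_operator_limit[where T = "\<lambda>n x. \<Sum>k<n. (of_real (c k) * cinner x (e k)) *\<^sub>C f k"])
    show "clinear (diag_op c e f)"
      by (rule clinear_diag_op[OF assms(1,2) C])
    show "compact_operator (\<lambda>x. \<Sum>k<n. (of_real (c k) * cinner x (e k)) *\<^sub>C f k)" for n
      by (intro compact_operator_sum compact_operator_rank_one) auto
    fix \<epsilon> :: real assume "\<epsilon> > 0"
    then obtain n where n: "\<And>k. k \<ge> n \<Longrightarrow> \<bar>c k\<bar> < \<epsilon>"
      using assms(3) unfolding LIMSEQ_iff by fastforce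
    have "norm ((\<Sum>k<n. (of_real (c k) * cinner x (e k)) *\<^sub>C f k) - diag_op c e f x) \<le> \<epsilon>"
      if "norm x \<le> 1" for x
    proof -
      have "norm ((\<Sum>k<n. (of_real (c k) * cinner x (e k)) *\<^sub>C f k) - diag_op c e f x)
          = norm (diag_op (\<lambda>k. if k < n then 0 else c k) e f x)"
        by (subst norm_minus_commute, subst diag_op_tail[OF assms(1,2) C]) simp
      also have "\<dots> \<le> \<epsilon> * norm x"
        using n \<open>\<epsilon> > 0\<close> by (intro norm_diag_op_le assms) (auto simp: less_imp_le)
      also have "\<dots> \<le> \<epsilon>" using that \<open>\<epsilon> > 0\<close> by (simp add: mult_left_le)
      finally show ?thesis .
    qed
    then show "\<exists>n. \<forall>x. norm x \<le> 1 \<longrightarrow>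
        norm ((\<Sum>k<n. (of_real (c k) * cinner x (e k)) *\<^sub>C f k) - diag_op c e f x) \<le> \<epsilon>"
      by blast
  qed
qed

section \<open>Singular value decomposition\<close>

text \<open>
  The supremum of \<open>norm (T x)\<close> over the unit ball of a closed subspace is attained: along a
  maximising sequence whose images converge, the parallelogram law forces the sequence itself
  to be Cauchy.
\<close>

lemma compact_operator_attains:
  fixes T :: "'a::complex_hilbert \<Rightarrow> 'a"
  assumes T: "compact_operator T" and x0: "\<forall>v\<in>V. cinner x0 v = 0" "T x0 \<noteq> 0"
  shows "\<exists>x. norm x = 1 \<and> (\<forall>v\<in>V. cinner x v = 0) \<and>
    (\<forall>y. (\<forall>v\<in>V. cinner y v = 0) \<longrightarrow> norm (T y) \<le> norm (T x) * norm y)"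
proof -
  define M where "M = {x. \<forall>v\<in>V. cinner x v = 0}"
  define B where "B = M \<inter> cball 0 1"
  define s where "s = (SUP x\<in>B. norm (T x))"
  note lin = compact_operator_clinear[OF T]
  obtain C where C: "C \<ge> 0" "\<And>x. norm (T x) \<le> C * norm x"
    by (rule compact_operator_bounded[OF T]) (rule that)
  have M_add: "x + y \<in> M" if "x \<in> M" "y \<in> M" for x y
    using that by (simp add: M_def cinner_add_left)
  have M_scale: "r *\<^sub>R x \<in> M" if "x \<in> M" for x r
    using that by (simp add: M_def cinner_scaleR_left)
  have bdd: "bdd_above ((\<lambda>x. norm (T x)) ` B)"
  proof (rule bdd_aboveI2)
    fix x assume "x \<in> B"
    then show "norm (T x) \<le> C"
      using order_trans[OF C(2)[of x] mult_left_le[of "norm x" C]] C(1) by (simp add: B_def)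
  qed
  have "0 \<in> B" by (simp add: B_def M_def)
  have up: "norm (T x) \<le> s * norm x" if "x \<in> M" for x
  proof (cases "x = 0")
    case False
    have "norm (T ((1 / norm x) *\<^sub>R x)) \<le> s"
      unfolding s_def using False
      by (intro cSUP_upper bdd) (simp add: B_def M_scale that)
    then show ?thesis
      using False by (simp add: clinear_scaleR[OF lin] field_simps)
  qed (simp add: clinear_zero[OF lin])
  have "x0 \<in> M" using x0 by (simp add: M_def)
  have spos: "s > 0"
  proof (rule ccontr)
    assume "\<not> s > 0"
    then have "s * norm x0 \<le> 0"
      by (simp add: mult_nonpos_nonneg)
    moreover have "norm (T x0) > 0" using x0(2) by simp
    ultimately show False using up[OF \<open>x0 \<in> M\<close>] by linarith
  qed
  have "\<exists>x. x \<in> B \<and> s - 1 / Suc n < norm (T x)" for n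
  proof -
    have "s - 1 / Suc n < (SUP x\<in>B. norm (T x))" unfolding s_def[symmetric] by simp
    moreover have "B \<noteq> {}" using \<open>0 \<in> B\<close> by auto
    ultimately show ?thesis
      using less_cSUP_iff[OF _ bdd] by blast
  qed
  then obtain X where X: "\<And>n. X n \<in> B" "\<And>n. s - 1 / Suc n < norm (T (X n))"
    by metis
  have "seq_compact (closure (T ` cball 0 1))"
    using T unfolding compact_operator_def compact_eq_seq_compact_metric by simp
  moreover have "\<forall>n. T (X n) \<in> closure (T ` cball 0 1)"
    using X(1) by (intro allI subsetD[OF closure_subset] imageI) (simp add: B_def)
  ultimately obtain y r where r: "strict_mono (r :: nat \<Rightarrow> nat)" and y: "((\<lambda>n. T (X n)) \<circ> r) \<longlonglongrightarrow> y"
    unfolding seq_compact_def by metis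
  have lim_s: "(\<lambda>n. norm (T (X (r n)))) \<longlonglongrightarrow> s"
  proof (rule tendsto_sandwich)
    have "(\<lambda>n. s - 1 / real (Suc n)) \<longlonglongrightarrow> s - 0"
      by (intro tendsto_intros LIMSEQ_Suc lim_1_over_n)
    then have "((\<lambda>n. s - 1 / real (Suc n)) \<circ> r) \<longlonglongrightarrow> s"
      using LIMSEQ_subseq_LIMSEQ[OF _ r] by fastforce
    then show "(\<lambda>n. s - 1 / real (Suc (r n))) \<longlonglongrightarrow> s" by (simp add: o_def)
    show "\<forall>\<^sub>F n in sequentially. s - 1 / real (Suc (r n)) \<le> norm (T (X (r n)))"
      using X(2) by (intro always_eventually allI less_imp_le)
    show "\<forall>\<^sub>F n in sequentially. norm (T (X (r n))) \<le> s"
      unfolding s_def by (intro always_eventually allI cSUP_upper bdd X)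
  qed simp
  have norm_y: "norm y = s"
    using LIMSEQ_unique[OF tendsto_norm[OF y[unfolded o_def]] lim_s] .
  have "Cauchy (\<lambda>n. X (r n))"
  proof (rule metric_CauchyI)
    fix \<epsilon> :: real assume \<epsilon>: "\<epsilon> > 0"
    \<comment> \<open>Both images are close to \<open>y\<close>, whose norm is the supremum
      \<open>s\<close>; hence the sum of the two vectors has norm at least
      \<open>2 - \<delta>\<close>. The parallelogram law bounds the squared distance by
      \<open>4 - (2 - \<delta>)\<^sup>2\<close>, which is less than
      \<open>\<epsilon>\<^sup>2\<close> for this choice.\<close>
    define \<delta> where "\<delta> = min 1 (\<epsilon>\<^sup>2 / 8)"
    have \<delta>: "0 < \<delta>" "\<delta> \<le> 1" "8 * \<delta> \<le> \<epsilon>\<^sup>2" using \<epsilon> by (auto simp: \<delta>_def min_def)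
    have "s * \<delta> / 2 > 0" using spos \<delta> by simp
    then obtain N where N: "\<And>n. n \<ge> N \<Longrightarrow> norm (T (X (r n)) - y) < s * \<delta> / 2"
      using LIMSEQ_D[OF y[unfolded o_def] \<open>s * \<delta> / 2 > 0\<close>] by blast
    show "\<exists>N. \<forall>m\<ge>N. \<forall>n\<ge>N. dist (X (r m)) (X (r n)) < \<epsilon>"
    proof (intro exI allI impI)
      fix m n assume mn: "N \<le> m" "N \<le> n"
      let ?a = "X (r m)" and ?b = "X (r n)"
      have ab: "?a \<in> M" "?b \<in> M" "norm ?a \<le> 1" "norm ?b \<le> 1"
        using X(1)[of "r m"] X(1)[of "r n"] by (auto simp: B_def)
      have "norm (2 *\<^sub>R y) \<le> norm (T ?a + T ?b) + norm (T ?a - y) + norm (T ?b - y)"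
      proof -
        have "2 *\<^sub>R y = (T ?a + T ?b) - (T ?a - y) - (T ?b - y)"
          by (simp add: scaleR_2)
        then show ?thesis
          by (metis (no_types, lifting) norm_triangle_ineq4 order_trans add_right_mono)
      qed
      then have "2 * s - s * \<delta> \<le> norm (T (?a + ?b))"
        using N[OF mn(1)] N[OF mn(2)] norm_y by (simp add: clinear_add[OF lin])
      also have "\<dots> \<le> s * norm (?a + ?b)"
        by (intro up M_add ab)
      finally have "s * (2 - \<delta>) \<le> s * norm (?a + ?b)"
        by (simp add: algebra_simps)
      then have "2 - \<delta> \<le> norm (?a + ?b)"
        using spos by simp
      then have "(2 - \<delta>)\<^sup>2 \<le> (norm (?a + ?b))\<^sup>2"
        using \<delta> by (intro power_mono) auto
      moreover have "(norm ?a)\<^sup>2 \<le> 1" "(norm ?b)\<^sup>2 \<le> 1"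
        using ab by (auto simp: power_le_one)
      ultimately have "(norm (?a - ?b))\<^sup>2 \<le> 4 - (2 - \<delta>)\<^sup>2"
        using parallelogram[of ?a ?b] by linarith
      also have "\<dots> < \<epsilon>\<^sup>2"
      proof -
        have "4 - (2 - \<delta>)\<^sup>2 = 4 * \<delta> - \<delta>\<^sup>2" by (simp add: power2_diff)
        with \<delta> zero_le_power2[of \<delta>] show ?thesis by linarith
      qed
      finally show "dist ?a ?b < \<epsilon>"
        using \<epsilon> by (simp add: dist_norm power2_less_imp_less)
    qed
  qed
  then obtain x where x: "(\<lambda>n. X (r n)) \<longlonglongrightarrow> x"
    using Cauchy_convergent convergentD by blast
  have xM: "\<forall>v\<in>V. cinner x v = 0"
  proof
    fix v assume "v \<in> V"
    then have "(\<lambda>n. cinner (X (r n)) v) = (\<lambda>n. 0)"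
      using X(1) by (auto simp: B_def M_def)
    with tendsto_cinner[OF x tendsto_const, of v] show "cinner x v = 0"
      by (simp add: LIMSEQ_const_iff)
  qed
  have "norm x \<le> 1"
    using tendsto_norm[OF x] by (rule Lim_bounded) (use X(1) in \<open>auto simp: B_def\<close>)
  have "(\<lambda>n. T (X (r n))) \<longlonglongrightarrow> T x"
    using bounded_linear.tendsto[OF compact_operator_bounded_linear[OF T] x] .
  with y have "T x = y" unfolding o_def by (rule LIMSEQ_unique[rotated])
  with norm_y have Tx: "norm (T x) = s" by simp
  have "x \<in> M" using xM by (simp add: M_def)
  have "s \<le> s * norm x" using up[OF \<open>x \<in> M\<close>] Tx by simp
  then have "norm x = 1" using spos \<open>norm x \<le> 1\<close> by simp
  with xM up Tx show ?thesis by (auto simp: M_def)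
qed

text \<open>First variation: for \<open>c\<close> a small positive multiple of
  \<open>cinner (T x) (T y)\<close>, the squared norm of \<open>T (x + c *\<^sub>C y)\<close> grows
  to first order, that of \<open>x + c *\<^sub>C y\<close> only to second order since
  \<open>y\<close> is orthogonal to \<open>x\<close>. A maximiser permits this only if the inner
  product vanishes.\<close>

lemma maximizer_orthogonal:
  assumes T: "clinear T" and x: "norm x = 1"
    and max: "\<And>c. norm (T (x + c *\<^sub>C y)) \<le> norm (T x) * norm (x + c *\<^sub>C y)"
    and ort: "cinner x y = 0"
  shows "cinner (T x) (T y) = 0"
proof (rule ccontr)
  define g where "g = cinner (T x) (T y)"
  define s where "s = norm (T x)"
  assume "cinner (T x) (T y) \<noteq> 0"
  then have g: "cmod g > 0" by (simp add: g_def)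
  have key: "2 * \<epsilon> * (cmod g)\<^sup>2 \<le> \<epsilon>\<^sup>2 * (s\<^sup>2 * (cmod g)\<^sup>2 * (norm y)\<^sup>2)" if "\<epsilon> > 0" for \<epsilon> :: real
  proof -
    define c where "c = of_real \<epsilon> * g"
    have "(norm (T (x + c *\<^sub>C y)))\<^sup>2 \<le> (s * norm (x + c *\<^sub>C y))\<^sup>2"
      unfolding s_def by (intro power_mono max) simp
    moreover have "(norm (x + c *\<^sub>C y))\<^sup>2 = 1 + \<epsilon>\<^sup>2 * (cmod g)\<^sup>2 * (norm y)\<^sup>2"
      using that by (simp add: norm_add_sq x cinner_scaleC_right ort norm_scaleC c_def norm_mult power_mult_distrib)
    moreover have "Re (cnj c * g) = \<epsilon> * (cmod g)\<^sup>2"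
    proof -
      have "cnj c * g = of_real (\<epsilon> * (cmod g)\<^sup>2)"
        unfolding c_def of_real_mult complex_norm_square by simp
      then show ?thesis by (simp only: Re_complex_of_real)
    qed
    then have "(norm (T (x + c *\<^sub>C y)))\<^sup>2 \<ge> s\<^sup>2 + 2 * \<epsilon> * (cmod g)\<^sup>2"
      by (simp add: clinear_add[OF T] clinear_scaleC[OF T] norm_add_sq s_def cinner_scaleC_right g_def[symmetric])
    ultimately show ?thesis by (simp add: power_mult_distrib algebra_simps)
  qed
  \<comment> \<open>The summand 1 keeps \<open>D\<close> positive even if \<open>s\<close> or
    \<open>y\<close> vanishes; the step size is \<open>1 / D\<close>.\<close>
  define D where "D = s\<^sup>2 * (norm y)\<^sup>2 + 1"
  have D: "D > 0" unfolding D_def by (simp add: add_nonneg_pos)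
  have "2 * (1 / D) * (cmod g)\<^sup>2 \<le> (1 / D)\<^sup>2 * (D - 1) * (cmod g)\<^sup>2"
    using key[of "1 / D"] D by (simp add: D_def mult_ac)
  then have "2 * (1 / D) \<le> (1 / D)\<^sup>2 * (D - 1)"
    by (rule mult_right_le_imp_le) (use g in simp)
  then have "2 * D \<le> D - 1"
    using D by (simp add: field_simps power2_eq_square)
  with D show False by simp
qed

text \<open>Finite rank is padded with zeros, and vectors vanish exactly where the singular value
  does, so the side conditions of \<open>diag_op_comp\<close> hold automatically. No order of the
  values is required, and the notion is symmetric under exchanging \<open>e\<close> and
  \<open>f\<close>.\<close>

definition svd :: "('a::complex_hilbert \<Rightarrow> 'a) \<Rightarrow> (nat \<Rightarrow> real) \<Rightarrow> (nat \<Rightarrow> 'a) \<Rightarrow> (nat \<Rightarrow> 'a) \<Rightarrow> bool"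
  where "svd T s e f \<longleftrightarrow> ortho e \<and> ortho f \<and> (\<forall>k. 0 \<le> s k) \<and> (\<forall>k. e k = 0 \<longleftrightarrow> s k = 0)
    \<and> (\<forall>k. f k = 0 \<longleftrightarrow> s k = 0) \<and> s \<longlonglongrightarrow> 0 \<and> T = diag_op s e f"

text \<open>Greedy choice: \<open>e n\<close> maximises the norm of the image among unit vectors
  orthogonal to its predecessors. The first variation makes the images orthogonal, and the maximal
  value \<open>s n\<close> also bounds \<open>T\<close> on the remainder of any vector after
  projecting off the first n directions.\<close>

lemma svd_exists:
  fixes T :: "'a::complex_hilbert \<Rightarrow> 'a"
  assumes T: "compact_operator T"
  shows "\<exists>s e f. svd T s e f"
proof -
  define perp where "perp V y \<longleftrightarrow> (\<forall>v\<in>V. cinner y v = 0)" for V and y :: 'a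
  \<comment> \<open>If \<open>T\<close> vanishes on the orthogonal complement of \<open>V\<close>,
    the choice is 0; all later choices are then 0 as well.\<close>
  define pick where "pick V = (if \<forall>y. perp V y \<longrightarrow> T y = 0 then 0
    else SOME x. norm x = 1 \<and> perp V x \<and> (\<forall>y. perp V y \<longrightarrow> norm (T y) \<le> norm (T x) * norm y))" for V
  define E where "E = rec_nat {} (\<lambda>_ V. insert (pick V) V)"
  define e where "e n = pick (E n)" for n
  define s where "s n = norm (T (e n))" for n
  define f where "f n = (1 / s n) *\<^sub>R T (e n)" for n
  note lin = compact_operator_clinear[OF T]
  have ESuc: "E (Suc n) = insert (e n) (E n)" and E0: "E 0 = {}" for n
    by (auto simp: E_def e_def)
  have E: "E n = e ` {..<n}" for n
    by (induction n) (auto simp: ESuc E0 lessThan_Suc)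
  have pick: "(pick V = 0 \<or> norm (pick V) = 1 \<and> T (pick V) \<noteq> 0) \<and> perp V (pick V) \<and>
      (\<forall>y. perp V y \<longrightarrow> norm (T y) \<le> norm (T (pick V)) * norm y)" for V
  proof (cases "\<forall>y. perp V y \<longrightarrow> T y = 0")
    case True
    then show ?thesis by (simp add: pick_def perp_def)
  next
    case False
    then obtain x0 where x0: "perp V x0" "T x0 \<noteq> 0" by blast
    have "\<exists>x. norm x = 1 \<and> perp V x \<and> (\<forall>y. perp V y \<longrightarrow> norm (T y) \<le> norm (T x) * norm y)"
      using compact_operator_attains[OF T, of V x0] x0 unfolding perp_def by simp
    from someI_ex[OF this]
    have *: "norm (pick V) = 1 \<and> perp V (pick V) \<and> (\<forall>y. perp V y \<longrightarrow> norm (T y) \<le> norm (T (pick V)) * norm y)"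
      using False by (simp add: pick_def)
    then have "norm (T x0) \<le> norm (T (pick V)) * norm x0" using x0 by blast
    then have "T (pick V) \<noteq> 0" using x0(2) by auto
    with * show ?thesis by blast
  qed
  have e01: "e n = 0 \<or> norm (e n) = 1 \<and> T (e n) \<noteq> 0" for n using pick by (simp add: e_def)
  have e_perp: "perp (E n) (e n)" for n using pick by (simp add: e_def)
  have e_max: "norm (T y) \<le> s n * norm y" if "perp (E n) y" for n y
    using pick[of "E n"] that by (simp add: e_def s_def)
  have e_orth: "cinner (e n) (e m) = 0" if "m < n" for m n
    using e_perp[of n] that by (auto simp: perp_def E)
  have orth_e: "ortho e"
    unfolding ortho_def
  proof (intro conjI allI impI)
    fix k l :: nat assume "k \<noteq> l"
    then show "cinner (e k) (e l) = 0"
      using e_orth[of k l] e_orth[of l k] cinner_commute[of "e l" "e k"] by (cases "k < l") auto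
  qed (use e01 in auto)
  have s0: "s n = 0 \<longleftrightarrow> e n = 0" for n
    using e01[of n] by (auto simp: s_def clinear_zero[OF lin])
  have s_ge: "s n \<ge> 0" for n by (simp add: s_def)
  have perp_mono: "perp (E n) y" if "perp (E m) y" "n \<le> m" for m n y
    using that by (force simp: perp_def E)
  have Te_orth: "cinner (T (e n)) (T (e m)) = 0" if "n < m" for m n
  proof (cases "e n = 0")
    case False
    show ?thesis
    proof (rule maximizer_orthogonal[OF lin])
      show "norm (e n) = 1" using e01 False by blast
      show "cinner (e n) (e m) = 0" using orth_e that by (auto simp: ortho_def)
      fix c
      have "perp (E n) (e n + c *\<^sub>C e m)"
        using e_perp[of n] perp_mono[OF e_perp[of m], of n] that
        by (simp add: perp_def cinner_add_left cinner_scaleC_left)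
      from e_max[OF this] show "norm (T (e n + c *\<^sub>C e m)) \<le> norm (T (e n)) * norm (e n + c *\<^sub>C e m)"
        by (simp add: s_def)
    qed
  qed (simp add: clinear_zero[OF lin])
  have Te_orth': "cinner (T (e n)) (T (e m)) = 0" if "n \<noteq> m" for m n
    using that Te_orth[of n m] Te_orth[of m n] cinner_commute[of "T (e m)" "T (e n)"]
    by (cases "n < m") auto
  have f0: "f n = 0 \<longleftrightarrow> s n = 0" for n by (auto simp: f_def s_def)
  have Te: "T (e n) = s n *\<^sub>R f n" for n
    by (auto simp: f_def) (simp add: s_def)
  have orth_f: "ortho f"
    unfolding ortho_def
  proof (intro conjI allI impI)
    show "cinner (f k) (f l) = 0" if "k \<noteq> l" for k l
      using Te_orth'[OF that] by (simp add: f_def cinner_scaleR_left cinner_scaleR_right)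
    show "norm (f k) = 0 \<or> norm (f k) = 1" for k
      by (auto simp: f_def s_def)
  qed
  have s_dec: "s m \<le> s n" if "n \<le> m" for n m
  proof -
    have "s m \<le> s n * norm (e m)"
      using e_max[OF perp_mono[OF e_perp[of m] that]] by (simp add: s_def)
    also have "\<dots> \<le> s n" using ortho_norm_le[OF orth_e] s_ge by (simp add: mult_left_le)
    finally show ?thesis .
  qed
  have s_lim: "s \<longlonglongrightarrow> 0"
  proof (rule LIMSEQ_I)
    fix \<delta> :: real assume \<delta>: "\<delta> > 0"
    \<comment> \<open>Otherwise the images, being orthogonal and of norm at least
      \<open>\<delta>\<close>, would stay apart and could not have a convergent subsequence.\<close>
    have "\<exists>n. s n < \<delta>"
    proof (rule ccontr)
      assume "\<nexists>n. s n < \<delta>"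
      then have ge: "s n \<ge> \<delta>" for n by (simp add: not_less)
      have "seq_compact (closure (T ` cball 0 1))"
        using T unfolding compact_operator_def compact_eq_seq_compact_metric by simp
      moreover have "\<forall>n. T (e n) \<in> closure (T ` cball 0 1)"
        using ortho_norm_le[OF orth_e] by (intro allI subsetD[OF closure_subset] imageI) simp
      ultimately obtain y r where r: "strict_mono (r :: nat \<Rightarrow> nat)" and y: "((\<lambda>n. T (e n)) \<circ> r) \<longlonglongrightarrow> y"
        unfolding seq_compact_def by metis
      from y have "Cauchy (\<lambda>n. T (e (r n)))" unfolding o_def by (rule LIMSEQ_imp_Cauchy)
      then obtain N where N: "\<forall>m\<ge>N. \<forall>n\<ge>N. dist (T (e (r m))) (T (e (r n))) < \<delta>"
        using \<delta> unfolding Cauchy_def by auto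
      have lt: "norm (T (e (r N)) - T (e (r (Suc N)))) < \<delta>"
        using N[rule_format, of N "Suc N"] by (simp add: dist_norm)
      have "r N \<noteq> r (Suc N)" using strict_monoD[OF r, of N "Suc N"] by simp
      then have "(norm (T (e (r N)) - T (e (r (Suc N)))))\<^sup>2 = (s (r N))\<^sup>2 + (s (r (Suc N)))\<^sup>2"
        by (simp add: norm_diff_sq Te_orth' s_def)
      moreover have "(s (r N))\<^sup>2 \<ge> \<delta>\<^sup>2" using ge \<delta> by (intro power_mono) auto
      ultimately have "\<delta>\<^sup>2 \<le> (norm (T (e (r N)) - T (e (r (Suc N)))))\<^sup>2"
        using zero_le_power2[of "s (r (Suc N))"] by linarith
      then have "\<delta> \<le> norm (T (e (r N)) - T (e (r (Suc N))))"
        by (rule power2_le_imp_le) simp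
      with lt show False by simp
    qed
    then obtain N where "s N < \<delta>" ..
    then show "\<exists>no. \<forall>n\<ge>no. norm (s n - 0) < \<delta>"
      using s_dec[of N] s_ge by (intro exI[of _ N]) (auto intro: le_less_trans)
  qed
  have s_bd: "\<forall>k. \<bar>s k\<bar> \<le> s 0" using s_dec[of 0] s_ge by simp
  have "T x = diag_op s e f x" for x
  proof -
    define p where "p n = (\<Sum>k<n. cinner x (e k) *\<^sub>C e k)" for n
    have Tp: "T (p n) = (\<Sum>k<n. (of_real (s k) * cinner x (e k)) *\<^sub>C f k)" for n
      unfolding p_def clinear_sum[OF lin]
      by (intro sum.cong refl)
        (simp add: clinear_scaleC[OF lin] Te scaleC_of_real[symmetric] scaleC_scaleC mult.commute)
    have bd: "norm (T x - T (p n)) \<le> s n * norm x" for n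
    proof -
      have cp: "cinner (p n) (e m) = (if m < n then cinner x (e m) else 0)" for m
      proof -
        have "cinner (p n) (e m) = (\<Sum>k<n. if k = m then (if e m = 0 then 0 else cinner x (e m)) else 0)"
          unfolding p_def cinner_sum_left
          by (intro sum.cong refl) (auto simp: cinner_scaleC_left ortho_cinner[OF orth_e])
        then show ?thesis by (auto simp: sum.delta)
      qed
      have "perp (E n) (x - p n)"
        by (auto simp: perp_def E cinner_diff_left cp)
      from e_max[OF this] have "norm (T x - T (p n)) \<le> s n * norm (x - p n)"
        by (simp add: clinear_diff[OF lin])
      also have "\<dots> \<le> s n * norm x"
      proof (intro mult_left_mono s_ge power2_le_imp_le[OF _ norm_ge_zero])
        have "cinner (x - p n) (p n) = 0"
          unfolding p_def[of n] cinner_sum_right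
          by (intro sum.neutral ballI)
            (simp add: cinner_scaleC_right cinner_diff_left cp p_def[of n, symmetric])
        then show "(norm (x - p n))\<^sup>2 \<le> (norm x)\<^sup>2"
          using norm_add_sq[of "x - p n" "p n"] by simp
      qed
      finally show ?thesis .
    qed
    have "(\<lambda>n. T x - T (p n)) \<longlonglongrightarrow> 0"
      by (rule Lim_null_comparison[OF always_eventually[OF allI[OF bd]]])
        (use tendsto_mult_left[OF s_lim, of "norm x"] in \<open>simp add: mult.commute\<close>)
    from tendsto_diff[OF tendsto_const this, of "T x"] have "(\<lambda>n. T (p n)) \<longlonglongrightarrow> T x"
      by simp
    then have "(\<lambda>k. (of_real (s k) * cinner x (e k)) *\<^sub>C f k) sums T x"
      unfolding sums_def Tp .
    with diag_op_sums[OF orth_e orth_f s_bd] show ?thesis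
      by (rule sums_unique2[symmetric])
  qed
  then have "svd T s e f"
    unfolding svd_def using orth_e orth_f s_ge s0 f0 s_lim by auto
  then show ?thesis by blast
qed

section \<open>Adjoint, absolute value and singular values in terms of the decomposition\<close>

lemma cinner_ext_right: "(\<And>x. cinner x y = cinner x z) \<Longrightarrow> y = (z :: 'a::complex_hilbert)"
  using cinner_ext[of y z] by (metis cinner_commute)

lemma svdD:
  assumes "svd T s e f"
  shows "ortho e" "ortho f" "0 \<le> s k" "e k = 0 \<longleftrightarrow> s k = 0" "f k = 0 \<longleftrightarrow> s k = 0" "s \<longlonglongrightarrow> 0" "T = diag_op s e f"
  using assms by (auto simp: svd_def)

lemma svd_bounded:
  assumes "svd T s e f"
  obtains C where "C \<ge> 0" "\<forall>k. \<bar>s k\<bar> \<le> C"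
proof -
  have "Bseq s" using svdD(6)[OF assms] convergentI convergent_imp_Bseq by blast
  then obtain C where "C > 0" "\<forall>k. \<bar>s k\<bar> \<le> C" unfolding Bseq_def by auto
  with that show ?thesis by (meson less_imp_le)
qed

lemma svd_compact: "svd T s e f \<Longrightarrow> compact_operator T"
  by (metis svd_def compact_operator_diag_op)

text \<open>\<open>cadjoint\<close> is a choice. The exchanged diagonal operator witnesses
  existence, so the chosen map is an adjoint too, and inner products determine its values.\<close>

lemma svd_cadjoint:
  assumes "svd T s e f" shows "cadjoint T = diag_op s f e"
proof -
  obtain C where C: "\<forall>k. \<bar>s k\<bar> \<le> C" using svd_bounded[OF assms] by metis
  note D = svdD[OF assms]
  have ex: "\<forall>x y. cinner (T x) y = cinner x (diag_op s f e y)"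
    unfolding D(7) using cinner_diag_op_adjoint[OF D(1,2) C] by simp
  have *: "\<forall>x y. cinner (T x) y = cinner x (cadjoint T y)"
    unfolding cadjoint_def
    by (rule someI[of "\<lambda>T'. \<forall>x y. cinner (T x) y = cinner x (T' y)", OF ex])
  show ?thesis
  proof
    fix y show "cadjoint T y = diag_op s f e y"
      by (rule cinner_ext_right) (simp only: ex[rule_format, symmetric] *[rule_format, symmetric])
  qed
qed

text \<open>The sesquilinear form \<open>d\<close> measuring the failure of symmetry vanishes on the
  diagonal, because \<open>cinner (S z) z\<close> is real; polarising with \<open>x + y\<close> and
  \<open>x + \<i> *\<^sub>C y\<close> shows that it vanishes everywhere.\<close>

lemma positive_operator_symmetric:
  assumes "positive_operator S" shows "cinner (S x) y = cinner x (S y)"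
proof -
  have lin: "clinear S" and nn: "cinner (S z) z \<in> \<real>\<^sub>\<ge>\<^sub>0" for z
    using assms by (auto simp: positive_operator_def)
  have re: "cinner (S z) z = cinner z (S z)" for z
    using nn[of z] cinner_commute[of z "S z"] by (simp add: complex_nonneg_Reals_iff complex_eq_iff)
  define d where "d u v = cinner (S u) v - cinner u (S v)" for u v
  have d0: "d z z = 0" for z using re by (simp add: d_def)
  have 1: "d x y + d y x = 0"
    using d0[of "x + y"] d0[of x] d0[of y]
    by (simp add: d_def clinear_add[OF lin] cinner_add_left cinner_add_right algebra_simps)
  have "d (x + \<i> *\<^sub>C y) (x + \<i> *\<^sub>C y) = d x x + d y y - \<i> * d x y + \<i> * d y x"
    by (simp add: d_def clinear_add[OF lin] clinear_scaleC[OF lin] cinner_add_left cinner_add_right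
      cinner_scaleC_left cinner_scaleC_right algebra_simps)
  then have "\<i> * d y x = \<i> * d x y" using d0 by simp
  with 1 have "d x y = 0" by simp
  then show ?thesis by (simp add: d_def)
qed

text \<open>\<open>abs_operator\<close> is a definite description, so uniqueness of the positive
  square root has to be established together with existence.\<close>

lemma svd_abs_operator:
  assumes "svd T s e f" shows "abs_operator T = diag_op s e e"
proof -
  obtain C where C: "\<forall>k. \<bar>s k\<bar> \<le> C" using svd_bounded[OF assms] by metis
  note D = svdD[OF assms]
  let ?A = "diag_op s e e" and ?G = "diag_op (\<lambda>k. s k * s k) e e"
  have G: "cadjoint T \<circ> T = ?G"
  proof
    fix x
    have "(cadjoint T \<circ> T) x = diag_op s f e (diag_op s e f x)"
      using svd_cadjoint[OF assms] D(7) by (metis comp_apply)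
    also have "\<dots> = ?G x"
      by (rule diag_op_comp[OF D(1,2,1) C]) (use D(4,5) in auto)
    finally show "(cadjoint T \<circ> T) x = ?G x" .
  qed
  have A2: "?A (?A x) = ?G x" for x
    using diag_op_comp[OF D(1,1,1) C] by simp
  note cA = compact_operator_diag_op[OF D(1,1,6)]
  have pos: "positive_operator ?A"
    unfolding positive_operator_def
  proof (intro conjI allI)
    show "clinear ?A" "bounded_linear ?A"
      using cA by (simp_all add: compact_operator_clinear compact_operator_bounded_linear)
    fix x
    have A: "(\<lambda>k. of_real (s k) * cinner x (e k) * cinner (e k) x) sums cinner (?A x) x"
      by (rule cinner_diag_op_sums[OF D(1,1) C])
    have B: "of_real (s k) * cinner x (e k) * cinner (e k) x
        = complex_of_real (s k * (cmod (cinner x (e k)))\<^sup>2)" for k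
      using cinner_commute[of "e k" x] unfolding of_real_mult complex_norm_square by simp
    have *: "(\<lambda>k. complex_of_real (s k * (cmod (cinner x (e k)))\<^sup>2)) sums cinner (?A x) x"
      using A unfolding B .
    have "(\<lambda>k. s k * (cmod (cinner x (e k)))\<^sup>2) sums Re (cinner (?A x) x)"
      using sums_Re[OF *] by simp
    then have "0 \<le> Re (cinner (?A x) x)"
      by (rule sums_le[OF _ sums_zero, rotated]) (use D(3) in simp)
    moreover have "Im (cinner (?A x) x) = 0"
      using sums_Im[OF *] by (simp add: sums_iff)
    ultimately show "cinner (?A x) x \<in> \<real>\<^sub>\<ge>\<^sub>0"
      by (simp add: complex_nonneg_Reals_iff)
  qed
  have uniq: "S = ?A" if S: "positive_operator S" "S \<circ> S = cadjoint T \<circ> T" for S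
  proof
    fix x
    have linS: "clinear S" and bS: "bounded_linear S" using S(1) by (auto simp: positive_operator_def)
    have S2: "S (S y) = ?G y" for y using S(2) G by (metis comp_apply)
    have Sk: "S (e k) = s k *\<^sub>R e k" for k
    proof (cases "s k = 0")
      case True
      then show ?thesis using D(4)[of k] clinear_zero[OF linS] by simp
    next
      case False
      then have sk: "s k > 0" using D(3)[of k] by simp
      \<comment> \<open>Since \<open>S \<circ> S\<close> has eigenvalue \<open>s k * s k\<close> at
        \<open>e k\<close>, this vector satisfies \<open>S w = - (s k *\<^sub>R w)\<close>;
        positivity forces it to be 0.\<close>
      define w where "w = S (e k) - s k *\<^sub>R e k"
      have "S (S (e k)) = (s k * s k) *\<^sub>R e k"
        unfolding S2 using diag_op_basis[OF D(1), of "\<lambda>k. s k * s k" e k] sk D(4)[of k]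
        by (simp add: scaleC_of_real del: of_real_mult)
      then have "S w = - (s k *\<^sub>R w)"
        by (simp add: w_def clinear_diff[OF linS] clinear_scaleR[OF linS] algebra_simps)
      then have "cinner (S w) w = - of_real (s k * (norm w)\<^sup>2)"
        by (simp add: cinner_minus_left cinner_scaleR_left cinner_self)
      moreover have "cinner (S w) w \<in> \<real>\<^sub>\<ge>\<^sub>0" using S(1) by (simp add: positive_operator_def)
      ultimately have "0 \<le> - (s k * (norm w)\<^sup>2)"
        by (auto simp: complex_nonneg_Reals_iff simp flip: of_real_mult of_real_power)
      then have "(norm w)\<^sup>2 \<le> 0" using sk by (simp add: mult_le_0_iff)
      then show ?thesis by (simp add: w_def)
    qed
    have "\<forall>k. \<bar>1 :: real\<bar> \<le> 1" by simp
    note one = diag_op_sums[OF D(1,1) this, of x] clinear_diag_op[OF D(1,1) this]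
      cinner_diag_op_coeff[OF D(1,1) this]
    \<comment> \<open>The projection of \<open>x\<close> onto the closed span of \<open>e\<close>.
      On the complementary part \<open>S \<circ> S\<close> vanishes, hence so does \<open>S\<close>
      by symmetry.\<close>
    define P where "P = diag_op (\<lambda>_. 1) e e x"
    have "(\<lambda>k. S ((of_real 1 * cinner x (e k)) *\<^sub>C e k)) sums S P"
      unfolding P_def by (rule bounded_linear.sums[OF bS one(1)])
    then have "(\<lambda>k. (of_real (s k) * cinner x (e k)) *\<^sub>C e k) sums S P"
      by (simp add: clinear_scaleC[OF linS] Sk scaleC_of_real[symmetric] scaleC_scaleC mult.commute)
    with diag_op_sums[OF D(1,1) C, of x] have SP: "S P = ?A x"
      by (rule sums_unique2[symmetric])
    have "cinner (x - P) (e k) = 0" for k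
      using one(3)[of x k] by (auto simp: P_def cinner_diff_left)
    then have "?G (x - P) = 0" by (simp add: diag_op_def)
    then have "cinner (S (S (x - P))) (x - P) = 0" by (simp add: S2)
    then have "cinner (S (x - P)) (S (x - P)) = 0"
      using positive_operator_symmetric[OF S(1), of "S (x - P)" "x - P"] by simp
    then have "S (x - P) = 0" by (simp add: cinner_self)
    then show "S x = ?A x" using SP by (simp add: clinear_diff[OF linS])
  qed
  show ?thesis
    unfolding abs_operator_def
  proof (rule the_equality)
    show "positive_operator ?A \<and> ?A \<circ> ?A = cadjoint T \<circ> T"
      using pos A2 G by (auto simp: fun_eq_iff)
  qed (use uniq in blast)
qed

text \<open>Comparing coefficients, an eigenvector is orthogonal to every \<open>e k\<close> with
  \<open>s k \<noteq> \<mu>\<close>. The series for its image thus reduces to a finite sum, and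
  dividing by \<open>\<mu>\<close> recovers the vector itself.\<close>

lemma svd_eigenspace:
  assumes "svd T s e f" and \<mu>: "\<mu> > 0"
  shows "eigenspace (abs_operator T) (of_real \<mu>) = complex_vector.span (e ` {k. s k = \<mu>})"
    and "complex_vector.dim (eigenspace (abs_operator T) (of_real \<mu>)) = card {k. s k = \<mu>}"
    and "finite {k. s k = \<mu>}"
proof -
  obtain C where C: "\<forall>k. \<bar>s k\<bar> \<le> C" using svd_bounded[OF assms(1)] by metis
  note D = svdD[OF assms(1)]
  let ?A = "diag_op s e e" and ?K = "{k. s k = \<mu>}"
  have lin: "clinear ?A" by (rule clinear_diag_op[OF D(1,1) C])
  obtain n where n: "\<And>k. k \<ge> n \<Longrightarrow> \<bar>s k\<bar> < \<mu>"
    using LIMSEQ_D[OF D(6) \<mu>] by auto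
  have "?K \<subseteq> {..<n}"
  proof
    fix k assume "k \<in> ?K"
    then have "\<not> n \<le> k" using n[of k] by auto
    then show "k \<in> {..<n}" by simp
  qed
  then show fin: "finite ?K" by (rule finite_subset) simp
  have nz: "e k \<noteq> 0" if "k \<in> ?K" for k using D(4)[of k] that \<mu> by auto
  have inj: "inj_on e ?K"
  proof (rule inj_onI)
    fix k l assume "k \<in> ?K" "l \<in> ?K" "e k = e l"
    then have "cinner (e k) (e l) = 1" using nz[of k] by (metis ortho_cinner[OF D(1)])
    then show "k = l" by (simp add: ortho_cinner[OF D(1)] split: if_splits)
  qed
  have ind: "complex_vector.independent (e ` ?K)"
  proof (rule complex_vector.independent_if_scalars_zero)
    show "finite (e ` ?K)" using fin by simp
    fix g x assume s0: "(\<Sum>x\<in>e ` ?K. g x *\<^sub>C x) = 0" and "x \<in> e ` ?K"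
    then obtain l where l: "l \<in> ?K" "x = e l" by blast
    have "0 = cinner (\<Sum>x\<in>e ` ?K. g x *\<^sub>C x) (e l)" by (simp add: s0)
    also have "\<dots> = (\<Sum>k\<in>?K. g (e k) * cinner (e k) (e l))"
      by (simp add: sum.reindex[OF inj] cinner_sum_left cinner_scaleC_left)
    also have "\<dots> = (\<Sum>k\<in>?K. if k = l then g (e l) else 0)"
      using nz by (intro sum.cong refl) (auto simp: ortho_cinner[OF D(1)])
    also have "\<dots> = g x" using fin l by simp
    finally show "g x = 0" by simp
  qed
  have sub: "complex_vector.span (e ` ?K) \<subseteq> eigenspace ?A (of_real \<mu>)"
  proof (rule complex_vector.span_minimal)
    show "e ` ?K \<subseteq> eigenspace ?A (of_real \<mu>)"
      using nz by (auto simp: eigenspace_def diag_op_basis[OF D(1)])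
    show "complex_vector.subspace (eigenspace ?A (of_real \<mu>))"
      using lin by (auto simp: complex_vector.subspace_def eigenspace_def clinear_add clinear_zero
        clinear_scaleC scaleC_add_right scaleC_scaleC mult.commute)
  qed
  have sup: "x \<in> complex_vector.span (e ` ?K)" if "x \<in> eigenspace ?A (of_real \<mu>)" for x
  proof -
    have Ax: "?A x = of_real \<mu> *\<^sub>C x" using that by (simp add: eigenspace_def)
    have z: "cinner x (e k) = 0" if "k \<notin> ?K" for k
    proof (cases "e k = 0")
      case False
      have "of_real \<mu> * cinner x (e k) = of_real (s k) * cinner x (e k)"
        using cinner_diag_op_coeff[OF D(1,1) C, of x k] False unfolding Ax by (simp add: cinner_scaleC_left)
      then show ?thesis using that by simp
    qed simp
    have "(\<lambda>k. if k \<in> ?K then (of_real (s k) * cinner x (e k)) *\<^sub>C e k else 0)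
        sums (\<Sum>k\<in>?K. (of_real (s k) * cinner x (e k)) *\<^sub>C e k)"
      by (rule sums_If_finite_set[OF fin])
    moreover have "(\<lambda>k. if k \<in> ?K then (of_real (s k) * cinner x (e k)) *\<^sub>C e k else 0)
        = (\<lambda>k. (of_real (s k) * cinner x (e k)) *\<^sub>C e k)"
      using z by auto
    ultimately have "?A x = (\<Sum>k\<in>?K. (of_real (s k) * cinner x (e k)) *\<^sub>C e k)"
      using sums_unique2[OF diag_op_sums[OF D(1,1) C, of x]] by simp
    then have "of_real \<mu> *\<^sub>C x \<in> complex_vector.span (e ` ?K)"
      unfolding Ax[symmetric]
      by (simp only:) (intro complex_vector.span_sum complex_vector.span_scale complex_vector.span_base imageI)
    from complex_vector.span_scale[OF this, of "inverse (of_real \<mu>)"] show ?thesis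
      using \<mu> by (simp add: scaleC_scaleC)
  qed
  show eq: "eigenspace (abs_operator T) (of_real \<mu>) = complex_vector.span (e ` {k. s k = \<mu>})"
    unfolding svd_abs_operator[OF assms(1)] using sub sup by blast
  show "complex_vector.dim (eigenspace (abs_operator T) (of_real \<mu>)) = card {k. s k = \<mu>}"
    unfolding eq complex_vector.dim_span_eq_card_independent[OF ind] by (rule card_image[OF inj])
qed

lemma svd_nonzero_singular_values:
  assumes "svd T s e f"
  shows "nonzero_singular_values T = s ` {k. s k > 0}"
proof -
  have "eigenspace (abs_operator T) (of_real \<mu>) \<noteq> {0} \<longleftrightarrow> (\<exists>k. s k = \<mu>)" if "\<mu> > 0" for \<mu>
  proof -
    have "e ` {k. s k = \<mu>} \<subseteq> {0} \<longleftrightarrow> (\<nexists>k. s k = \<mu>)"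
      using svdD(4)[OF assms] that by auto
    moreover have "complex_vector.span X = {0} \<longleftrightarrow> X \<subseteq> {0}" for X :: "'a set"
      by (metis complex_vector.span_empty complex_vector.span_insert_0 complex_vector.span_superset
          subset_singletonD)
    ultimately show ?thesis
      unfolding svd_eigenspace(1)[OF assms that] by blast
  qed
  then show ?thesis
    unfolding nonzero_singular_values_def by auto
qed

text \<open>Passage from distinct values with multiplicities to a plain series: the fibre of
  \<open>s\<close> over each positive value is finite and its cardinality is the multiplicity.
  Eigenspaces do not reappear after this point.\<close>

lemma svd_power_sum:
  assumes "svd T s e f"
  shows "schatten_power_sum q T = (\<Sum>k. ennreal (s k powr q))"
proof -
  note D = svdD[OF assms]
  define g where "g \<mu> = of_nat (singular_value_mult T \<mu>) * ennreal (\<mu> powr q)" for \<mu>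
  have fin: "finite {k. s k = \<mu>}" and g: "g \<mu> = (\<Sum>k\<in>{k. s k = \<mu>}. ennreal (s k powr q))" if "\<mu> > 0" for \<mu>
    using svd_eigenspace(2,3)[OF assms that] by (auto simp: g_def singular_value_mult_def)
  have eq: "schatten_power_sum q T = (SUP F\<in>{F. finite F \<and> F \<subseteq> nonzero_singular_values T}. sum g F)"
    unfolding schatten_power_sum_def g_def by (rule nonneg_infsum_complete) simp
  show ?thesis
  proof (rule antisym)
    show "schatten_power_sum q T \<le> (\<Sum>k. ennreal (s k powr q))"
      unfolding eq
    proof (rule SUP_least)
      fix F assume "F \<in> {F. finite F \<and> F \<subseteq> nonzero_singular_values T}"
      then have F: "finite F" "\<And>\<mu>. \<mu> \<in> F \<Longrightarrow> \<mu> > 0"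
        unfolding svd_nonzero_singular_values[OF assms] by auto
      have "sum g F = (\<Sum>\<mu>\<in>F. \<Sum>k\<in>{k. s k = \<mu>}. ennreal (s k powr q))"
        using g F(2) by (intro sum.cong) auto
      also have "\<dots> = (\<Sum>k\<in>(\<Union>\<mu>\<in>F. {k. s k = \<mu>}). ennreal (s k powr q))"
        using F fin by (intro sum.UNION_disjoint[symmetric]) auto
      also have "\<dots> \<le> (\<Sum>k. ennreal (s k powr q))"
        using F fin by (intro sum_le_suminf) auto
      finally show "sum g F \<le> (\<Sum>k. ennreal (s k powr q))" .
    qed
    show "(\<Sum>k. ennreal (s k powr q)) \<le> schatten_power_sum q T"
    proof (rule suminf_le_const)
      fix n
      define S where "S = {k \<in> {..<n}. s k > 0}"
      have "(\<Sum>k<n. ennreal (s k powr q)) = (\<Sum>k\<in>S. ennreal (s k powr q))"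
        using D(3) by (intro sum.mono_neutral_right) (auto simp: S_def le_less)
      also have "\<dots> = (\<Sum>\<mu>\<in>s ` S. \<Sum>k\<in>{k\<in>S. s k = \<mu>}. ennreal (s k powr q))"
        by (intro sum.group[symmetric]) (auto simp: S_def)
      also have "\<dots> \<le> (\<Sum>\<mu>\<in>s ` S. g \<mu>)"
      proof (rule sum_mono)
        fix \<mu> assume "\<mu> \<in> s ` S"
        then have "\<mu> > 0" by (auto simp: S_def)
        then show "(\<Sum>k\<in>{k\<in>S. s k = \<mu>}. ennreal (s k powr q)) \<le> g \<mu>"
          unfolding g[OF \<open>\<mu> > 0\<close>] using fin by (intro sum_mono2) auto
      qed
      also have "\<dots> \<le> schatten_power_sum q T"
        unfolding eq
        by (rule SUP_upper) (auto simp: svd_nonzero_singular_values[OF assms] S_def)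
      finally show "(\<Sum>k<n. ennreal (s k powr q)) \<le> schatten_power_sum q T" .
    qed simp
  qed
qed

section \<open>Diagonal estimates for Schatten norms\<close>

text \<open>The tangent of the convex power function at \<open>c\<close> lies below its graph;
  rearranged, this is Young's inequality with exponents q and q/(q-1).\<close>

lemma powr_tangent:
  fixes s c q :: real
  assumes "q \<ge> 1" "s \<ge> 0" "c \<ge> 0"
  shows "q * (c powr (q - 1) * s) \<le> s powr q + (q - 1) * c powr q"
proof (cases "s = 0 \<or> c = 0")
  case False
  have "(s powr q) powr (1 / q) * (c powr q) powr (1 - 1 / q) \<le> (1 / q) * s powr q + (1 - 1 / q) * c powr q"
    using False assms by (intro Youngs_inequality_0) auto
  moreover have "q * (1 - 1 / q) = q - 1" using assms by (simp add: field_simps)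
  ultimately have "s * c powr (q - 1) \<le> (1 / q) * s powr q + (1 - 1 / q) * c powr q"
    using assms by (simp add: powr_powr)
  then have "q * (s * c powr (q - 1)) \<le> q * ((1 / q) * s powr q + (1 - 1 / q) * c powr q)"
    using assms by (intro mult_left_mono) auto
  also have "\<dots> = s powr q + (q - 1) * c powr q"
    using assms by (simp add: field_simps)
  finally show ?thesis by (simp add: mult.commute)
qed (use assms in auto)

text \<open>Jensen's inequality with total weight at most 1: the tangent inequality at the weighted
  sum \<open>c\<close> is averaged. Missing weight is harmless because the term
  \<open>(q - 1) * c powr q\<close> is nonnegative.\<close>

lemma powr_weighted_sum_le:
  fixes s w :: "'i \<Rightarrow> real"
  assumes "q \<ge> 1" and "\<And>k. k \<in> K \<Longrightarrow> 0 \<le> w k" and "\<And>k. k \<in> K \<Longrightarrow> 0 \<le> s k" and W: "(\<Sum>k\<in>K. w k) \<le> 1"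
  shows "(\<Sum>k\<in>K. w k * s k) powr q \<le> (\<Sum>k\<in>K. w k * s k powr q)"
proof (cases "(\<Sum>k\<in>K. w k * s k) = 0")
  case True
  then show ?thesis using assms by (simp add: sum_nonneg)
next
  case False
  define c where "c = (\<Sum>k\<in>K. w k * s k)"
  define V where "V = (\<Sum>k\<in>K. w k)"
  have c: "c > 0" using False assms by (simp add: c_def less_le sum_nonneg)
  have "(\<Sum>k\<in>K. w k * (q * (c powr (q - 1) * s k))) \<le> (\<Sum>k\<in>K. w k * (s k powr q + (q - 1) * c powr q))"
    using assms c by (intro sum_mono mult_left_mono powr_tangent) auto
  moreover have "(\<Sum>k\<in>K. w k * (q * (c powr (q - 1) * s k))) = q * (c powr (q - 1) * c)"
  proof -
    have "(\<Sum>k\<in>K. w k * (q * (b * s k))) = q * (b * (\<Sum>k\<in>K. w k * s k))" for b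
      by (simp add: sum_distrib_left mult_ac)
    then show ?thesis by (simp only: c_def[symmetric])
  qed
  moreover have "c powr (q - 1) * c = c powr q"
    using c by (simp add: powr_diff)
  moreover have "(\<Sum>k\<in>K. w k * (s k powr q + (q - 1) * c powr q))
      = (\<Sum>k\<in>K. w k * s k powr q) + V * ((q - 1) * c powr q)"
    unfolding V_def by (simp add: distrib_left sum.distrib sum_distrib_right)
  moreover have "V * ((q - 1) * c powr q) \<le> 1 * ((q - 1) * c powr q)"
    using W assms(1) by (intro mult_right_mono) (auto simp: V_def)
  ultimately have "q * c powr q \<le> (\<Sum>k\<in>K. w k * s k powr q) + (q - 1) * c powr q"
    by simp
  then show ?thesis
    unfolding c_def[symmetric] by (simp add: left_diff_distrib)
qed

lemma sum_mult_le_sq: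
  fixes a b :: "'i \<Rightarrow> real"
  assumes "(\<Sum>k\<in>K. (a k)\<^sup>2) \<le> A\<^sup>2" "(\<Sum>k\<in>K. (b k)\<^sup>2) \<le> B\<^sup>2" "A \<ge> 0" "B \<ge> 0"
  shows "(\<Sum>k\<in>K. a k * b k) \<le> A * B"
proof (rule power2_le_imp_le)
  have "(\<Sum>k\<in>K. a k * b k)\<^sup>2 \<le> (\<Sum>k\<in>K. (a k)\<^sup>2) * (\<Sum>k\<in>K. (b k)\<^sup>2)"
    by (rule Cauchy_Schwarz_ineq_sum)
  also have "\<dots> \<le> A\<^sup>2 * B\<^sup>2"
    using assms by (intro mult_mono) (auto simp: sum_nonneg)
  finally show "(\<Sum>k\<in>K. a k * b k)\<^sup>2 \<le> (A * B)\<^sup>2" by (simp add: power_mult_distrib)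
qed (use assms in simp)

text \<open>
  The weights \<open>cmod (cinner x (e k)) * cmod (cinner (f k) y)\<close> form a doubly substochastic matrix,
  so Jensen's inequality applies.
\<close>

lemma schatten_power_sum_ge:
  assumes T: "compact_operator T" and q: "q \<ge> 1" and F: "finite F" "bessel_on F x" "bessel_on F y"
  shows "ennreal (\<Sum>a\<in>F. cmod (cinner (T (x a)) (y a)) powr q) \<le> schatten_power_sum q T"
proof -
  obtain s e f where svd: "svd T s e f" using svd_exists[OF T] by blast
  note D = svdD[OF svd]
  obtain C where C: "\<forall>k. \<bar>s k\<bar> \<le> C" using svd_bounded[OF svd] by metis
  define w where "w a k = cmod (cinner (x a) (e k)) * cmod (cinner (f k) (y a))" for a k
  have w_nonneg: "w a k \<ge> 0" for a k by (simp add: w_def)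
  have row: "(\<Sum>k<n. w a k) \<le> 1" if "a \<in> F" for a n
  proof -
    have "(\<Sum>k<n. w a k) \<le> norm (x a) * norm (y a)"
      unfolding w_def
      by (intro sum_mult_le_sq bessel_onD bessel_onD' bessel_ortho D) auto
    also have "\<dots> \<le> 1 * 1"
      using bessel_norm_le[OF F(2,1) that] bessel_norm_le[OF F(3,1) that] by (intro mult_mono) auto
    finally show ?thesis by simp
  qed
  have col: "(\<Sum>a\<in>F. w a k) \<le> 1" for k
  proof -
    have "(\<Sum>a\<in>F. w a k) \<le> norm (e k) * norm (f k)"
      unfolding w_def
      by (intro sum_mult_le_sq bessel_onD bessel_onD' F) auto
    also have "\<dots> \<le> 1 * 1"
      using ortho_norm_le[OF D(1)] ortho_norm_le[OF D(2)] by (intro mult_mono) auto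
    finally show ?thesis by simp
  qed
  \<comment> \<open>Truncating the singular value expansion keeps all interchanges of sums finite;
    the limit in \<open>n\<close> is taken at the end.\<close>
  define p where "p n a = (\<Sum>k<n. of_real (s k) * cinner (x a) (e k) * cinner (f k) (y a))" for n a
  have lim: "(\<lambda>n. \<Sum>a\<in>F. cmod (p n a) powr q) \<longlonglongrightarrow> (\<Sum>a\<in>F. cmod (cinner (T (x a)) (y a)) powr q)"
  proof (intro tendsto_sum tendsto_powr' tendsto_norm tendsto_const)
    show "(\<lambda>n. p n a) \<longlonglongrightarrow> cinner (T (x a)) (y a)" for a
      using cinner_diag_op_sums[OF D(1,2) C, of "x a" "y a"] unfolding p_def sums_def D(7) .
  qed (use q in auto)
  have bound: "(\<Sum>a\<in>F. cmod (p n a) powr q) \<le> (\<Sum>k<n. s k powr q)" for n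
  proof -
    have "(\<Sum>a\<in>F. cmod (p n a) powr q) \<le> (\<Sum>a\<in>F. \<Sum>k<n. w a k * s k powr q)"
    proof (rule sum_mono)
      fix a assume "a \<in> F"
      have "cmod (p n a) \<le> (\<Sum>k<n. w a k * s k)"
        unfolding p_def w_def
        by (rule order_trans[OF norm_sum], intro sum_mono) (simp add: norm_mult D(3))
      then have "cmod (p n a) powr q \<le> (\<Sum>k<n. w a k * s k) powr q"
        using q by (intro powr_mono2) auto
      also have "\<dots> \<le> (\<Sum>k<n. w a k * s k powr q)"
        using q row[OF \<open>a \<in> F\<close>] D(3) by (intro powr_weighted_sum_le) (auto simp: w_nonneg)
      finally show "cmod (p n a) powr q \<le> (\<Sum>k<n. w a k * s k powr q)" .
    qed
    also have "\<dots> = (\<Sum>k<n. (\<Sum>a\<in>F. w a k) * s k powr q)"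
      by (subst sum.swap) (simp add: sum_distrib_right)
    also have "\<dots> \<le> (\<Sum>k<n. 1 * s k powr q)"
      by (intro sum_mono mult_right_mono col) simp
    finally show ?thesis by simp
  qed
  have "ennreal (\<Sum>a\<in>F. cmod (p n a) powr q) \<le> schatten_power_sum q T" for n
  proof -
    have "ennreal (\<Sum>a\<in>F. cmod (p n a) powr q) \<le> (\<Sum>k<n. ennreal (s k powr q))"
      using bound[of n] by (simp add: sum_ennreal ennreal_leI)
    also have "\<dots> \<le> schatten_power_sum q T"
      unfolding svd_power_sum[OF svd] by (rule sum_le_suminf) auto
    finally show ?thesis .
  qed
  then show ?thesis
    by (intro LIMSEQ_le_const2[OF tendsto_ennrealI[OF lim]]) auto
qed

text \<open>The singular vectors of \<open>T\<close> are themselves admissible test systems, and on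
  them the inner products are the singular values. With \<open>schatten_power_sum_ge\<close> this is
  the variational formula by which Schatten norms of sums and limits are estimated.\<close>

lemma schatten_power_sum_le:
  assumes T: "compact_operator T"
    and le: "\<And>(n::nat) x y. ortho x \<Longrightarrow> ortho y \<Longrightarrow> (\<Sum>a<n. cmod (cinner (T (x a)) (y a)) powr q) \<le> C"
  shows "schatten_power_sum q T \<le> ennreal C"
proof -
  obtain s e f where svd: "svd T s e f" using svd_exists[OF T] by blast
  note D = svdD[OF svd]
  obtain B where B: "\<forall>k. \<bar>s k\<bar> \<le> B" using svd_bounded[OF svd] by metis
  have "cinner (T (e k)) (f k) = of_real (s k)" for k
    using cinner_diag_op_coeff[OF D(1,2) B, of "e k" k] D(4,5)[of k]
    unfolding D(7) by (auto simp: ortho_cinner[OF D(1)])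
  then have "(\<Sum>k<n. s k powr q) \<le> C" for n
    using le[OF D(1,2), of n] D(3) by simp
  then have "(\<Sum>k<n. ennreal (s k powr q)) \<le> ennreal C" for n
    by (simp add: sum_ennreal ennreal_leI)
  then show ?thesis
    unfolding svd_power_sum[OF svd] by (intro suminf_le_const) auto
qed

section \<open>Orthogonalisation\<close>

text \<open>\<open>sgn\<close> normalises nonzero residuals and keeps 0, so linearly dependent input
  is allowed and merely produces zero vectors.\<close>

function gram_schmidt :: "(nat \<Rightarrow> 'a::complex_hilbert) \<Rightarrow> nat \<Rightarrow> 'a" where
  "gram_schmidt w n = sgn (w n - (\<Sum>k<n. cinner (w n) (gram_schmidt w k) *\<^sub>C gram_schmidt w k))"
  by auto
termination by (relation "Wellfounded.measure snd") auto
declare gram_schmidt.simps [simp del]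

lemma gram_schmidt_norm: "norm (gram_schmidt w n) = 0 \<or> norm (gram_schmidt w n) = 1"
  by (subst (1 2) gram_schmidt.simps) (simp add: norm_sgn)

lemma gram_schmidt_orth_less: "m < n \<Longrightarrow> cinner (gram_schmidt w n) (gram_schmidt w m) = 0"
proof (induction n arbitrary: m rule: less_induct)
  case (less n)
  let ?g = "gram_schmidt w"
  have orth: "cinner (?g k) (?g m) = (if k = m \<and> ?g m \<noteq> 0 then 1 else 0)" if "k < n" for k
  proof (cases "k = m")
    case True
    then show ?thesis using gram_schmidt_norm[of w m] by (auto simp: cinner_self)
  next
    case False
    then show ?thesis
      using less.IH[of k m] less.IH[of m k] less.prems that cinner_commute[of "?g m" "?g k"]
      by (cases "k < m") auto
  qed
  have "cinner (\<Sum>k<n. cinner (w n) (?g k) *\<^sub>C ?g k) (?g m)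
      = (\<Sum>k<n. if k = m then cinner (w n) (?g m) else 0)"
    unfolding cinner_sum_left
    by (intro sum.cong refl) (auto simp: cinner_scaleC_left orth)
  also have "\<dots> = cinner (w n) (?g m)" using less.prems by simp
  finally have "cinner (w n - (\<Sum>k<n. cinner (w n) (?g k) *\<^sub>C ?g k)) (?g m) = 0"
    by (simp add: cinner_diff_left)
  then show ?case
    by (subst gram_schmidt.simps) (simp add: sgn_div_norm cinner_scaleR_left)
qed

lemma ortho_gram_schmidt: "ortho (gram_schmidt w)"
  unfolding ortho_def
proof (intro conjI allI impI gram_schmidt_norm)
  fix k l :: nat assume "k \<noteq> l"
  then show "cinner (gram_schmidt w k) (gram_schmidt w l) = 0"
    using gram_schmidt_orth_less[of k l w] gram_schmidt_orth_less[of l k w]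
      cinner_commute[of "gram_schmidt w l" "gram_schmidt w k"]
    by (cases "k < l") auto
qed

text \<open>The triangular relation between the two sequences, with \<open>r\<close> the norm of the
  residual. That \<open>r\<close> is nonzero allows inductions to solve for the orthogonalised
  vector.\<close>

lemma gram_schmidt_split:
  obtains r where "w n = r *\<^sub>R gram_schmidt w n + (\<Sum>k<n. cinner (w n) (gram_schmidt w k) *\<^sub>C gram_schmidt w k)"
    and "gram_schmidt w n \<noteq> 0 \<Longrightarrow> r \<noteq> 0"
proof (rule that)
  let ?v = "w n - (\<Sum>k<n. cinner (w n) (gram_schmidt w k) *\<^sub>C gram_schmidt w k)"
  have g: "gram_schmidt w n = sgn ?v" by (rule gram_schmidt.simps)
  have "norm v *\<^sub>R sgn v = v" for v :: "'v::real_normed_vector"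
    by (cases "v = 0") (simp_all add: sgn_div_norm)
  from this[of ?v] have "norm ?v *\<^sub>R gram_schmidt w n = ?v" unfolding g[symmetric] .
  then show "w n = norm ?v *\<^sub>R gram_schmidt w n + (\<Sum>k<n. cinner (w n) (gram_schmidt w k) *\<^sub>C gram_schmidt w k)"
    by simp
  show "norm ?v \<noteq> 0" if "gram_schmidt w n \<noteq> 0"
    using that g by (metis norm_zero norm_eq_zero sgn_zero)
qed

text \<open>The bound \<open>N\<close> is independent of \<open>n\<close>, so that finitely many
  vectors are expanded in one common system.\<close>

lemma gram_schmidt_expand:
  assumes "n < N"
  shows "w n = (\<Sum>k<N. cinner (w n) (gram_schmidt w k) *\<^sub>C gram_schmidt w k)"
proof -
  let ?g = "gram_schmidt w"
  obtain r where r: "w n = r *\<^sub>R ?g n + (\<Sum>k<n. cinner (w n) (?g k) *\<^sub>C ?g k)"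
    using gram_schmidt_split[of w n] by metis
  have c: "cinner (w n) (?g m) *\<^sub>C ?g m = (if m = n then r *\<^sub>R ?g n else 0)" if "n \<le> m" for m
  proof -
    have "cinner (w n) (?g m) = of_real r * cinner (?g n) (?g m)"
      using that by (subst r)
        (auto simp: cinner_add_left cinner_scaleR_left cinner_sum_left cinner_scaleC_left
          ortho_cinner[OF ortho_gram_schmidt] intro!: sum.neutral)
    then show ?thesis
      using that by (auto simp: ortho_cinner[OF ortho_gram_schmidt] scaleC_of_real)
  qed
  have "(\<Sum>k<N. cinner (w n) (?g k) *\<^sub>C ?g k)
      = (\<Sum>k\<in>{..<n}. cinner (w n) (?g k) *\<^sub>C ?g k) + (\<Sum>k\<in>{n..<N}. cinner (w n) (?g k) *\<^sub>C ?g k)"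
    using assms by (subst sum.union_disjoint[symmetric]) (auto intro!: sum.cong)
  also have "(\<Sum>k\<in>{n..<N}. cinner (w n) (?g k) *\<^sub>C ?g k) = (\<Sum>k\<in>{n..<N}. if k = n then r *\<^sub>R ?g n else 0)"
    using c by (intro sum.cong) auto
  also have "\<dots> = r *\<^sub>R ?g n" using assms by simp
  finally show ?thesis using r by (simp add: add.commute)
qed

text \<open>
  Schur triangularisation: eigenvalues of independent eigenvectors occur on the diagonal with
  respect to an orthonormal system. Independence is expressed through the functionals
  \<open>\<lambda>x. cinner (R x) (u n)\<close>.
\<close>

lemma schur_diagonal:
  assumes T: "clinear T" and R: "clinear R"
    and eig: "\<And>n. T (w n) = ev n *\<^sub>C w n"
    and dual: "\<And>n k. k < n \<Longrightarrow> cinner (R (w k)) (u n) = 0"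
    and dual': "\<And>n. cinner (R (w n)) (u n) = 0 \<Longrightarrow> ev n = 0"
  shows "cinner (T (gram_schmidt w n)) (gram_schmidt w n) = ev n"
proof -
  let ?g = "gram_schmidt w"
  \<comment> \<open>The n-th functional annihilates the span of \<open>w k\<close> for
    \<open>k < n\<close>, hence also the orthogonalised vectors in it.\<close>
  have low: "cinner (R (?g k)) (u n) = 0" if "k < n" for k n
    using that
  proof (induction k rule: less_induct)
    case (less k)
    show ?case
    proof (cases "?g k = 0")
      case False
      obtain r where r: "w k = r *\<^sub>R ?g k + (\<Sum>j<k. cinner (w k) (?g j) *\<^sub>C ?g j)" "r \<noteq> 0"
        using gram_schmidt_split[of w k] False by metis
      have "0 = cinner (R (w k)) (u n)" using dual less.prems by simp
      also have "\<dots> = of_real r * cinner (R (?g k)) (u n) + (\<Sum>j<k. cinner (w k) (?g j) * cinner (R (?g j)) (u n))"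
        by (subst r(1)) (simp add: clinear_add[OF R] clinear_scaleR[OF R] clinear_sum[OF R] clinear_scaleC[OF R]
          cinner_add_left cinner_scaleR_left cinner_sum_left cinner_scaleC_left)
      also have "(\<Sum>j<k. cinner (w k) (?g j) * cinner (R (?g j)) (u n)) = 0"
        using less by (intro sum.neutral) auto
      finally show ?thesis using r(2) by simp
    qed (simp add: clinear_zero[OF R])
  qed
  \<comment> \<open>Modulo the span of its predecessors, \<open>?g n\<close> is an eigenvector for
    \<open>ev n\<close>, and \<open>?g m\<close> with \<open>n \<le> m\<close> is orthogonal to that
    span: the matrix of \<open>T\<close> is triangular.\<close>
  have tri: "cinner (T (?g n)) (?g m) = ev n * cinner (?g n) (?g m)" if "n \<le> m" for n m
    using that
  proof (induction n arbitrary: m rule: less_induct)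
    case (less n)
    show ?case
    proof (cases "?g n = 0")
      case False
      obtain r where r: "w n = r *\<^sub>R ?g n + (\<Sum>j<n. cinner (w n) (?g j) *\<^sub>C ?g j)" "r \<noteq> 0"
        using gram_schmidt_split[of w n] False by metis
      have z: "(\<Sum>j<n. cinner (w n) (?g j) * cinner (?g j) (?g m)) = 0"
        using less.prems by (intro sum.neutral) (auto simp: ortho_cinner[OF ortho_gram_schmidt])
      have z': "(\<Sum>j<n. cinner (w n) (?g j) * cinner (T (?g j)) (?g m)) = 0"
        using less by (intro sum.neutral) (auto simp: ortho_cinner[OF ortho_gram_schmidt])
      have "cinner (T (w n)) (?g m) = of_real r * cinner (T (?g n)) (?g m)
          + (\<Sum>j<n. cinner (w n) (?g j) * cinner (T (?g j)) (?g m))"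
        by (subst r(1)) (simp add: clinear_add[OF T] clinear_scaleR[OF T] clinear_sum[OF T] clinear_scaleC[OF T]
          cinner_add_left cinner_scaleR_left cinner_sum_left cinner_scaleC_left)
      moreover have "cinner (w n) (?g m) = of_real r * cinner (?g n) (?g m)
          + (\<Sum>j<n. cinner (w n) (?g j) * cinner (?g j) (?g m))"
        by (subst r(1)) (simp add: cinner_add_left cinner_scaleR_left cinner_sum_left cinner_scaleC_left)
      moreover have "cinner (T (w n)) (?g m) = ev n * cinner (w n) (?g m)"
        by (simp add: eig cinner_scaleC_left)
      ultimately have "of_real r * cinner (T (?g n)) (?g m) = of_real r * (ev n * cinner (?g n) (?g m))"
        unfolding z z' by (simp only: add_0_right mult.left_commute)
      then show ?thesis using r(2) by (simp only: mult_cancel_left of_real_eq_0_iff simp_thms)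
    qed (simp add: clinear_zero[OF T])
  qed
  show ?thesis
  proof (cases "?g n = 0")
    \<comment> \<open>Here \<open>w n\<close> lies in the span of its predecessors, where the n-th
      functional vanishes; so the eigenvalue is 0, in agreement with the zero diagonal
      entry.\<close>
    case True
    obtain r where r: "w n = r *\<^sub>R ?g n + (\<Sum>j<n. cinner (w n) (?g j) *\<^sub>C ?g j)"
      using gram_schmidt_split[of w n] by metis
    have "cinner (R (w n)) (u n) = (\<Sum>j<n. cinner (w n) (?g j) * cinner (R (?g j)) (u n))"
      by (subst r) (simp add: True clinear_sum[OF R] clinear_scaleC[OF R] cinner_sum_left cinner_scaleC_left)
    also have "\<dots> = 0" using low by (intro sum.neutral) auto
    finally show ?thesis using dual'[of n] True by simp
  next
    case False
    then show ?thesis using tri[of n n] by (simp add: ortho_cinner[OF ortho_gram_schmidt])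
  qed
qed

section \<open>Products of square roots\<close>

lemma bessel_on_diag_op:
  assumes "ortho e" "ortho f" "bessel_on F x"
  shows "bessel_on F (\<lambda>a. diag_op (\<lambda>_. 1) e f (x a))"
  unfolding bessel_on_def
proof
  fix z
  have one: "\<forall>k. \<bar>(\<lambda>_. 1 :: real) k\<bar> \<le> 1" by simp
  have "cinner z (diag_op (\<lambda>_. 1) e f (x a)) = cinner (diag_op (\<lambda>_. 1) f e z) (x a)" for a
    using cinner_diag_op_adjoint[OF assms(2,1) one, of z "x a"] by simp
  then have "(\<Sum>a\<in>F. (cmod (cinner z (diag_op (\<lambda>_. 1) e f (x a))))\<^sup>2) \<le> (norm (diag_op (\<lambda>_. 1) f e z))\<^sup>2"
    using bessel_onD[OF assms(3)] by simp
  also have "\<dots> \<le> (norm z)\<^sup>2"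
    using norm_diag_op_le[OF assms(2,1) one, of z] by (intro power_mono) auto
  finally show "(\<Sum>a\<in>F. (cmod (cinner z (diag_op (\<lambda>_. 1) e f (x a))))\<^sup>2) \<le> (norm z)\<^sup>2" .
qed

lemma svd_apply:
  assumes "svd T s e f" shows "T (e k) = s k *\<^sub>R f k" "diag_op s f e (f k) = s k *\<^sub>R e k"
  using diag_op_basis[OF svdD(1)[OF assms], of s f k] diag_op_basis[OF svdD(2)[OF assms], of s e k]
    svdD(4,5,7)[OF assms]
  by (auto simp: scaleC_of_real)

abbreviation sqrt_abs :: "(nat \<Rightarrow> real) \<Rightarrow> (nat \<Rightarrow> 'a) \<Rightarrow> 'a \<Rightarrow> 'a::complex_hilbert"
  where "sqrt_abs s e \<equiv> diag_op (\<lambda>k. sqrt (s k)) e e"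

lemma svd_sqrt:
  assumes "svd T s e f"
  shows "compact_operator (sqrt_abs s e)" "cinner (sqrt_abs s e x) y = cinner x (sqrt_abs s e y)"
    "sqrt_abs s e (sqrt_abs s e x) = diag_op s e e x"
    "compact_operator (diag_op s e e)" "cinner (diag_op s e e x) y = cinner x (diag_op s e e y)"
proof -
  note D = svdD[OF assms]
  obtain C where C: "\<forall>k. \<bar>s k\<bar> \<le> C" using svd_bounded[OF assms] by metis
  have Cs: "\<forall>k. \<bar>sqrt (s k)\<bar> \<le> sqrt C" using C by (auto simp flip: real_sqrt_abs2)
  show "cinner (diag_op s e e x) y = cinner x (diag_op s e e y)"
    by (rule cinner_diag_op_adjoint[OF D(1,1) C])
  show "cinner (sqrt_abs s e x) y = cinner x (sqrt_abs s e y)"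
    by (rule cinner_diag_op_adjoint[OF D(1,1) Cs])
  show "compact_operator (sqrt_abs s e)"
    using tendsto_real_sqrt[OF D(6)] by (intro compact_operator_diag_op D) simp
  show "compact_operator (diag_op s e e)" by (intro compact_operator_diag_op D)
  show "sqrt_abs s e (sqrt_abs s e x) = diag_op s e e x"
    using diag_op_comp[OF D(1,1,1) Cs] D(3) by simp
qed

text \<open>
  The squares of the singular values of \<open>|S|\<^sup>1\<^sup>/\<^sup>2 |T|\<^sup>1\<^sup>/\<^sup>2\<close> are eigenvalues of
  \<open>|S| |T|\<close>, which in turn is \<open>S T\<^sup>*\<close> up to partial isometries on both sides.
\<close>

lemma schatten_sqrt_product:
  assumes S: "svd S sS eS fS" and T: "svd T sT eT fT"
    and X: "svd (\<lambda>x. sqrt_abs sS eS (sqrt_abs sT eT x)) t u v"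
    and q: "q \<ge> 1" and c: "compact_operator (S \<circ> cadjoint T)"
  shows "ennreal (\<Sum>a<n. t a powr (2 * q)) \<le> schatten_power_sum q (S \<circ> cadjoint T)"
proof -
  note DS = svdD[OF S] and DT = svdD[OF T] and DX = svdD[OF X]
  note rS = svd_sqrt[OF S] and rT = svd_sqrt[OF T]
  obtain CS where CS: "\<forall>k. \<bar>sS k\<bar> \<le> CS" using svd_bounded[OF S] by metis
  obtain CX where CX: "\<forall>k. \<bar>t k\<bar> \<le> CX" using svd_bounded[OF X] by metis
  let ?R = "sqrt_abs sS eS" and ?Q = "sqrt_abs sT eT"
  let ?A = "diag_op sS eS eS" and ?B = "diag_op sT eT eT"
  have linR: "clinear ?R" and linQ: "clinear ?Q" and linA: "clinear ?A" and linB: "clinear ?B"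
    using rS rT by (auto intro: compact_operator_clinear)
  have X_adj: "?Q (?R y) = diag_op t v u y" for y
  proof (rule cinner_ext_right)
    fix x
    have "cinner x (?Q (?R y)) = cinner (?R (?Q x)) y" using rS(2) rT(2) by simp
    also have "\<dots> = cinner (diag_op t u v x) y" using fun_cong[OF DX(7), of x] by simp
    also have "\<dots> = cinner x (diag_op t v u y)" by (rule cinner_diag_op_adjoint[OF DX(1,2) CX])
    finally show "cinner x (?Q (?R y)) = cinner x (diag_op t v u y)" .
  qed
  have QAQ: "?Q (?A (?Q (u k))) = ((t k)\<^sup>2) *\<^sub>R u k" for k
  proof -
    have "?Q (?A (?Q (u k))) = ?Q (?R (?R (?Q (u k))))" by (simp add: rS(3))
    also have "?R (?Q (u k)) = t k *\<^sub>R v k" using svd_apply(1)[OF X] .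
    also have "?Q (?R (t k *\<^sub>R v k)) = t k *\<^sub>R diag_op t v u (v k)"
      by (simp add: clinear_scaleR[OF linR] clinear_scaleR[OF linQ] X_adj)
    finally show ?thesis by (simp add: svd_apply(2)[OF X] power2_eq_square)
  qed
  \<comment> \<open>By \<open>QAQ\<close>, these are eigenvectors of \<open>?A \<circ> ?B\<close>
    with eigenvalue \<open>(t k)\<^sup>2\<close>. Applying \<open>?Q\<close> turns them into
    multiples of the orthogonal \<open>u k\<close>, which supplies the functionals for the
    triangularisation.\<close>
  define w where "w k = ?A (?Q (u k))" for k
  define g where "g = gram_schmidt w"
  have lin: "clinear (\<lambda>x. ?A (?B x))"
    using linA linB by (intro clinearI) (auto simp: clinear_add clinear_scaleC)
  have diag: "cinner (?A (?B (g k))) (g k) = complex_of_real ((t k)\<^sup>2)" for k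
    unfolding g_def
  proof (rule schur_diagonal[OF lin linQ, where u = u])
    fix n
    show "?A (?B (w n)) = complex_of_real ((t n)\<^sup>2) *\<^sub>C w n"
      unfolding w_def rT(3)[symmetric] QAQ scaleC_of_real
      by (simp add: clinear_scaleR[OF linA] clinear_scaleR[OF linQ])
    show "cinner (?Q (w k)) (u n) = 0" if "k < n" for k
      using that by (simp add: w_def QAQ cinner_scaleR_left ortho_cinner[OF DX(1)])
    assume "cinner (?Q (w n)) (u n) = 0"
    then show "complex_of_real ((t n)\<^sup>2) = 0"
      using DX(4)[of n] by (auto simp: w_def QAQ cinner_scaleR_left ortho_cinner[OF DX(1)] split: if_splits)
  qed
  have one: "\<forall>k. \<bar>(\<lambda>_. 1 :: real) k\<bar> \<le> 1" by simp
  \<comment> \<open>Polar decomposition on both sides: partial isometries applied to the two test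
    vectors convert \<open>S \<circ> cadjoint T\<close> into \<open>?A \<circ> ?B\<close>.\<close>
  have TA: "cadjoint T (diag_op (\<lambda>_. 1) eT fT x) = ?B x" for x
    unfolding svd_cadjoint[OF T]
    using diag_op_comp[OF DT(1,2,1) one, of sT x] DT(4,5) by simp
  have SA: "diag_op (\<lambda>_. 1) fS eS (S y) = ?A y" for y
    unfolding DS(7)
    using diag_op_comp[OF DS(1,2,1) CS, of "\<lambda>_. 1" y] DS(4,5) by simp
  have "cinner ((S \<circ> cadjoint T) (diag_op (\<lambda>_. 1) eT fT (g a))) (diag_op (\<lambda>_. 1) eS fS (g a))
      = complex_of_real ((t a)\<^sup>2)" for a
    using cinner_diag_op_adjoint[OF DS(2,1) one, of "S (?B (g a))" "g a"]
    by (simp add: TA SA diag)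
  then have "t a powr (2 * q) = cmod (cinner ((S \<circ> cadjoint T) (diag_op (\<lambda>_. 1) eT fT (g a)))
      (diag_op (\<lambda>_. 1) eS fS (g a))) powr q" for a
  proof -
    assume *: "\<And>a. cinner ((S \<circ> cadjoint T) (diag_op (\<lambda>_. 1) eT fT (g a))) (diag_op (\<lambda>_. 1) eS fS (g a))
      = complex_of_real ((t a)\<^sup>2)"
    have "t a powr (2 * q) = ((t a)\<^sup>2) powr q"
      using DX(3)[of a] by (cases "t a = 0") (simp_all add: powr_powr[symmetric])
    then show ?thesis unfolding * by (simp only: norm_of_real abs_power2)
  qed
  then have "ennreal (\<Sum>a<n. t a powr (2 * q)) = ennreal (\<Sum>a<n. cmod (cinner ((S \<circ> cadjoint T)
      (diag_op (\<lambda>_. 1) eT fT (g a))) (diag_op (\<lambda>_. 1) eS fS (g a))) powr q)"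
    by presburger
  also have "\<dots> \<le> schatten_power_sum q (S \<circ> cadjoint T)"
    unfolding g_def
    by (intro schatten_power_sum_ge c q bessel_on_diag_op bessel_ortho ortho_gram_schmidt DS DT) auto
  finally show ?thesis .
qed

section \<open>A Bessel inequality for tensor products\<close>

text \<open>The sum is the squared Hilbert-Schmidt norm of a combination of rank-one operators,
  equivalently a quadratic form of the entrywise product of two Gram matrices. Expanding the
  \<open>y r\<close> in an orthonormal system turns it into a sum of squared norms.\<close>

lemma tensor_gram_nonneg:
  fixes x y :: "nat \<Rightarrow> 'a::complex_hilbert"
  shows "0 \<le> Re (\<Sum>r<N. \<Sum>s<N. d r * cnj (d s) * (cinner (x r) (x s) * cinner (y s) (y r)))"
proof -
  let ?g = "gram_schmidt y"
  define V where "V b = (\<Sum>r<N. (d r * cinner (?g b) (y r)) *\<^sub>C x r)" for b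
  have yy: "cinner (y s) (y r) = (\<Sum>b<N. cinner (y s) (?g b) * cinner (?g b) (y r))" if "s < N" for r s
    by (subst gram_schmidt_expand[OF that, of y]) (simp add: cinner_sum_left cinner_scaleC_left)
  have "(\<Sum>r<N. \<Sum>s<N. d r * cnj (d s) * (cinner (x r) (x s) * cinner (y s) (y r)))
      = (\<Sum>r<N. \<Sum>s<N. \<Sum>b<N. (d r * cinner (?g b) (y r)) * cnj (d s * cinner (?g b) (y s)) * cinner (x r) (x s))"
    by (intro sum.cong refl)
      (simp add: yy sum_distrib_left sum_distrib_right mult_ac cinner_commute[symmetric])
  also have "\<dots> = (\<Sum>r<N. \<Sum>b<N. \<Sum>s<N. (d r * cinner (?g b) (y r)) * cnj (d s * cinner (?g b) (y s)) * cinner (x r) (x s))"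
    by (rule sum.cong[OF refl], rule sum.swap)
  also have "\<dots> = (\<Sum>b<N. \<Sum>r<N. \<Sum>s<N. (d r * cinner (?g b) (y r)) * cnj (d s * cinner (?g b) (y s)) * cinner (x r) (x s))"
    by (rule sum.swap)
  also have "\<dots> = (\<Sum>b<N. complex_of_real ((norm (V b))\<^sup>2))"
    unfolding cinner_self[symmetric] V_def cinner_sum_left cinner_sum_right
    by (rule sum.cong[OF refl], subst sum.swap)
      (simp add: cinner_scaleC_left cinner_scaleC_right sum_distrib_left mult_ac)
  finally show ?thesis by (simp add: sum_nonneg flip: of_real_power)
qed

lemma sum_lessThan_add:
  fixes K n :: nat
  shows "(\<Sum>r<K + n. f r) = (\<Sum>r<K. f r) + (\<Sum>a<n. f (K + a) :: 'b::comm_monoid_add)"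
  by (induction n) (auto simp: add.assoc)

text \<open>Bessel's inequality for the elementary tensors of \<open>u a\<close> and
  \<open>v a\<close>. The given combination, minus its projection, is encoded as one family of
  length \<open>K + n\<close>; each of the two mixed blocks contributes \<open>- M\<close> and the
  last block at most \<open>M\<close>.\<close>

lemma tensor_bessel:
  fixes x y u v :: "nat \<Rightarrow> 'a::complex_hilbert"
  assumes u: "ortho u" and v: "ortho v"
  shows "(\<Sum>a<n. (cmod (\<Sum>k<K. c k * (cinner (x k) (u a) * cinner (v a) (y k))))\<^sup>2)
    \<le> Re (\<Sum>k<K. \<Sum>l<K. c k * cnj (c l) * (cinner (x k) (x l) * cinner (y l) (y k)))"
proof -
  define m where "m a = (\<Sum>k<K. c k * (cinner (x k) (u a) * cinner (v a) (y k)))" for a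
  define M where "M = (\<Sum>a<n. (cmod (m a))\<^sup>2)"
  define d where "d r = (if r < K then c r else - m (r - K))" for r
  define x' where "x' r = (if r < K then x r else u (r - K))" for r
  define y' where "y' r = (if r < K then y r else v (r - K))" for r
  define q where "q r s = d r * cnj (d s) * (cinner (x' r) (x' s) * cinner (y' s) (y' r))" for r s
  have mm: "(\<Sum>a<n. m a * cnj (m a)) = complex_of_real M"
    unfolding M_def of_real_sum complex_norm_square by simp
  have 1: "(\<Sum>r<K. \<Sum>s<K. q r s) = (\<Sum>k<K. \<Sum>l<K. c k * cnj (c l) * (cinner (x k) (x l) * cinner (y l) (y k)))"
    by (simp add: q_def d_def x'_def y'_def)
  have 2: "(\<Sum>r<K. \<Sum>a<n. q r (K + a)) = - complex_of_real M"
  proof -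
    have "(\<Sum>r<K. \<Sum>a<n. q r (K + a)) = (\<Sum>a<n. \<Sum>r<K. q r (K + a))" by (rule sum.swap)
    also have "\<dots> = (\<Sum>a<n. - (m a * cnj (m a)))"
      by (intro sum.cong refl)
        (simp add: q_def d_def x'_def y'_def m_def[of a for a] sum_distrib_right sum_negf mult_ac)
    finally show ?thesis by (simp add: sum_negf mm)
  qed
  have 3: "(\<Sum>a<n. \<Sum>s<K. q (K + a) s) = - complex_of_real M"
  proof -
    have "(\<Sum>a<n. \<Sum>s<K. q (K + a) s) = (\<Sum>a<n. - (m a * cnj (m a)))"
      by (intro sum.cong refl)
        (simp add: q_def d_def x'_def y'_def m_def[of a for a] sum_distrib_left sum_negf mult_ac
          cinner_commute[symmetric])
    then show ?thesis by (simp add: sum_negf mm)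
  qed
  have 4: "Re (\<Sum>a<n. \<Sum>b<n. q (K + a) (K + b)) \<le> M"
  proof -
    have "(\<Sum>b<n. q (K + a) (K + b)) = (if u a \<noteq> 0 \<and> v a \<noteq> 0 then m a * cnj (m a) else 0)" if "a < n" for a
    proof -
      have "(\<Sum>b<n. q (K + a) (K + b)) = (\<Sum>b<n. if b = a then (if u a \<noteq> 0 \<and> v a \<noteq> 0 then m a * cnj (m a) else 0) else 0)"
        by (intro sum.cong refl) (auto simp: q_def d_def x'_def y'_def ortho_cinner[OF u] ortho_cinner[OF v])
      then show ?thesis using that by simp
    qed
    then have "Re (\<Sum>a<n. \<Sum>b<n. q (K + a) (K + b)) = (\<Sum>a<n. Re (if u a \<noteq> 0 \<and> v a \<noteq> 0 then m a * cnj (m a) else 0))"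
      by simp
    also have "\<dots> \<le> M"
      unfolding M_def by (intro sum_mono) (simp add: complex_norm_square[symmetric] del: of_real_power)
    finally show ?thesis .
  qed
  have "0 \<le> Re (\<Sum>r<K + n. \<Sum>s<K + n. q r s)"
    unfolding q_def by (rule tensor_gram_nonneg)
  also have "(\<Sum>r<K + n. \<Sum>s<K + n. q r s) = (\<Sum>r<K. \<Sum>s<K. q r s) + (\<Sum>r<K. \<Sum>a<n. q r (K + a))
      + ((\<Sum>a<n. \<Sum>s<K. q (K + a) s) + (\<Sum>a<n. \<Sum>b<n. q (K + a) (K + b)))"
    by (simp add: sum_lessThan_add sum.distrib)
  finally show ?thesis
    using 4 unfolding 1 2 3 m_def[symmetric] M_def[symmetric] by simp
qed

text \<open>The rank-one operators built from orthonormal block vectors are orthonormal for the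
  Hilbert--Schmidt inner product.\<close>

lemma block_bessel:
  fixes h :: "nat \<Rightarrow> 'j \<Rightarrow> 'a::complex_hilbert" and u v :: "'j \<Rightarrow> 'j \<Rightarrow> nat \<Rightarrow> 'a"
  assumes J: "finite J" and u: "\<And>i j. ortho (u i j)" and v: "\<And>i j. ortho (v i j)"
    and h: "\<And>k l. k \<noteq> l \<Longrightarrow> (\<Sum>j\<in>J. cinner (h k j) (h l j)) = 0"
      "\<And>k. (\<Sum>j\<in>J. (norm (h k j))\<^sup>2) \<le> 1"
  shows "(\<Sum>k<K. (cmod (\<Sum>i\<in>J. \<Sum>j\<in>J. \<Sum>a<n. y i j a * (cinner (h k j) (u i j a) * cinner (v i j a) (h k i))))\<^sup>2)
    \<le> (\<Sum>i\<in>J. \<Sum>j\<in>J. \<Sum>a<n. (cmod (y i j a))\<^sup>2)"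
proof -
  define m where "m i j a k = cinner (h k j) (u i j a) * cinner (v i j a) (h k i)" for i j a k
  define z where "z k = (\<Sum>i\<in>J. \<Sum>j\<in>J. \<Sum>a<n. y i j a * m i j a k)" for k
  define Z where "Z = (\<Sum>k<K. (cmod (z k))\<^sup>2)"
  define B where "B = J \<times> J \<times> {..<n}"
  define Y where "Y = (\<Sum>(i,j,a)\<in>B. (cmod (y i j a))\<^sup>2)"
  define g where "g i j a = (\<Sum>k<K. cnj (z k) * m i j a k)" for i j a
  have triple: "(\<Sum>i\<in>J. \<Sum>j\<in>J. \<Sum>a<n. f i j a) = (\<Sum>(i,j,a)\<in>B. f i j a)" for f :: "'j \<Rightarrow> 'j \<Rightarrow> nat \<Rightarrow> 'c::comm_monoid_add"
    unfolding B_def by (simp add: sum.cartesian_product)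
  \<comment> \<open>After \<open>tensor_bessel\<close> on every block the sums over \<open>i\<close>
    and \<open>j\<close> separate into two block inner products, and orthogonality leaves only the
    terms \<open>k = l\<close>.\<close>
  have G: "(\<Sum>(i,j,a)\<in>B. (cmod (g i j a))\<^sup>2) \<le> Z"
  proof -
    have "(\<Sum>(i,j,a)\<in>B. (cmod (g i j a))\<^sup>2) = (\<Sum>i\<in>J. \<Sum>j\<in>J. \<Sum>a<n. (cmod (g i j a))\<^sup>2)"
      by (rule triple[symmetric])
    also have "\<dots> \<le> (\<Sum>i\<in>J. \<Sum>j\<in>J. Re (\<Sum>k<K. \<Sum>l<K. cnj (z k) * cnj (cnj (z l)) *
        (cinner (h k j) (h l j) * cinner (h l i) (h k i))))"
      unfolding g_def m_def by (intro sum_mono tensor_bessel u v)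
    also have "\<dots> = Re (\<Sum>k<K. \<Sum>l<K. cnj (z k) * z l *
        ((\<Sum>j\<in>J. cinner (h k j) (h l j)) * (\<Sum>i\<in>J. cinner (h l i) (h k i))))"
    proof -
      have "(\<Sum>i\<in>J. \<Sum>j\<in>J. \<Sum>k<K. \<Sum>l<K. f k l * (p k l j * q k l i))
          = (\<Sum>k<K. \<Sum>l<K. f k l * ((\<Sum>j\<in>J. p k l j) * (\<Sum>i\<in>J. q k l i)))"
        for f :: "nat \<Rightarrow> nat \<Rightarrow> complex" and p q
      proof -
        let ?f = "\<lambda>i j k l. f k l * (p k l j * q k l i)"
        have "(\<Sum>i\<in>J. \<Sum>j\<in>J. \<Sum>k<K. \<Sum>l<K. ?f i j k l) = (\<Sum>i\<in>J. \<Sum>k<K. \<Sum>j\<in>J. \<Sum>l<K. ?f i j k l)"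
          by (rule sum.cong[OF refl], rule sum.swap)
        also have "\<dots> = (\<Sum>k<K. \<Sum>i\<in>J. \<Sum>j\<in>J. \<Sum>l<K. ?f i j k l)" by (rule sum.swap)
        also have "\<dots> = (\<Sum>k<K. \<Sum>i\<in>J. \<Sum>l<K. \<Sum>j\<in>J. ?f i j k l)"
          by (rule sum.cong[OF refl], rule sum.cong[OF refl], rule sum.swap)
        also have "\<dots> = (\<Sum>k<K. \<Sum>l<K. \<Sum>i\<in>J. \<Sum>j\<in>J. ?f i j k l)"
          by (rule sum.cong[OF refl], rule sum.swap)
        also have "\<dots> = (\<Sum>k<K. \<Sum>l<K. f k l * ((\<Sum>j\<in>J. p k l j) * (\<Sum>i\<in>J. q k l i)))"
          by (simp add: sum_distrib_left sum_distrib_right)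
        finally show ?thesis .
      qed
      then show ?thesis by (simp flip: Re_sum)
    qed
    also have "\<dots> = Re (\<Sum>k<K. \<Sum>l<K. if l = k then
        complex_of_real ((cmod (z k))\<^sup>2 * (\<Sum>j\<in>J. (norm (h k j))\<^sup>2)\<^sup>2) else 0)"
    proof (intro arg_cong[of _ _ Re] sum.cong refl)
      fix k l
      have "(\<Sum>j\<in>J. cinner (h k j) (h k j)) = complex_of_real (\<Sum>j\<in>J. (norm (h k j))\<^sup>2)"
        by (simp only: cinner_self of_real_sum)
      moreover have "cnj (z k) * z k = complex_of_real ((cmod (z k))\<^sup>2)"
        unfolding complex_norm_square by simp
      ultimately show "cnj (z k) * z l * ((\<Sum>j\<in>J. cinner (h k j) (h l j)) * (\<Sum>i\<in>J. cinner (h l i) (h k i)))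
          = (if l = k then complex_of_real ((cmod (z k))\<^sup>2 * (\<Sum>j\<in>J. (norm (h k j))\<^sup>2)\<^sup>2) else 0)"
        using h(1)[of k l] by (cases "l = k") (simp_all only: of_real_mult power2_eq_square, auto)
    qed
    also have "\<dots> = (\<Sum>k<K. (cmod (z k))\<^sup>2 * (\<Sum>j\<in>J. (norm (h k j))\<^sup>2)\<^sup>2)"
      by (simp flip: of_real_power of_real_mult of_real_sum)
    also have "\<dots> \<le> (\<Sum>k<K. (cmod (z k))\<^sup>2 * 1)"
      using h(2) by (intro sum_mono mult_left_mono power_le_one sum_nonneg) auto
    finally show ?thesis by (simp add: Z_def)
  qed
  have zB: "z k = (\<Sum>(i,j,a)\<in>B. y i j a * m i j a k)" for k
    unfolding z_def by (rule triple)
  \<comment> \<open>Duality: \<open>Z\<close> is the pairing of \<open>y\<close> with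
    \<open>g\<close>, and \<open>G\<close> bounds the square sum of \<open>g\<close> by
    \<open>Z\<close> again, so Cauchy-Schwarz yields \<open>Z \<le> sqrt Y * sqrt Z\<close>.\<close>
  have "complex_of_real Z = (\<Sum>k<K. cnj (z k) * z k)"
    unfolding Z_def of_real_sum complex_norm_square by (simp add: mult.commute)
  also have "\<dots> = (\<Sum>k<K. \<Sum>(i,j,a)\<in>B. y i j a * (cnj (z k) * m i j a k))"
    by (rule sum.cong[OF refl], subst (2) zB) (simp add: sum_distrib_left case_prod_unfold mult_ac)
  also have "\<dots> = (\<Sum>(i,j,a)\<in>B. y i j a * g i j a)"
    unfolding g_def case_prod_unfold sum_distrib_left by (rule sum.swap)
  finally have "complex_of_real Z = (\<Sum>(i,j,a)\<in>B. y i j a * g i j a)" .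
  moreover have "Z \<ge> 0" by (simp add: Z_def sum_nonneg)
  then have "Z = cmod (complex_of_real Z)" by simp
  ultimately have "Z = cmod (\<Sum>(i,j,a)\<in>B. y i j a * g i j a)"
    by (simp only:)
  also have "\<dots> \<le> (\<Sum>b\<in>B. cmod (case b of (i,j,a) \<Rightarrow> y i j a) * cmod (case b of (i,j,a) \<Rightarrow> g i j a))"
    by (rule order_trans[OF norm_sum]) (simp add: case_prod_unfold norm_mult)
  also have "\<dots> \<le> sqrt Y * sqrt Z"
    using G by (intro sum_mult_le_sq) (auto simp: Y_def case_prod_unfold Z_def sum_nonneg)
  finally have "Z \<le> sqrt Y * sqrt Z" .
  moreover have "Z \<ge> 0" "Y \<ge> 0" by (auto simp: Z_def Y_def case_prod_unfold sum_nonneg)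
  ultimately have ZY: "sqrt Z * sqrt Z \<le> sqrt Y * sqrt Z" by simp
  have "Z \<le> Y"
  proof (cases "Z = 0")
    case False
    then have "sqrt Z > 0" using \<open>Z \<ge> 0\<close> by simp
    with ZY have "sqrt Z \<le> sqrt Y" by (rule mult_right_le_imp_le)
    then show ?thesis by simp
  qed (simp add: \<open>Y \<ge> 0\<close>)
  then show ?thesis
    unfolding Y_def triple[symmetric] Z_def z_def m_def .
qed

section \<open>The three lines theorem\<close>

text \<open>One exponential factor normalises both edge bounds to 1. The other, with parameter
  \<open>\<epsilon>\<close>, has modulus at most 1 on the strip and decays as the imaginary part
  grows, so the maximum modulus principle on a tall rectangle applies; then
  \<open>\<epsilon>\<close> tends to 0.\<close>

lemma three_lines:
  fixes f :: "complex \<Rightarrow> complex"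
  assumes hol: "f holomorphic_on UNIV" and b: "b > 0" and A: "A > 0" and B: "B > 0"
    and bdd: "\<And>z. 0 \<le> Re z \<Longrightarrow> Re z \<le> b \<Longrightarrow> cmod (f z) \<le> M"
    and left: "\<And>z. Re z = 0 \<Longrightarrow> cmod (f z) \<le> A"
    and right: "\<And>z. Re z = b \<Longrightarrow> cmod (f z) \<le> B"
    and x: "0 \<le> x" "x \<le> b"
  shows "cmod (f (of_real x)) \<le> A powr (1 - x / b) * B powr (x / b)"
proof -
  define L where "L t = - ln A * (1 - t / b) - ln B * (t / b)" for t
  define F where "F \<epsilon> z = f z * exp (of_real (- ln A) * (1 - z / of_real b) - of_real (ln B) * (z / of_real b)
    + of_real \<epsilon> * (z\<^sup>2 - of_real (b\<^sup>2)))" for \<epsilon> :: real and z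
  have normF: "cmod (F \<epsilon> z) = cmod (f z) * exp (L (Re z) + \<epsilon> * ((Re z)\<^sup>2 - (Im z)\<^sup>2 - b\<^sup>2))" for \<epsilon> z
    by (simp add: F_def norm_mult L_def Re_divide_of_real power2_eq_square)
  have L0: "exp (L 0) = 1 / A" using A by (simp add: L_def exp_minus inverse_eq_divide)
  have Lb: "exp (L b) = 1 / B" using b B by (simp add: L_def exp_minus inverse_eq_divide)
  define C where "C = max (exp \<bar>ln A\<bar> * exp \<bar>ln B\<bar>) 1 * max M 0"
  have key: "cmod (F \<epsilon> (of_real x)) \<le> 1" if \<epsilon>: "\<epsilon> > 0" for \<epsilon>
  proof -
    \<comment> \<open>\<open>C\<close> bounds \<open>f\<close> together with the normalising factor
      on the strip. This height gives \<open>C \<le> \<epsilon> * R\<^sup>2 < exp (\<epsilon> *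
      R\<^sup>2)\<close>, so the horizontal sides are below 1.\<close>
    define R where "R = sqrt (C / \<epsilon>) + 1"
    have C0: "C \<ge> 0" by (simp add: C_def)
    then have R0: "R > 0" using \<epsilon> by (simp add: R_def add_nonneg_pos)
    have "C / \<epsilon> = (sqrt (C / \<epsilon>))\<^sup>2" using C0 \<epsilon> by simp
    also have "\<dots> \<le> R\<^sup>2" unfolding R_def using C0 \<epsilon> by (intro power_mono) auto
    finally have "C \<le> \<epsilon> * R\<^sup>2" using \<epsilon> by (simp add: field_simps)
    then have "C < exp (\<epsilon> * R\<^sup>2)" using exp_ge_add_one_self[of "\<epsilon> * R\<^sup>2"] by linarith
    then have R: "C * exp (- (\<epsilon> * R\<^sup>2)) < 1" "R > 0"
      using R0 by (auto simp: exp_minus field_simps)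
    define S where "S = cbox (Complex 0 (- R)) (Complex b R)"
    show ?thesis
    proof (rule maximum_modulus_frontier[of "F \<epsilon>" S])
      have holF: "F \<epsilon> holomorphic_on UNIV"
        unfolding F_def using b by (intro holomorphic_intros hol) auto
      then show "F \<epsilon> holomorphic_on interior S" by (rule holomorphic_on_subset) simp
      show "continuous_on (closure S) (F \<epsilon>)"
        by (rule holomorphic_on_imp_continuous_on[OF holomorphic_on_subset[OF holF]]) simp
      show "bounded S" by (simp add: S_def bounded_cbox)
      show "of_real x \<in> S" using x R by (simp add: S_def in_cbox_complex_iff)
      fix z assume "z \<in> frontier S"
      then have z: "0 \<le> Re z" "Re z \<le> b" "\<bar>Im z\<bar> \<le> R" "Re z = 0 \<or> Re z = b \<or> \<bar>Im z\<bar> = R"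
        by (auto simp: S_def frontier_cbox in_cbox_complex_iff in_box_complex_iff)
      have sq: "(Re z)\<^sup>2 \<le> b\<^sup>2" using z by (intro power_mono) auto
      have e1: "exp (L (Re z) + \<epsilon> * ((Re z)\<^sup>2 - (Im z)\<^sup>2 - b\<^sup>2)) \<le> exp (L (Re z) - \<epsilon> * (Im z)\<^sup>2)"
        using \<epsilon> sq by (simp add: algebra_simps)
      consider "Re z = 0" | "Re z = b" | "\<bar>Im z\<bar> = R" using z(4) by blast
      then show "cmod (F \<epsilon> z) \<le> 1"
      proof cases
        case 1
        have "cmod (F \<epsilon> z) \<le> A * exp (L (Re z) - \<epsilon> * (Im z)\<^sup>2)"
          unfolding normF using left[OF 1] e1 A by (intro mult_mono) auto
        also have "\<dots> \<le> A * exp (L 0)" using A \<epsilon> 1 by simp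
        finally show ?thesis using A by (simp add: L0)
      next
        case 2
        have "cmod (F \<epsilon> z) \<le> B * exp (L (Re z) - \<epsilon> * (Im z)\<^sup>2)"
          unfolding normF using right[OF 2] e1 B by (intro mult_mono) auto
        also have "\<dots> \<le> B * exp (L b)" using B \<epsilon> 2 by simp
        finally show ?thesis using B by (simp add: Lb)
      next
        case 3
        have "L (Re z) \<le> \<bar>ln A\<bar> * 1 + \<bar>ln B\<bar> * 1"
        proof -
          have "- ln A * (1 - Re z / b) \<le> \<bar>ln A\<bar> * 1"
            using z b by (intro mult_mono) auto
          moreover have "- ln B * (Re z / b) \<le> \<bar>ln B\<bar> * 1"
            using z b by (intro mult_mono) auto
          ultimately show ?thesis by (simp add: L_def)
        qed
        then have "exp (L (Re z)) \<le> exp \<bar>ln A\<bar> * exp \<bar>ln B\<bar>"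
          by (simp flip: exp_add)
        then have "cmod (f z) * exp (L (Re z)) \<le> max M 0 * max (exp \<bar>ln A\<bar> * exp \<bar>ln B\<bar>) 1"
          using bdd[OF z(1,2)] by (intro mult_mono) auto
        then have "cmod (f z) * exp (L (Re z)) * exp (- (\<epsilon> * R\<^sup>2)) \<le> C * exp (- (\<epsilon> * R\<^sup>2))"
          unfolding C_def by (intro mult_right_mono) (auto simp: mult.commute)
        moreover have "cmod (F \<epsilon> z) \<le> cmod (f z) * exp (L (Re z)) * exp (- (\<epsilon> * R\<^sup>2))"
        proof -
          have "(Im z)\<^sup>2 = R\<^sup>2" using 3 by (metis power2_abs)
          then show ?thesis
            unfolding normF mult.assoc
            using e1 by (intro mult_left_mono) (auto simp: exp_diff exp_minus divide_inverse)
        qed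
        ultimately show ?thesis using R by linarith
      qed
    qed
  qed
  have "((\<lambda>\<epsilon>. cmod (F \<epsilon> (of_real x))) \<longlongrightarrow> cmod (F 0 (of_real x))) (at_right 0)"
    unfolding normF by (intro tendsto_intros)
  then have "cmod (F 0 (of_real x)) \<le> 1"
    by (rule tendsto_upperbound) (auto intro!: key eventually_at_rightI[of 0 1])
  then have "cmod (f (of_real x)) \<le> exp (- L x)"
    by (simp add: normF exp_minus field_simps)
  also have "\<dots> = A powr (1 - x / b) * B powr (x / b)"
    using A B by (simp add: powr_def L_def exp_add[symmetric] algebra_simps)
  finally show ?thesis .
qed

section \<open>Almost orthogonal families of positive operators\<close>

text \<open>By symmetry \<open>A\<close> maps \<open>e k\<close> and \<open>f k\<close> to
  \<open>s k\<close> times each other, so their difference belongs to the eigenvalue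
  \<open>- s k\<close>; positivity makes it vanish when \<open>s k > 0\<close>.\<close>

lemma svd_positive:
  assumes svd: "svd A s e f"
    and sym: "\<And>x y. cinner (A x) y = cinner x (A y)" and pos: "\<And>x. 0 \<le> Re (cinner (A x) x)"
  shows "A (e k) = s k *\<^sub>R e k"
proof (cases "s k = 0")
  case True
  then show ?thesis using svd_apply(1)[OF svd, of k] by simp
next
  case False
  note D = svdD[OF svd]
  obtain C where C: "\<forall>k. \<bar>s k\<bar> \<le> C" using svd_bounded[OF svd] by metis
  have lin: "clinear A" by (rule compact_operator_clinear[OF svd_compact[OF svd]])
  have "A y = diag_op s f e y" for y
    by (rule cinner_ext_right) (metis sym cinner_diag_op_adjoint[OF D(1,2) C] D(7))
  then have "A (f k) = s k *\<^sub>R e k" using svd_apply(2)[OF svd] by simp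
  then have "A (e k - f k) = - (s k *\<^sub>R (e k - f k))"
    using svd_apply(1)[OF svd, of k] by (simp add: clinear_diff[OF lin] scaleR_diff_right)
  then have "Re (cinner (A (e k - f k)) (e k - f k)) = - (s k * (norm (e k - f k))\<^sup>2)"
    by (simp add: cinner_minus_left cinner_scaleR_left cinner_self flip: of_real_power of_real_mult)
  then have "s k * (norm (e k - f k))\<^sup>2 \<le> 0" using pos[of "e k - f k"] by simp
  moreover have "s k > 0" using False D(3)[of k] by simp
  ultimately have "e k = f k" by (simp add: mult_le_0_iff)
  then show ?thesis using svd_apply(1)[OF svd, of k] by simp
qed

section \<open>Complex powers of real bases\<close>

lemma cmod_of_real_powr: "0 \<le> x \<Longrightarrow> cmod (of_real x powr z) = x powr Re z"
  by (simp add: norm_powr_real_powr)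

lemma holomorphic_of_real_powr:
  "g holomorphic_on UNIV \<Longrightarrow> (\<lambda>z. of_real x powr g z) holomorphic_on UNIV"
  unfolding powr_def by (cases "x = 0") (auto intro!: holomorphic_intros)

lemma powr_le_strip:
  fixes x r c :: real assumes "0 \<le> x" "0 \<le> r" "r \<le> c" shows "x powr r \<le> (1 + x) powr c"
proof -
  have "x powr r \<le> (1 + x) powr r" using assms by (intro powr_mono2) auto
  also have "\<dots> \<le> (1 + x) powr c" using assms by (intro powr_mono) auto
  finally show ?thesis .
qed

text \<open>
  Interpolation between the operator norm and the Hilbert--Schmidt norm of the block operator
  with entries \<open>|T\<^sub>i|\<^sup>1\<^sup>/\<^sup>2 |T\<^sub>j|\<^sup>1\<^sup>/\<^sup>2\<close>, which has the same nonzero spectrum as \<open>\<Sum>|T\<^sub>j|\<close>.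
  The analytic family raises the singular values of each block to the power \<open>p z\<close>.
\<close>

lemma positive_family_bound:
  fixes s :: "'j \<Rightarrow> nat \<Rightarrow> real" and e f :: "'j \<Rightarrow> nat \<Rightarrow> 'a::complex_hilbert"
  assumes J: "finite J" and p: "p \<ge> 2" and b: "b > 0" and \<theta>: "\<theta> > 0"
    and svd: "\<And>j. svd (T j) (s j) (e j) (f j)"
    and \<beta>: "\<And>i j. \<beta> i j \<ge> 0" and \<tau>: "\<And>j. \<tau> j \<ge> 0" "sum \<tau> J \<le> \<theta>"
    and form: "\<And>x. (\<And>j. 0 \<le> x j) \<Longrightarrow> (\<Sum>i\<in>J. \<Sum>j\<in>J. \<beta> i j * (x i * x j)) \<le> b * (\<Sum>j\<in>J. (x j)\<^sup>2)"
    and block: "\<And>i j t u v n. svd (\<lambda>x. sqrt_abs (s i) (e i) (sqrt_abs (s j) (e j) x)) t u v \<Longrightarrow>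
      (\<Sum>a<n. t a powr p) \<le> \<beta> i j powr (p - 1) * sqrt (\<tau> i * \<tau> j)"
  shows "schatten_power_sum p (\<lambda>x. \<Sum>j\<in>J. diag_op (s j) (e j) (e j) x) \<le> ennreal (b powr (p - 1) * \<theta>)"
proof -
  define R where "R j = sqrt_abs (s j) (e j)" for j
  define A where "A x = (\<Sum>j\<in>J. diag_op (s j) (e j) (e j) x)" for x
  note rt = svd_sqrt[OF svd]
  have RR: "R j (R j x) = diag_op (s j) (e j) (e j) x" for j x by (simp add: R_def rt(3))
  have Rsym: "cinner (R j x) y = cinner x (R j y)" for j x y by (simp add: R_def rt(2))
  have cR: "compact_operator (R j)" for j unfolding R_def by (rule rt(1))
  then have Rlin: "clinear (R j)" for j by (rule compact_operator_clinear)
  have A_RR: "A x = (\<Sum>j\<in>J. R j (R j x))" for x by (simp add: A_def RR)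
  have A_form: "cinner (A x) y = (\<Sum>j\<in>J. cinner (R j x) (R j y))" for x y
    by (simp add: A_RR cinner_sum_left Rsym)
  have cA: "compact_operator A" unfolding A_def by (intro compact_operator_sum J rt)
  then have linA: "clinear A" by (rule compact_operator_clinear)
  obtain \<sigma> g g' where svdA: "svd A \<sigma> g g'" using svd_exists[OF cA] by blast
  note DA = svdD[OF svdA]
  have Ag: "A (g k) = \<sigma> k *\<^sub>R g k" for k
  proof (rule svd_positive[OF svdA])
    show "cinner (A x) y = cinner x (A y)" for x y
      by (simp add: A_RR cinner_sum_left cinner_sum_right Rsym)
    show "0 \<le> Re (cinner (A x) x)" for x
      unfolding A_form cinner_self by (simp add: sum_nonneg)
  qed
  \<comment> \<open>Normalised eigenvectors of the block operator: the images of the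
    \<open>g k\<close> under the column of the \<open>R j\<close>. For \<open>\<sigma> k = 0\<close>
    the division convention gives the zero vector.\<close>
  define h where "h k j = (1 / sqrt (\<sigma> k)) *\<^sub>R R j (g k)" for k j
  have hh: "(\<Sum>j\<in>J. cinner (h k j) (h l j)) = (if k = l \<and> \<sigma> k \<noteq> 0 then 1 else 0)" for k l
  proof -
    have "(\<Sum>j\<in>J. cinner (h k j) (h l j)) = of_real (1 / sqrt (\<sigma> k)) * of_real (1 / sqrt (\<sigma> l)) * cinner (A (g k)) (g l)"
      unfolding A_form sum_distrib_left
      by (intro sum.cong refl) (simp add: h_def cinner_scaleR_left cinner_scaleR_right)
    also have "\<dots> = of_real (1 / sqrt (\<sigma> k) * (1 / sqrt (\<sigma> l)) * \<sigma> k) * cinner (g k) (g l)"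
      by (simp add: Ag cinner_scaleR_left)
    also have "\<dots> = (if k = l \<and> \<sigma> k \<noteq> 0 then 1 else 0)"
      using DA(3)[of k] DA(4)[of k] by (auto simp: ortho_cinner[OF DA(1)] simp flip: of_real_mult)
    finally show ?thesis .
  qed
  have h_norm: "(\<Sum>j\<in>J. (norm (h k j))\<^sup>2) \<le> 1" for k
  proof -
    have "complex_of_real (\<Sum>j\<in>J. (norm (h k j))\<^sup>2) = (\<Sum>j\<in>J. cinner (h k j) (h k j))"
      by (simp only: cinner_self of_real_sum)
    also have "\<dots> = of_real (if \<sigma> k \<noteq> 0 then 1 else 0)" unfolding hh by simp
    finally show ?thesis unfolding of_real_eq_iff by simp
  qed
  have "\<exists>t u v. svd (\<lambda>x. R i (R j x)) t u v" for i j
    by (rule svd_exists, rule compact_operator_comp_left[OF cR Rlin compact_operator_bounded_linear[OF cR]])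
  then obtain t u v where tuv: "\<And>i j. svd (\<lambda>x. R i (R j x)) (t i j) (u i j) (v i j)"
    by metis
  note DX = svdD[OF tuv]
  define m where "m i j = \<beta> i j powr ((p - 1) / p) * (\<tau> i * \<tau> j) powr (1 / (2 * p))" for i j
  \<comment> \<open>Singular values of a block divided by its Schatten bound, so that their p-th
    powers sum to at most 1. If the bound is 0 the block vanishes, and the value 0 of the quotient
    is consistent.\<close>
  define th where "th i j a = t i j a / m i j" for i j a
  have m_nonneg: "m i j \<ge> 0" for i j by (simp add: m_def)
  have mp: "m i j powr p = \<beta> i j powr (p - 1) * sqrt (\<tau> i * \<tau> j)" for i j
    using p \<beta> \<tau> by (simp add: m_def powr_mult powr_powr powr_half_sqrt[symmetric])
  have t_sum: "(\<Sum>a<n. t i j a powr p) \<le> m i j powr p" for i j n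
    unfolding mp by (rule block) (use tuv in \<open>simp add: R_def\<close>)
  have th_nonneg: "th i j a \<ge> 0" for i j a using DX(3) m_nonneg by (simp add: th_def)
  have m_th: "m i j * th i j a = t i j a" for i j a
  proof (cases "m i j = 0")
    case True
    have "t i j a powr p \<le> (\<Sum>a<Suc a. t i j a powr p)" by (rule member_le_sum) auto
    also have "\<dots> \<le> 0" using t_sum[of i j "Suc a"] True by simp
    finally show ?thesis by (simp add: True)
  qed (simp add: th_def)
  have th_sum: "(\<Sum>a<n. th i j a powr p) \<le> 1" for i j n
  proof (cases "m i j = 0")
    case False
    then have "(\<Sum>a<n. th i j a powr p) = (\<Sum>a<n. t i j a powr p) / m i j powr p"
      using DX(3) m_nonneg by (simp add: th_def powr_divide sum_divide_distrib)
    also have "\<dots> \<le> 1" using t_sum[of i j n] False m_nonneg[of i j] by (simp add: divide_le_eq)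
    finally show ?thesis .
  qed (simp add: th_def)
  define c where "c k i j a = cinner (h k j) (u i j a) * cinner (v i j a) (h k i)" for k i j a
  \<comment> \<open>The quadratic form of the block operator at its own eigenvector, with every
    block written in its singular value decomposition.\<close>
  have expand: "(\<lambda>n. \<Sum>i\<in>J. \<Sum>j\<in>J. \<Sum>a<n. of_real (t i j a) * c k i j a) \<longlonglongrightarrow> of_real (\<sigma> k)" for k
  proof -
    have 1: "(\<lambda>n. \<Sum>a<n. of_real (t i j a) * c k i j a) \<longlonglongrightarrow> cinner (R i (R j (h k j))) (h k i)" for i j
    proof -
      obtain C where C: "\<forall>k. \<bar>t i j k\<bar> \<le> C" using svd_bounded[OF tuv] by metis
      have "R i (R j (h k j)) = diag_op (t i j) (u i j) (v i j) (h k j)"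
        using fun_cong[OF DX(7)[of i j], of "h k j"] .
      then show ?thesis
        using cinner_diag_op_sums[OF DX(1,2)[of i j] C, of "h k j" "h k i"]
        by (simp add: sums_def c_def mult.assoc)
    qed
    have 2: "(\<Sum>i\<in>J. \<Sum>j\<in>J. cinner (R i (R j (h k j))) (h k i)) = of_real (\<sigma> k)"
    proof -
      have "(\<Sum>j\<in>J. R j (h k j)) = (1 / sqrt (\<sigma> k)) *\<^sub>R A (g k)"
        by (simp add: h_def A_RR clinear_scaleR[OF Rlin] scaleR_sum_right)
      also have "\<dots> = (\<sigma> k / sqrt (\<sigma> k)) *\<^sub>R g k" by (simp add: Ag)
      finally have Rh: "(\<Sum>j\<in>J. R j (h k j)) = (\<sigma> k / sqrt (\<sigma> k)) *\<^sub>R g k" .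
      have "(\<Sum>j\<in>J. R i (R j (h k j))) = \<sigma> k *\<^sub>R h k i" for i
        unfolding clinear_sum[OF Rlin, symmetric] Rh
        by (simp add: clinear_scaleR[OF Rlin] h_def)
      then have "(\<Sum>i\<in>J. \<Sum>j\<in>J. cinner (R i (R j (h k j))) (h k i)) = of_real (\<sigma> k) * (\<Sum>i\<in>J. cinner (h k i) (h k i))"
        by (simp add: cinner_sum_left[symmetric] cinner_scaleR_left sum_distrib_left)
      then show ?thesis by (simp add: hh)
    qed
    show ?thesis
      unfolding 2[symmetric] by (intro tendsto_sum 1)
  qed
  have main: "(\<Sum>k<K. \<sigma> k powr p) \<le> b powr (p - 1) * \<theta>" for K
  proof (cases "(\<Sum>k<K. \<sigma> k powr p) = 0")
    case True
    then show ?thesis using \<theta> by simp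
  next
    case False
    define S where "S = (\<Sum>k<K. \<sigma> k powr p)"
    have S: "S > 0" using False by (simp add: S_def less_le sum_nonneg)
    \<comment> \<open>At \<open>z = 1 / p\<close> this is \<open>t i j a\<close>. Its modulus is at
      most \<open>\<beta> i j\<close> where \<open>Re z = 0\<close>, and where
      \<open>Re z = 1 / 2\<close> its square is
      \<open>\<beta> i j * (sqrt (\<tau> i) * sqrt (\<tau> j))\<close> times the summable factor
      \<open>th i j a powr p\<close>.\<close>
    define y where "y i j a z = of_real (\<beta> i j) powr (1 - z) * of_real (\<tau> i * \<tau> j) powr (z / 2)
        * of_real (th i j a) powr (of_real p * z)" for i j a and z :: complex
    \<comment> \<open>The weight becomes \<open>\<sigma> k powr (p - 1)\<close> at
      \<open>1 / p\<close>, so the limit value in \<open>n\<close> is the sum \<open>S\<close> to be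
      bounded. On the edges its modulus is \<open>\<sigma> k powr p\<close> and
      \<open>\<sigma> k powr (p / 2)\<close>, which contribute \<open>S\<close> and, by
      Cauchy-Schwarz, \<open>sqrt S\<close>. Truncation at \<open>n\<close> makes the function
      entire.\<close>
    define F where "F n z = (\<Sum>k<K. of_real (\<sigma> k) powr (of_real p * (1 - z)) * (\<Sum>i\<in>J. \<Sum>j\<in>J. \<Sum>a<n. y i j a z * c k i j a))"
      for n and z :: complex
    have norm_y: "cmod (y i j a z) = \<beta> i j powr (1 - Re z) * (\<tau> i * \<tau> j) powr (Re z / 2) * th i j a powr (p * Re z)" for i j a z
      unfolding y_def norm_mult using \<beta> \<tau> th_nonneg
      by (simp only: cmod_of_real_powr mult_nonneg_nonneg) simp
    have norm_\<sigma>: "cmod (of_real (\<sigma> k) powr (of_real p * (1 - z))) = \<sigma> k powr (p * (1 - Re z))" for k z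
      using DA(3) by (simp only: cmod_of_real_powr) simp
    have c_sum: "(\<Sum>a<n. cmod (c k i j a)) \<le> norm (h k j) * norm (h k i)" for n k i j
      unfolding c_def norm_mult
      by (intro sum_mult_le_sq bessel_onD bessel_onD' bessel_ortho DX) auto
    have left: "cmod (F n z) \<le> S * b" if "Re z = 0" for n z
    proof -
      have "cmod (F n z) \<le> (\<Sum>k<K. \<sigma> k powr p * b)"
        unfolding F_def
      proof (rule order_trans[OF norm_sum], rule sum_mono, unfold norm_mult norm_\<sigma>)
        fix k
        have "cmod (\<Sum>i\<in>J. \<Sum>j\<in>J. \<Sum>a<n. y i j a z * c k i j a) \<le> (\<Sum>i\<in>J. \<Sum>j\<in>J. \<beta> i j * (norm (h k i) * norm (h k j)))"
        proof (rule order_trans[OF norm_sum], rule sum_mono, rule order_trans[OF norm_sum], rule sum_mono)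
          fix i j
          have "cmod (\<Sum>a<n. y i j a z * c k i j a) \<le> (\<Sum>a<n. \<beta> i j * cmod (c k i j a))"
          proof (intro order_trans[OF norm_sum] sum_mono)
            fix a
            \<comment> \<open>Powers with exponent 0 are at most 1; base 0 gives the value 0
              here.\<close>
            have "cmod (y i j a z) \<le> \<beta> i j * 1 * 1"
              unfolding norm_y that using \<beta>[of i j]
              by (intro mult_mono) auto
            then show "cmod (y i j a z * c k i j a) \<le> \<beta> i j * cmod (c k i j a)"
              by (simp add: norm_mult mult_right_mono)
          qed
          also have "\<dots> \<le> \<beta> i j * (norm (h k i) * norm (h k j))"
            unfolding sum_distrib_left[symmetric] using c_sum[of k i j n] \<beta>[of i j]
            by (intro mult_left_mono) (auto simp: mult.commute)
          finally show "cmod (\<Sum>a<n. y i j a z * c k i j a) \<le> \<beta> i j * (norm (h k i) * norm (h k j))" .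
        qed
        also have "\<dots> \<le> b * (\<Sum>j\<in>J. (norm (h k j))\<^sup>2)" by (rule form) simp
        also have "\<dots> \<le> b" using h_norm[of k] b by (simp add: mult_left_le)
        finally show "\<sigma> k powr (p * (1 - Re z)) * cmod (\<Sum>i\<in>J. \<Sum>j\<in>J. \<Sum>a<n. y i j a z * c k i j a) \<le> \<sigma> k powr p * b"
          unfolding that by (intro mult_mono) auto
      qed
      then show ?thesis by (simp add: S_def sum_distrib_right)
    qed
    \<comment> \<open>Cauchy-Schwarz over \<open>k\<close>, then \<open>block_bessel\<close>
      replaces the values \<open>w k\<close> by the Hilbert-Schmidt norms of the blocks, to which
      \<open>form\<close> applies at the vector of the \<open>sqrt (\<tau> j)\<close>.\<close>
    have right: "cmod (F n z) \<le> sqrt S * sqrt (b * \<theta>)" if z: "Re z = 1 / 2" for n z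
    proof -
      define w where "w k = (\<Sum>i\<in>J. \<Sum>j\<in>J. \<Sum>a<n. y i j a z * c k i j a)" for k
      have y2: "(cmod (y i j a z))\<^sup>2 = \<beta> i j * (sqrt (\<tau> i) * sqrt (\<tau> j)) * th i j a powr p" for i j a
      proof -
        have sq: "(x powr r)\<^sup>2 = x powr (2 * r)" for x r :: real
          by (simp add: power2_eq_square flip: powr_add)
        show ?thesis
          unfolding norm_y z power_mult_distrib sq
          using \<beta>[of i j] \<tau>(1) by (simp add: powr_half_sqrt real_sqrt_mult)
      qed
      have "(\<Sum>k<K. (cmod (w k))\<^sup>2) \<le> (\<Sum>i\<in>J. \<Sum>j\<in>J. \<Sum>a<n. (cmod (y i j a z))\<^sup>2)"
        unfolding w_def c_def by (rule block_bessel[OF J DX(1,2)]) (use h_norm in \<open>auto simp: hh\<close>)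
      also have "\<dots> \<le> (\<Sum>i\<in>J. \<Sum>j\<in>J. \<beta> i j * (sqrt (\<tau> i) * sqrt (\<tau> j)))"
        unfolding y2 sum_distrib_left[symmetric]
        using \<beta> \<tau> by (intro sum_mono mult_left_le th_sum) auto
      also have "\<dots> \<le> b * (\<Sum>j\<in>J. (sqrt (\<tau> j))\<^sup>2)" by (rule form) (simp add: \<tau>)
      also have "\<dots> \<le> b * \<theta>" using \<tau> b by simp
      finally have w: "(\<Sum>k<K. (cmod (w k))\<^sup>2) \<le> b * \<theta>" .
      have "cmod (F n z) \<le> (\<Sum>k<K. \<sigma> k powr (p / 2) * cmod (w k))"
        unfolding F_def w_def[symmetric]
        by (rule order_trans[OF norm_sum]) (simp add: norm_mult norm_\<sigma> z)
      also have "\<dots> \<le> sqrt S * sqrt (b * \<theta>)"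
        using w S b \<theta>
        by (intro sum_mult_le_sq) (auto simp: S_def power2_eq_square simp flip: powr_add)
      finally show ?thesis .
    qed
    \<comment> \<open>A crude bound depending on \<open>n\<close>: the three lines theorem asks only
      that some bound exists, and it does not enter the conclusion.\<close>
    define M where "M n = (\<Sum>k<K. (1 + \<sigma> k) powr p * (\<Sum>i\<in>J. \<Sum>j\<in>J. \<Sum>a<n.
        ((1 + \<beta> i j) powr 1 * (1 + \<tau> i * \<tau> j) powr 1 * (1 + th i j a) powr p) * cmod (c k i j a)))" for n
    have bdd: "cmod (F n z) \<le> M n" if "0 \<le> Re z" "Re z \<le> 1 / 2" for n z
    proof -
      have pz: "p * Re z \<le> p" "p * (1 - Re z) \<le> p" "0 \<le> p * (1 - Re z)" "0 \<le> p * Re z"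
        using that p by (auto simp: mult_left_le intro!: mult_nonneg_nonneg)
      have "cmod (y i j a z) \<le> (1 + \<beta> i j) powr 1 * (1 + \<tau> i * \<tau> j) powr 1 * (1 + th i j a) powr p" for i j a
        unfolding norm_y using \<beta>[of i j] \<tau>(1) th_nonneg that pz
        by (intro mult_mono powr_le_strip) auto
      then show ?thesis
        unfolding F_def M_def
        by (intro order_trans[OF norm_sum] sum_mono, unfold norm_mult norm_\<sigma>)
          (intro mult_mono powr_le_strip DA(3) pz order_trans[OF norm_sum] sum_mono;
            simp add: norm_mult mult_right_mono)
    qed
    have hol: "F n holomorphic_on UNIV" for n
      unfolding F_def y_def by (intro holomorphic_intros holomorphic_of_real_powr) auto
    \<comment> \<open>The strip has width 1/2 and contains \<open>1 / p\<close> because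
      \<open>p \<ge> 2\<close>; the relative position is \<open>2 / p\<close>.\<close>
    have three: "cmod (F n (of_real (1 / p))) \<le> (S * b) powr (1 - 2 / p) * (sqrt S * sqrt (b * \<theta>)) powr (2 / p)" for n
      using three_lines[OF hol[of n], of "1 / 2" "S * b" "sqrt S * sqrt (b * \<theta>)" "M n" "1 / p"]
        left right bdd p b \<theta> S by simp
    have Fval: "F n (of_real (1 / p)) = (\<Sum>k<K. of_real (\<sigma> k powr (p - 1)) * (\<Sum>i\<in>J. \<Sum>j\<in>J. \<Sum>a<n. of_real (t i j a) * c k i j a))" for n
    proof -
      have "y i j a (of_real (1 / p)) = of_real (t i j a)" for i j a
      proof -
        have "y i j a (of_real (1 / p)) = of_real (\<beta> i j powr (1 - 1 / p) * (\<tau> i * \<tau> j) powr (1 / p / 2) * th i j a powr (p * (1 / p)))"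
          unfolding y_def of_real_mult
          using \<beta>[of i j] \<tau>(1) th_nonneg
          by (simp add: powr_of_real[symmetric])
        also have "\<beta> i j powr (1 - 1 / p) * (\<tau> i * \<tau> j) powr (1 / p / 2) * th i j a powr (p * (1 / p)) = m i j * th i j a"
          using p th_nonneg[of i j a] by (simp add: m_def diff_divide_distrib mult.commute)
        finally show ?thesis by (simp only: m_th)
      qed
      moreover have "of_real (\<sigma> k) powr (of_real p * (1 - of_real (1 / p))) = complex_of_real (\<sigma> k powr (p - 1))" for k
      proof -
        have "complex_of_real p * (1 - of_real (1 / p)) = of_real (p - 1)"
          using p by (simp add: field_simps)
        then show ?thesis using DA(3) by (simp only: powr_of_real)
      qed
      ultimately show ?thesis unfolding F_def by simp
    qed
    have "(\<lambda>n. F n (of_real (1 / p))) \<longlonglongrightarrow> (\<Sum>k<K. of_real (\<sigma> k powr (p - 1)) * of_real (\<sigma> k))"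
      unfolding Fval by (intro tendsto_intros expand)
    moreover have "(\<Sum>k<K. complex_of_real (\<sigma> k powr (p - 1)) * of_real (\<sigma> k)) = of_real S"
    proof -
      have "\<sigma> k powr (p - 1) * \<sigma> k = \<sigma> k powr p" for k
        using DA(3)[of k] by (cases "\<sigma> k = 0") (auto simp: powr_diff)
      then show ?thesis unfolding S_def of_real_sum by (simp flip: of_real_mult)
    qed
    ultimately have "(\<lambda>n. cmod (F n (of_real (1 / p)))) \<longlonglongrightarrow> cmod (of_real S)"
      using tendsto_norm by metis
    then have "cmod (of_real S) \<le> (S * b) powr (1 - 2 / p) * (sqrt S * sqrt (b * \<theta>)) powr (2 / p)"
      by (rule Lim_bounded) (use three in blast)
    then have "S \<le> (S * b) powr (1 - 2 / p) * (sqrt S * sqrt (b * \<theta>)) powr (2 / p)"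
      using S by simp
    \<comment> \<open>On the right \<open>S\<close> has total exponent 1 - 1/p < 1, so the
      inequality can be solved for \<open>S\<close>; in logarithms it is linear.\<close>
    then have "ln S \<le> ln ((S * b) powr (1 - 2 / p) * (sqrt S * sqrt (b * \<theta>)) powr (2 / p))"
      using S by (subst ln_le_cancel_iff) auto
    also have "\<dots> = (1 - 2 / p) * (ln S + ln b) + (2 / p) * ((ln S + (ln b + ln \<theta>)) / 2)"
      using S b \<theta> by (simp add: ln_mult ln_powr ln_sqrt add_divide_distrib)
    finally have "p * ln S \<le> p * ((1 - 2 / p) * (ln S + ln b) + (2 / p) * ((ln S + (ln b + ln \<theta>)) / 2))"
      using p by (intro mult_left_mono) auto
    also have "\<dots> = (p - 1) * ln S + (p - 1) * ln b + ln \<theta>"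
      using p by (simp add: field_simps)
    finally have "ln S \<le> (p - 1) * ln b + ln \<theta>" by (simp add: algebra_simps)
    then have "exp (ln S) \<le> exp ((p - 1) * ln b + ln \<theta>)" by simp
    also have "\<dots> = b powr (p - 1) * \<theta>" using b \<theta> by (simp add: exp_add powr_def)
    finally show ?thesis using S by (simp add: S_def)
  qed
  have "schatten_power_sum p A \<le> ennreal (b powr (p - 1) * \<theta>)"
    unfolding svd_power_sum[OF svdA]
    by (rule suminf_le_const) (use main in \<open>auto simp: sum_ennreal intro!: ennreal_leI\<close>)
  then show ?thesis unfolding A_def .
qed

section \<open>Schatten norms and operator norms\<close>

lemma schatten_ennorm_le:
  assumes "compact_operator T" "schatten_power_sum q T \<le> ennreal c" "c \<ge> 0" "q > 0"
  shows "schatten_ennorm q T \<le> ennreal (c powr (1 / q))"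
proof -
  have "schatten_power_sum q T < \<infinity>" using assms(2) by (auto simp: le_less_trans)
  moreover have "enn2real (schatten_power_sum q T) \<le> c"
    using assms(2,3) by (metis enn2real_mono enn2real_ennreal ennreal_less_top)
  ultimately show ?thesis
    using assms by (auto simp: schatten_ennorm_def intro!: ennreal_leI powr_mono2)
qed

lemma schatten_power_sum_le_of_ennorm:
  assumes "schatten_ennorm q T \<le> ennreal r" "r \<ge> 0" "q > 0"
  shows "compact_operator T" "schatten_power_sum q T \<le> ennreal (r powr q)"
proof -
  have fin: "schatten_ennorm q T \<noteq> \<infinity>" using assms(1) by (auto simp: top_unique)
  then show "compact_operator T" by (auto simp: schatten_ennorm_def split: if_splits)
  define c where "c = enn2real (schatten_power_sum q T)"
  have c: "schatten_power_sum q T = ennreal c" "c \<ge> 0"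
    using fin by (auto simp: c_def schatten_ennorm_def ennreal_enn2real_if split: if_splits)
  have "ennreal (c powr (1 / q)) \<le> ennreal r"
    using fin assms(1) by (auto simp: c_def schatten_ennorm_def split: if_splits)
  then have "c powr (1 / q) \<le> r" using assms(2) by simp
  then have "(c powr (1 / q)) powr q \<le> r powr q" using assms(3) by (intro powr_mono2) auto
  then show "schatten_power_sum q T \<le> ennreal (r powr q)"
    using c assms(3) by (simp add: powr_powr ennreal_leI)
qed

text \<open>The diagonal estimate is applied to the one-element systems \<open>sgn x\<close> and
  \<open>sgn (T x)\<close>.\<close>

lemma norm_le_of_schatten_power_sum:
  assumes T: "compact_operator T" and c: "schatten_power_sum q T \<le> ennreal c" "c \<ge> 0" and q: "q \<ge> 1"
  shows "norm (T x) \<le> c powr (1 / q) * norm x"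
proof (cases "T x = 0 \<or> x = 0")
  case True
  then show ?thesis using clinear_zero[OF compact_operator_clinear[OF T]] by auto
next
  case False
  note lin = compact_operator_clinear[OF T]
  have bes: "bessel_on {0::nat} (\<lambda>_. sgn z)" for z :: 'a
    by (rule bessel_orthonormal_on) (auto simp: norm_sgn)
  have sgn_z: "cinner z (sgn z) = of_real (norm z)" for z :: 'a
    by (cases "z = 0") (auto simp: sgn_div_norm cinner_scaleR_right cinner_self power2_eq_square)
  have "T (sgn x) = (1 / norm x) *\<^sub>R T x" by (simp add: sgn_div_norm clinear_scaleR[OF lin] divide_inverse)
  then have "cinner (T (sgn x)) (sgn (T x)) = of_real (norm (T x) / norm x)"
    by (simp add: cinner_scaleR_left sgn_z)
  then have "ennreal ((norm (T x) / norm x) powr q) \<le> schatten_power_sum q T"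
    using schatten_power_sum_ge[OF T q _ bes bes, of x "T x"] by (simp add: norm_divide)
  also note c(1)
  finally have "(norm (T x) / norm x) powr q \<le> c" using c(2) by simp
  then have "((norm (T x) / norm x) powr q) powr (1 / q) \<le> c powr (1 / q)"
    using q by (intro powr_mono2) auto
  then show ?thesis using q False by (simp add: powr_powr field_simps)
qed

section \<open>Finite sums\<close>

lemma svd_swap: "svd T s e f \<Longrightarrow> svd (diag_op s f e) s f e"
  by (simp add: svd_def)

text \<open>\<open>T\<close> factors as the root of its modulus, a partial isometry, and the root of
  the modulus of its adjoint, here \<open>sqrt_abs s f\<close>; the last factor is moved to
  \<open>y\<close>.\<close>

lemma svd_cinner_le:
  assumes svd: "svd T s e f"
  shows "cmod (cinner (T x) y) \<le> norm (sqrt_abs s e x) * norm (sqrt_abs s f y)"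
proof -
  note D = svdD[OF svd]
  obtain C where C: "\<forall>k. \<bar>s k\<bar> \<le> C" using svd_bounded[OF svd] by metis
  have Cs: "\<forall>k. \<bar>sqrt (s k)\<bar> \<le> sqrt C" using C by (auto simp flip: real_sqrt_abs2)
  have one: "\<forall>k. \<bar>(\<lambda>_. 1 :: real) k\<bar> \<le> 1" by simp
  let ?U = "diag_op (\<lambda>_. 1) e f (sqrt_abs s e x)"
  have U: "?U = diag_op (\<lambda>k. sqrt (s k)) e f x"
    using diag_op_comp[OF D(1,1,2) Cs, of "\<lambda>_. 1" x] by simp
  have "diag_op (\<lambda>k. sqrt (s k)) f f (diag_op (\<lambda>k. sqrt (s k)) e f x) = diag_op (\<lambda>k. sqrt (s k) * sqrt (s k)) e f x"
    by (rule diag_op_comp[OF D(1,2,2) Cs]) (use D(4,5) in simp)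
  then have "T x = sqrt_abs s f ?U"
    unfolding U D(7) using D(3) by simp
  then have "cmod (cinner (T x) y) = cmod (cinner ?U (sqrt_abs s f y))"
    using svd_sqrt(2)[OF svd_swap[OF svd]] by simp
  also have "\<dots> \<le> norm ?U * norm (sqrt_abs s f y)" by (rule cinner_Cauchy_Schwarz)
  also have "\<dots> \<le> norm (sqrt_abs s e x) * norm (sqrt_abs s f y)"
    using norm_diag_op_le[OF D(1,2) one, of "sqrt_abs s e x"] by (intro mult_right_mono) auto
  finally show ?thesis .
qed

text \<open>\<open>b\<close> and \<open>\<theta>\<close> are strictly positive majorants, not the
  norm and the sum themselves, because the interpolation takes their logarithms.\<close>

lemma schatten_sum_bound:
  fixes T :: "'j \<Rightarrow> 'a::complex_hilbert \<Rightarrow> 'a" and \<alpha> :: "'j \<Rightarrow> 'j \<Rightarrow> real"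
  assumes J: "finite J" and p: "p \<ge> 2" and p': "p' = p / (p - 1)" and b: "b > 0" and \<theta>: "\<theta> > 0"
    and T: "\<And>j. T j \<in> schatten_class p"
    and sum_le: "(\<Sum>j\<in>J. schatten_norm p (T j) powr p) \<le> \<theta>"
    and \<alpha>: "\<And>i j. 0 \<le> \<alpha> i j"
    and right: "\<And>i j. schatten_ennorm (p / 2) (T i \<circ> cadjoint (T j))
      \<le> ennreal ((\<alpha> i j)\<^sup>2 * schatten_norm p (T i) * schatten_norm p (T j))"
    and left: "\<And>i j. schatten_ennorm (p / 2) (cadjoint (T i) \<circ> T j)
      \<le> ennreal ((\<alpha> i j)\<^sup>2 * schatten_norm p (T i) * schatten_norm p (T j))"
    and form: "\<And>x. (\<And>j. 0 \<le> x j) \<Longrightarrow>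
      (\<Sum>i\<in>J. \<Sum>j\<in>J. \<alpha> i j powr p' * (x i * x j)) \<le> b * (\<Sum>j\<in>J. (x j)\<^sup>2)"
  shows "schatten_power_sum p (\<lambda>x. \<Sum>j\<in>J. T j x) \<le> ennreal (b powr (p - 1) * \<theta>)"
proof -
  define C where "C = b powr (p - 1) * \<theta>"
  define \<tau> where "\<tau> j = schatten_norm p (T j) powr p" for j
  have nonneg: "schatten_norm p (T j) \<ge> 0" for j by (simp add: schatten_norm_def)
  have comp: "compact_operator (T j)" for j using T by (simp add: schatten_class_def)
  then have "\<exists>s e f. svd (T j) s e f" for j by (rule svd_exists)
  then obtain s e f where svd: "\<And>j. svd (T j) (s j) (e j) (f j)" by metis
  have block: "(\<Sum>a<n. t a powr p) \<le> (\<alpha> i j powr p') powr (p - 1) * sqrt (\<tau> i * \<tau> j)"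
    if U: "svd U sU eU fU" and V: "svd V sV eV fV"
      and X: "svd (\<lambda>x. sqrt_abs sU eU (sqrt_abs sV eV x)) t u v"
      and le: "schatten_ennorm (p / 2) (U \<circ> cadjoint V)
        \<le> ennreal ((\<alpha> i j)\<^sup>2 * schatten_norm p (T i) * schatten_norm p (T j))"
    for U V :: "'a \<Rightarrow> 'a" and sU eU fU sV eV fV t u v n i j
  proof -
    have r: "0 \<le> (\<alpha> i j)\<^sup>2 * schatten_norm p (T i) * schatten_norm p (T j)"
      using nonneg by simp
    have q: "p / 2 > 0" "p / 2 \<ge> 1" using p by auto
    note c = schatten_power_sum_le_of_ennorm[OF le r q(1)]
    have "ennreal (\<Sum>a<n. t a powr (2 * (p / 2))) \<le> schatten_power_sum (p / 2) (U \<circ> cadjoint V)"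
      by (rule schatten_sqrt_product[OF U V X q(2) c(1)])
    also note c(2)
    finally have "(\<Sum>a<n. t a powr p) \<le> ((\<alpha> i j)\<^sup>2 * schatten_norm p (T i) * schatten_norm p (T j)) powr (p / 2)"
      by simp
    \<comment> \<open>Since \<open>p' * (p - 1) = p\<close>, both sides carry the factor
      \<open>\<alpha> i j powr p\<close>.\<close>
    also have "\<dots> = (\<alpha> i j powr p') powr (p - 1) * sqrt (\<tau> i * \<tau> j)"
    proof -
      have "((\<alpha> i j)\<^sup>2) powr (p / 2) = \<alpha> i j powr p"
        using \<alpha>[of i j] by (cases "\<alpha> i j = 0") (auto simp: powr_powr simp flip: powr_numeral)
      moreover have "(\<alpha> i j powr p') powr (p - 1) = \<alpha> i j powr p"
        using p by (simp add: powr_powr p')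
      moreover have "sqrt (\<tau> i * \<tau> j) = schatten_norm p (T i) powr (p / 2) * schatten_norm p (T j) powr (p / 2)"
        by (simp add: \<tau>_def powr_half_sqrt[symmetric] powr_mult powr_powr)
      ultimately show ?thesis using nonneg by (simp add: powr_mult)
    qed
    finally show ?thesis .
  qed
  have cadj: "cadjoint (T j) = diag_op (s j) (f j) (e j)" for j by (rule svd_cadjoint[OF svd])
  have cadj': "cadjoint (diag_op (s j) (f j) (e j)) = T j" for j
    using svd_cadjoint[OF svd_swap[OF svd]] svdD(7)[OF svd] by metis
  \<comment> \<open>For the adjoint family the hypothesis on
    \<open>cadjoint (T i) \<circ> T j\<close> takes the shape of the other one, so a single block
    estimate serves both sums of moduli.\<close>
  have left': "schatten_ennorm (p / 2) (diag_op (s i) (f i) (e i) \<circ> cadjoint (diag_op (s j) (f j) (e j)))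
      \<le> ennreal ((\<alpha> i j)\<^sup>2 * schatten_norm p (T i) * schatten_norm p (T j))" for i j
    using left[of i j] by (simp only: cadj cadj')
  let ?A = "\<lambda>x. \<Sum>j\<in>J. diag_op (s j) (e j) (e j) x" and ?B = "\<lambda>x. \<Sum>j\<in>J. diag_op (s j) (f j) (f j) x"
  have A: "schatten_power_sum p ?A \<le> ennreal C"
    unfolding C_def
    by (rule positive_family_bound[where \<beta> = "\<lambda>i j. \<alpha> i j powr p'" and \<tau> = \<tau>, OF J p b \<theta> svd _ _ _ form])
      (use sum_le block[OF svd svd _ right] in \<open>auto simp: \<tau>_def\<close>)
  have B: "schatten_power_sum p ?B \<le> ennreal C"
    unfolding C_def
    by (rule positive_family_bound[where \<beta> = "\<lambda>i j. \<alpha> i j powr p'" and \<tau> = \<tau>, OF J p b \<theta> svd_swap[OF svd] _ _ _ form])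
      (use sum_le block[OF svd_swap[OF svd] svd_swap[OF svd] _ left'] in \<open>auto simp: \<tau>_def\<close>)
  have svd1: "\<forall>j. svd (T j) (s j) (e j) (f j)"
    and svd2: "\<forall>j. svd (diag_op (s j) (f j) (e j)) (s j) (f j) (e j)"
    using svd svd_swap[OF svd] by simp_all
  have form_eq: "cinner (\<Sum>j\<in>J. diag_op (s' j) (g j) (g j) x) x = of_real (\<Sum>j\<in>J. (norm (sqrt_abs (s' j) (g j) x))\<^sup>2)"
    if "\<forall>j. svd (W j) (s' j) (g j) (g' j)" for W s' g g' and x :: 'a
    unfolding cinner_sum_left of_real_sum cinner_self[symmetric]
    by (intro sum.cong refl) (simp add: svd_sqrt(3)[OF that[rule_format], symmetric] svd_sqrt(2)[OF that[rule_format]])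
  have diag: "(\<Sum>a<n. (\<Sum>j\<in>J. (norm (sqrt_abs (s' j) (g j) (x a)))\<^sup>2) powr p) \<le> C"
    if W: "\<forall>j. svd (W j) (s' j) (g j) (g' j)" and x: "ortho x"
      and le: "schatten_power_sum p (\<lambda>x. \<Sum>j\<in>J. diag_op (s' j) (g j) (g j) x) \<le> ennreal C"
    for W s' g g' and x :: "nat \<Rightarrow> 'a" and n :: nat
  proof -
    have c: "compact_operator (\<lambda>x. \<Sum>j\<in>J. diag_op (s' j) (g j) (g j) x)"
      by (intro compact_operator_sum J svd_sqrt(4)[OF W[rule_format]])
    have "ennreal (\<Sum>a<n. cmod (cinner (\<Sum>j\<in>J. diag_op (s' j) (g j) (g j) (x a)) (x a)) powr p) \<le> ennreal C"
      using schatten_power_sum_ge[OF c _ _ bessel_ortho[OF x] bessel_ortho[OF x], of p "{..<n}"] le p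
      by (auto intro: order_trans)
    moreover have "C \<ge> 0" using \<theta> by (simp add: C_def)
    ultimately show ?thesis
      unfolding form_eq[OF W] norm_of_real by (simp add: abs_of_nonneg sum_nonneg)
  qed
  have "schatten_power_sum p (\<lambda>x. \<Sum>j\<in>J. T j x) \<le> ennreal C"
  proof (rule schatten_power_sum_le)
    show "compact_operator (\<lambda>x. \<Sum>j\<in>J. T j x)" by (intro compact_operator_sum J comp)
    fix n :: nat and x y :: "nat \<Rightarrow> 'a" assume xy: "ortho x" "ortho y"
    define P where "P a = (\<Sum>j\<in>J. (norm (sqrt_abs (s j) (e j) (x a)))\<^sup>2)" for a
    define Q where "Q a = (\<Sum>j\<in>J. (norm (sqrt_abs (s j) (f j) (y a)))\<^sup>2)" for a
    have PQ: "P a \<ge> 0" "Q a \<ge> 0" for a by (auto simp: P_def Q_def sum_nonneg)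
    \<comment> \<open>Both sums of moduli obey the same bound \<open>C\<close>, so the arithmetic
      mean of the two p-th powers is good enough after the geometric one.\<close>
    have pt: "cmod (cinner (\<Sum>j\<in>J. T j (x a)) (y a)) powr p \<le> (P a powr p + Q a powr p) / 2" for a
    proof -
      have "cmod (cinner (\<Sum>j\<in>J. T j (x a)) (y a))
          \<le> (\<Sum>j\<in>J. norm (sqrt_abs (s j) (e j) (x a)) * norm (sqrt_abs (s j) (f j) (y a)))"
        unfolding cinner_sum_left by (intro order_trans[OF norm_sum] sum_mono svd_cinner_le svd)
      also have "\<dots> \<le> sqrt (P a) * sqrt (Q a)"
        using PQ by (intro sum_mult_le_sq) (auto simp: P_def Q_def)
      finally have "cmod (cinner (\<Sum>j\<in>J. T j (x a)) (y a)) powr p \<le> (sqrt (P a) * sqrt (Q a)) powr p"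
        using p by (intro powr_mono2) auto
      also have "\<dots> = P a powr (p / 2) * Q a powr (p / 2)"
        using PQ by (simp add: powr_mult powr_half_sqrt[symmetric] powr_powr)
      also have "\<dots> \<le> ((P a powr (p / 2))\<^sup>2 + (Q a powr (p / 2))\<^sup>2) / 2"
        using sum_squares_bound[of "P a powr (p / 2)" "Q a powr (p / 2)"] by simp
      also have "\<dots> = (P a powr p + Q a powr p) / 2"
        by (simp add: power2_eq_square flip: powr_add)
      finally show ?thesis .
    qed
    have "(\<Sum>a<n. cmod (cinner (\<Sum>j\<in>J. T j (x a)) (y a)) powr p)
        \<le> ((\<Sum>a<n. P a powr p) + (\<Sum>a<n. Q a powr p)) / 2"
      using sum_mono[of "{..<n}", OF pt] by (simp add: sum.distrib sum_divide_distrib[symmetric])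
    also have "\<dots> \<le> C"
    proof -
      have "(\<Sum>a<n. P a powr p) \<le> C" unfolding P_def by (rule diag[OF svd1 xy(1) A])
      moreover have "(\<Sum>a<n. Q a powr p) \<le> C" unfolding Q_def by (rule diag[OF svd2 xy(2) B])
      ultimately show ?thesis by simp
    qed
    finally show "(\<Sum>a<n. cmod (cinner (\<Sum>j\<in>J. T j (x a)) (y a)) powr p) \<le> C" .
  qed
  then show ?thesis by (simp add: C_def)
qed

section \<open>Matrices on square-summable sequences\<close>

text \<open>Rescaling to the unit ball; the boundedness hypothesis ensures that the real supremum is
  over a set bounded above.\<close>

lemma ell2_opnorm_bound:
  assumes A: "bounded_on_ell2 A" and x: "x \<in> ell2"
  shows "ell2_norm (matrix_apply A x) \<le> ell2_opnorm A * ell2_norm x" "0 \<le> ell2_opnorm A"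
proof -
  have norm_nonneg: "ell2_norm y \<ge> 0" if "y \<in> ell2" for y
    using that by (simp add: ell2_norm_def ell2_def suminf_nonneg)
  have scale: "(\<lambda>j. y j / of_real r) \<in> ell2" "ell2_norm (\<lambda>j. y j / of_real r) = ell2_norm y / r"
    if "y \<in> ell2" "r > 0" for y r
    using that suminf_divide[of "\<lambda>j. (cmod (y j))\<^sup>2" "r\<^sup>2"]
    by (auto simp: ell2_def ell2_norm_def norm_divide power_divide real_sqrt_divide intro: summable_divide)
  obtain C where C: "\<And>y. y \<in> ell2 \<Longrightarrow> ell2_norm (matrix_apply A y) \<le> C * ell2_norm y"
    using A unfolding bounded_on_ell2_def by blast
  have bdd: "bdd_above ((\<lambda>x. ell2_norm (matrix_apply A x)) ` {x \<in> ell2. ell2_norm x \<le> 1})"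
  proof (rule bdd_aboveI2)
    fix y assume y: "y \<in> {x \<in> ell2. ell2_norm x \<le> 1}"
    then have "ell2_norm (matrix_apply A y) \<le> C * ell2_norm y" using C by blast
    also have "\<dots> \<le> \<bar>C\<bar> * 1" using y norm_nonneg by (intro mult_mono) auto
    finally show "ell2_norm (matrix_apply A y) \<le> \<bar>C\<bar>" by simp
  qed
  have up: "ell2_norm (matrix_apply A y) \<le> ell2_opnorm A" if "y \<in> ell2" "ell2_norm y \<le> 1" for y
    unfolding ell2_opnorm_def using that by (intro cSUP_upper bdd) auto
  have "(\<lambda>_. 0) \<in> ell2" "ell2_norm (\<lambda>_. 0) = 0" by (auto simp: ell2_def ell2_norm_def)
  from up[OF this(1)] this(2) show "0 \<le> ell2_opnorm A"
    by (simp add: matrix_apply_def ell2_norm_def)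
  show "ell2_norm (matrix_apply A x) \<le> ell2_opnorm A * ell2_norm x"
  proof (cases "ell2_norm x = 0")
    case True
    then show ?thesis using C[OF x] by simp
  next
    case False
    then have r: "ell2_norm x > 0" using norm_nonneg[OF x] by simp
    have Ax: "matrix_apply A x \<in> ell2" "\<And>i. summable (\<lambda>j. A i j * x j)"
      using A x unfolding bounded_on_ell2_def by auto
    have "matrix_apply A (\<lambda>j. x j / of_real (ell2_norm x)) = (\<lambda>i. matrix_apply A x i / of_real (ell2_norm x))"
      using suminf_divide[OF Ax(2)] by (simp add: matrix_apply_def)
    then have "ell2_norm (matrix_apply A x) / ell2_norm x \<le> ell2_opnorm A"
      using up[OF scale(1)[OF x r]] scale(2)[OF x r] scale(2)[OF Ax(1) r] r by simp
    then show ?thesis using r by (simp add: field_simps)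
  qed
qed

text \<open>Extend the vector by zero and apply Cauchy-Schwarz. This finite quadratic form is the
  shape in which the matrix norm enters the estimates.\<close>

lemma ell2_opnorm_form:
  fixes \<beta> :: "nat \<Rightarrow> nat \<Rightarrow> real"
  assumes A: "bounded_on_ell2 (\<lambda>i j. complex_of_real (\<beta> i j))" and J: "finite J" and x: "\<And>j. 0 \<le> x j"
  shows "(\<Sum>i\<in>J. \<Sum>j\<in>J. \<beta> i j * (x i * x j)) \<le> ell2_opnorm (\<lambda>i j. complex_of_real (\<beta> i j)) * (\<Sum>j\<in>J. (x j)\<^sup>2)"
proof -
  let ?A = "\<lambda>i j. complex_of_real (\<beta> i j)"
  define z where "z j = (if j \<in> J then complex_of_real (x j) else 0)" for j
  define X where "X = (\<Sum>j\<in>J. (x j)\<^sup>2)"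
  have X: "X \<ge> 0" by (simp add: X_def sum_nonneg)
  have "(\<lambda>j. (cmod (z j))\<^sup>2) = (\<lambda>j. if j \<in> J then (x j)\<^sup>2 else 0)"
    by (auto simp: z_def fun_eq_iff)
  then have zs: "(\<lambda>j. (cmod (z j))\<^sup>2) sums X"
    using sums_If_finite_set[OF J, of "\<lambda>j. (x j)\<^sup>2"] by (simp only: X_def)
  have z: "z \<in> ell2" "ell2_norm z = sqrt X"
    using zs by (auto simp: ell2_def ell2_norm_def sums_iff)
  have Az: "matrix_apply ?A z i = (\<Sum>j\<in>J. of_real (\<beta> i j * x j))" for i
    unfolding matrix_apply_def using J by (subst suminf_finite[of J]) (auto simp: z_def)
  define Y where "Y i = (\<Sum>j\<in>J. \<beta> i j * x j)" for i
  have AzY: "matrix_apply ?A z i = of_real (Y i)" for i by (simp add: Az Y_def)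
  have "matrix_apply ?A z \<in> ell2" using A z(1) by (auto simp: bounded_on_ell2_def)
  then have Ys: "summable (\<lambda>i. (Y i)\<^sup>2)" by (simp add: ell2_def AzY)
  have "(\<Sum>i\<in>J. (Y i)\<^sup>2) \<le> (\<Sum>i. (Y i)\<^sup>2)" using Ys J by (intro sum_le_suminf) auto
  also have "\<dots> = (ell2_norm (matrix_apply ?A z))\<^sup>2"
    by (simp add: ell2_norm_def AzY suminf_nonneg[OF Ys])
  also have "\<dots> \<le> (ell2_opnorm ?A * sqrt X)\<^sup>2"
    using ell2_opnorm_bound(1)[OF A z(1)] z(2) suminf_nonneg[OF Ys]
    by (intro power_mono) (auto simp: ell2_norm_def AzY)
  finally have Y: "(\<Sum>i\<in>J. (Y i)\<^sup>2) \<le> (ell2_opnorm ?A * sqrt X)\<^sup>2" .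
  have "(\<Sum>i\<in>J. \<Sum>j\<in>J. \<beta> i j * (x i * x j)) = (\<Sum>i\<in>J. x i * Y i)"
    by (simp add: Y_def sum_distrib_left mult_ac)
  also have "\<dots> \<le> sqrt X * (ell2_opnorm ?A * sqrt X)"
    using Y X ell2_opnorm_bound(2)[OF A z(1)] by (intro sum_mult_le_sq) (auto simp: X_def)
  also have "\<dots> = ell2_opnorm ?A * X" using X by (simp add: mult.assoc mult.left_commute)
  finally show ?thesis by (simp add: X_def)
qed

section \<open>Convergence of the series\<close>

theorem mainTheorem3:
  fixes T :: "nat \<Rightarrow> 'h::complex_hilbert \<Rightarrow> 'h"
    and \<alpha> :: "nat \<Rightarrow> nat \<Rightarrow> real"
    and p p' :: real
  assumes "separable_space (euclidean :: 'h topology)"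
    and "2 \<le> p" and "p' = p / (p - 1)"
    and "\<And>j. T j \<in> schatten_class p"
    and "summable (\<lambda>j. schatten_norm p (T j) powr p)"
    and "\<And>i j. \<alpha> i j = \<alpha> j i"
    and "\<And>i j. \<alpha> i j \<in> {0..1}"
    and "\<And>i j. schatten_ennorm (p / 2) (T i \<circ> cadjoint (T j))
           \<le> ennreal ((\<alpha> i j)\<^sup>2 * schatten_norm p (T i) * schatten_norm p (T j))"
    and "\<And>i j. schatten_ennorm (p / 2) (cadjoint (T i) \<circ> T j)
           \<le> ennreal ((\<alpha> i j)\<^sup>2 * schatten_norm p (T i) * schatten_norm p (T j))"
    and "bounded_on_ell2 (\<lambda>i j. complex_of_real (\<alpha> i j powr p'))"
  shows "\<exists>S. schatten_sums p T S \<and>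
    schatten_norm p S
      \<le> ell2_opnorm (\<lambda>i j. complex_of_real (\<alpha> i j powr p')) powr (1 / p')
          * (\<Sum>j. schatten_norm p (T j) powr p) powr (1 / p)"
proof -
  note p = assms(2)
  define \<tau> where "\<tau> j = schatten_norm p (T j) powr p" for j
  define N where "N = ell2_opnorm (\<lambda>i j. complex_of_real (\<alpha> i j powr p'))"
  define G where "G = N powr (p - 1)"
  \<comment> \<open>Bounds the p-th power of the Schatten norm of every block of the series starting
    at \<open>m\<close>; \<open>\<delta> 0\<close> is the p-th power of the bound to be
    shown.\<close>
  define \<delta> where "\<delta> m = G * (suminf \<tau> - sum \<tau> {..<m})" for m
  have \<tau>: "\<tau> j \<ge> 0" "summable \<tau>" for j using assms(5) by (auto simp: \<tau>_def[abs_def])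
  have N: "N \<ge> 0" unfolding N_def
    by (rule ell2_opnorm_bound(2)[OF assms(10), of "\<lambda>_. 0"]) (simp add: ell2_def)
  have comp: "compact_operator (T j)" for j using assms(4) by (simp add: schatten_class_def)
  define D where "D m n x = (\<Sum>j\<in>{m..<n}. T j x)" for m n x
  have cD: "compact_operator (D m n)" for m n
    unfolding D_def by (intro compact_operator_sum comp) simp
  have D_le: "schatten_power_sum p (D m n) \<le> ennreal (G * sum \<tau> {m..<n})" for m n
  proof (rule LIMSEQ_le_const)
    \<comment> \<open>Enlarging \<open>N\<close> and the sum by 1/(k+1) provides the strict
      positivity needed for finite sums; letting k grow restores the exact constants, also when they
      are 0.\<close>
    have "(\<lambda>k. (N + 1 / real (Suc k)) powr (p - 1) * (sum \<tau> {m..<n} + 1 / real (Suc k)))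
        \<longlonglongrightarrow> (N + 0) powr (p - 1) * (sum \<tau> {m..<n} + 0)"
      using p N by (intro tendsto_intros tendsto_powr' LIMSEQ_Suc[OF lim_1_over_n]) auto
    then show "(\<lambda>k. ennreal ((N + 1 / real (Suc k)) powr (p - 1) * (sum \<tau> {m..<n} + 1 / real (Suc k))))
        \<longlonglongrightarrow> ennreal (G * sum \<tau> {m..<n})"
      unfolding G_def by (intro tendsto_ennrealI) simp
    have "schatten_power_sum p (D m n) \<le> ennreal ((N + \<epsilon>) powr (p - 1) * (sum \<tau> {m..<n} + \<epsilon>))" if "\<epsilon> > 0" for \<epsilon>
      unfolding D_def
    proof (rule schatten_sum_bound[OF _ p assms(3) _ _ assms(4) _ _ assms(8,9)])
      show "N + \<epsilon> > 0" "sum \<tau> {m..<n} + \<epsilon> > 0"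
        using that N \<tau>(1) by (auto intro: add_nonneg_pos sum_nonneg)
      show "0 \<le> \<alpha> i j" for i j using assms(7)[of i j] by simp
      show "(\<Sum>j\<in>{m..<n}. schatten_norm p (T j) powr p) \<le> sum \<tau> {m..<n} + \<epsilon>"
        using that by (simp add: \<tau>_def)
      fix x :: "nat \<Rightarrow> real" assume x: "\<And>j. 0 \<le> x j"
      have "(\<Sum>i\<in>{m..<n}. \<Sum>j\<in>{m..<n}. \<alpha> i j powr p' * (x i * x j)) \<le> N * (\<Sum>j\<in>{m..<n}. (x j)\<^sup>2)"
        unfolding N_def by (rule ell2_opnorm_form[OF assms(10) _ x]) simp
      also have "\<dots> \<le> (N + \<epsilon>) * (\<Sum>j\<in>{m..<n}. (x j)\<^sup>2)"
        using that by (intro mult_right_mono sum_nonneg) auto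
      finally show "(\<Sum>i\<in>{m..<n}. \<Sum>j\<in>{m..<n}. \<alpha> i j powr p' * (x i * x j)) \<le> (N + \<epsilon>) * (\<Sum>j\<in>{m..<n}. (x j)\<^sup>2)" .
    qed simp
    then show "\<exists>k0. \<forall>k\<ge>k0. schatten_power_sum p (D m n)
        \<le> ennreal ((N + 1 / real (Suc k)) powr (p - 1) * (sum \<tau> {m..<n} + 1 / real (Suc k)))"
      by simp
  qed
  have D_tail: "schatten_power_sum p (D m n) \<le> ennreal (\<delta> m)" if "m \<le> n" for m n
  proof -
    have "sum \<tau> {m..<n} = sum \<tau> {..<n} - sum \<tau> {..<m}"
      using that by (simp add: sum_diff_nat_ivl lessThan_atLeast0)
    also have "\<dots> \<le> suminf \<tau> - sum \<tau> {..<m}"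
      using \<tau> by (intro diff_right_mono sum_le_suminf) auto
    finally have "G * sum \<tau> {m..<n} \<le> \<delta> m"
      unfolding \<delta>_def by (intro mult_left_mono) (auto simp: G_def)
    then show ?thesis using D_le[of m n] by (meson ennreal_leI order_trans)
  qed
  have \<delta>0: "\<delta> m \<ge> 0" for m
    unfolding \<delta>_def G_def using \<tau> by (intro mult_nonneg_nonneg) (auto intro!: sum_le_suminf)
  have "(\<lambda>m. G * (suminf \<tau> - sum \<tau> {..<m})) \<longlonglongrightarrow> G * (suminf \<tau> - suminf \<tau>)"
    by (intro tendsto_intros summable_LIMSEQ \<tau>)
  then have \<delta>_lim: "\<delta> \<longlonglongrightarrow> 0" by (simp add: \<delta>_def[abs_def])
  have \<delta>_root: "(\<lambda>m. \<delta> m powr (1 / p)) \<longlonglongrightarrow> 0"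
    using tendsto_powr'[OF \<delta>_lim tendsto_const[of "1 / p"]] p \<delta>0 by simp
  define P where "P n x = (\<Sum>j<n. T j x)" for n x
  have PD: "P n x - P m x = D m n x" if "m \<le> n" for m n x
    using that by (simp add: P_def D_def sum_diff_nat_ivl lessThan_atLeast0)
  have cP: "compact_operator (P n)" for n
    unfolding P_def by (intro compact_operator_sum comp) simp
  \<comment> \<open>The Schatten bound dominates the operator norm, so the partial sums converge
    pointwise and uniformly on the unit ball.\<close>
  have P_diff: "norm (P n x - P m x) \<le> \<delta> m powr (1 / p) * norm x" if "m \<le> n" for m n x
    unfolding PD[OF that] using p by (intro norm_le_of_schatten_power_sum[OF cD D_tail[OF that] \<delta>0]) simp
  have "Cauchy (\<lambda>n. P n x)" for x
    unfolding Cauchy_altdef2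
  proof (intro allI impI)
    fix \<epsilon> :: real assume "\<epsilon> > 0"
    have "(\<lambda>m. \<delta> m powr (1 / p) * norm x) \<longlonglongrightarrow> 0"
      using tendsto_mult_right[OF \<delta>_root, of "norm x"] by simp
    then have "\<forall>\<^sub>F m in sequentially. \<delta> m powr (1 / p) * norm x < \<epsilon>"
      using \<open>\<epsilon> > 0\<close> by (rule order_tendstoD(2))
    then obtain m where "\<delta> m powr (1 / p) * norm x < \<epsilon>"
      by (auto simp: eventually_sequentially)
    then show "\<exists>m. \<forall>n\<ge>m. dist (P n x) (P m x) < \<epsilon>"
      using P_diff[of m] by (auto simp: dist_norm intro: le_less_trans)
  qed
  then have "\<exists>L. (\<lambda>n. P n x) \<longlonglongrightarrow> L" for x
    using Cauchy_convergent convergentD by blast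
  then obtain S where S: "\<And>x. (\<lambda>n. P n x) \<longlonglongrightarrow> S x" by metis
  have linS: "clinear S"
  proof (rule clinearI)
    fix x y and c
    have "(\<lambda>n. P n x + P n y) \<longlonglongrightarrow> S x + S y" by (intro tendsto_add S)
    then show "S (x + y) = S x + S y"
      using S[of "x + y"] by (simp add: clinear_add[OF compact_operator_clinear[OF cP]] LIMSEQ_unique)
    have "(\<lambda>n. c *\<^sub>C P n x) \<longlonglongrightarrow> c *\<^sub>C S x" by (intro tendsto_scaleC tendsto_const S)
    then show "S (c *\<^sub>C x) = c *\<^sub>C S x"
      using S[of "c *\<^sub>C x"] by (simp add: clinear_scaleC[OF compact_operator_clinear[OF cP]] LIMSEQ_unique)
  qed
  have PS: "norm (P m x - S x) \<le> \<delta> m powr (1 / p) * norm x" for m x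
  proof (rule Lim_bounded)
    show "(\<lambda>n. norm (P m x - P n x)) \<longlonglongrightarrow> norm (P m x - S x)" by (intro tendsto_intros S)
    show "\<forall>n\<ge>m. norm (P m x - P n x) \<le> \<delta> m powr (1 / p) * norm x"
      using P_diff by (subst norm_minus_commute) blast
  qed
  have cS: "compact_operator S"
  proof (rule compact_operator_limit[OF cP linS])
    fix \<epsilon> :: real assume "\<epsilon> > 0"
    then have "\<forall>\<^sub>F m in sequentially. \<delta> m powr (1 / p) < \<epsilon>" by (rule order_tendstoD(2)[OF \<delta>_root])
    then obtain m where m: "\<delta> m powr (1 / p) < \<epsilon>" by (auto simp: eventually_sequentially)
    have "norm (P m x - S x) \<le> \<epsilon>" if "norm x \<le> 1" for x
    proof -
      have "norm (P m x - S x) \<le> \<delta> m powr (1 / p) * 1"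
        using that by (intro order_trans[OF PS] mult_left_mono) auto
      with m show ?thesis by simp
    qed
    then show "\<exists>n. \<forall>x. norm x \<le> 1 \<longrightarrow> norm (P n x - S x) \<le> \<epsilon>" by blast
  qed
  \<comment> \<open>For fixed finite test systems the sum depends continuously on pointwise limits,
    so the bound for partial sums survives \<open>k\<close> tending to infinity. This transfers the
    Schatten estimates to \<open>S\<close>.\<close>
  have diff_sum: "(\<Sum>a<n. cmod (cinner (P m (x a) - S (x a)) (y a)) powr p) \<le> \<delta> m"
    if xy: "ortho x" "ortho y" for m n x y
  proof (rule Lim_bounded)
    show "(\<lambda>k. \<Sum>a<n. cmod (cinner (P m (x a) - P k (x a)) (y a)) powr p)
        \<longlonglongrightarrow> (\<Sum>a<n. cmod (cinner (P m (x a) - S (x a)) (y a)) powr p)"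
      using p by (intro tendsto_sum tendsto_powr' tendsto_norm tendsto_cinner tendsto_diff tendsto_const S) auto
    show "\<forall>k\<ge>m. (\<Sum>a<n. cmod (cinner (P m (x a) - P k (x a)) (y a)) powr p) \<le> \<delta> m"
    proof (intro allI impI)
      fix k assume k: "m \<le> k"
      have "ennreal (\<Sum>a<n. cmod (cinner (D m k (x a)) (y a)) powr p) \<le> ennreal (\<delta> m)"
        using schatten_power_sum_ge[OF cD _ _ bessel_ortho[OF xy(1)] bessel_ortho[OF xy(2)], of p "{..<n}" m k]
          D_tail[OF k] p by (auto intro: order_trans)
      moreover have "cmod (cinner (P m z - P k z) w) = cmod (cinner (D m k z) w)" for z w
        unfolding PD[OF k, symmetric] cinner_diff_left by (rule norm_minus_commute)
      ultimately show "(\<Sum>a<n. cmod (cinner (P m (x a) - P k (x a)) (y a)) powr p) \<le> \<delta> m"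
        using \<delta>0 by simp
    qed
  qed
  have cPS: "compact_operator (\<lambda>x. P m x - S x)" for m by (rule compact_operator_diff[OF cP cS])
  have PS_en: "schatten_ennorm p (\<lambda>x. P m x - S x) \<le> ennreal (\<delta> m powr (1 / p))" for m
    using p by (intro schatten_ennorm_le cPS schatten_power_sum_le diff_sum \<delta>0) auto
  \<comment> \<open>The case \<open>m = 0\<close> of the tail estimate: \<open>P 0\<close> is the
    empty sum, so the difference is \<open>- S\<close>.\<close>
  have S_en: "schatten_ennorm p S \<le> ennreal (\<delta> 0 powr (1 / p))"
  proof (intro schatten_ennorm_le cS schatten_power_sum_le \<delta>0)
    fix n :: nat and x y :: "nat \<Rightarrow> 'h" assume "ortho x" "ortho y"
    from diff_sum[OF this, where m = 0 and n = n] show "(\<Sum>a<n. cmod (cinner (S (x a)) (y a)) powr p) \<le> \<delta> 0"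
      by (simp add: P_def cinner_minus_left)
  qed (use p in simp)
  have "S \<in> schatten_class p"
    using S_en cS by (auto simp: schatten_class_def le_less_trans)
  moreover have "(\<lambda>n. schatten_ennorm p (\<lambda>x. (\<Sum>j<n. T j x) - S x)) \<longlonglongrightarrow> 0"
  proof (rule tendsto_sandwich[OF _ _ tendsto_const])
    show "(\<lambda>n. ennreal (\<delta> n powr (1 / p))) \<longlonglongrightarrow> 0" using tendsto_ennrealI[OF \<delta>_root] by simp
    show "\<forall>\<^sub>F n in sequentially. schatten_ennorm p (\<lambda>x. (\<Sum>j<n. T j x) - S x) \<le> ennreal (\<delta> n powr (1 / p))"
      using PS_en by (simp add: P_def)
  qed simp
  moreover have "schatten_norm p S \<le> N powr (1 / p') * suminf \<tau> powr (1 / p)"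
  proof -
    have "schatten_norm p S \<le> \<delta> 0 powr (1 / p)"
      unfolding schatten_norm_def using S_en by (metis enn2real_mono enn2real_ennreal ennreal_less_top powr_ge_zero)
    also have "\<dots> = N powr (1 / p') * suminf \<tau> powr (1 / p)"
      using \<tau> suminf_nonneg[OF \<tau>(2)] by (simp add: \<delta>_def G_def powr_mult powr_powr assms(3))
    finally show ?thesis .
  qed
  ultimately show ?thesis
    unfolding schatten_sums_def N_def \<tau>_def by blast
qed

end
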